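(* Let $K$ be a field and let $L$ be a simple planar distributive lattice. Then $\operatorname{reg} R(L)$ equals the maximal number of squares in a cyclic sublattice of $L$.
   Context: For a finite distributive lattice $L$, let $K[L]$ be the polynomial ring over $K$ whose variables are the elements of $L$; $I_L\subset K[L]$ is generated by $ab-(a\vee b)(a\wedge b)$ for all incomparable $a,b\in L$, $R(L)=K[L]/I_L$, and $\operatorname{reg} R(L)$ is its Castelnuovo–Mumford regularity as a graded $K[L]$-module. $\mathbb{N}^2$ is ordered componentwise. A planar distributive lattice is a finite sublattice $L$ of $\mathbb{N}^2$ with $(0,0)\in L$ such that for any $(i,j)\le(k,\ell)$ in $L$ there is a chain $x_0<x_1<\dots<x_t$ in $L$ from $(i,j)$ to $(k,\ell)$ in which the coordinate sum increases by exactly $1$ at each step. A cut edge of a graded lattice is a pair $(a,b)$ with $\operatorname{rank} b=\operatorname{rank} a+1$ such that $a$ is the only element of its rank and $b$ is the only element of its rank; $L$ is simple if it has no cut edge. A square is a sublattice $\{a,b,c,d\}$ with $a\to b\to d$, $a\to c\to d$ (covering relations) and $b,c$ incomparable. A cyclic sublattice is a sublattice consisting of squares $Q_1,\dots,Q_m$ arranged consecutively, the top of $Q_i$ either equal to the bottom of $Q_{i+1}$ or joined to it by a saturated chain of cut edges (of the sublattice). *)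

theory Defs
  imports Main "HOL-Library.Poly_Mapping"
begin

type_synonym pt = "nat \<times> nat"

definition le2 :: "pt \<Rightarrow> pt \<Rightarrow> bool" where
  "le2 x y \<longleftrightarrow> fst x \<le> fst y \<and> snd x \<le> snd y"

definition lt2 :: "pt \<Rightarrow> pt \<Rightarrow> bool" where
  "lt2 x y \<longleftrightarrow> le2 x y \<and> x \<noteq> y"

definition join2 :: "pt \<Rightarrow> pt \<Rightarrow> pt" where
  "join2 x y = (max (fst x) (fst y), max (snd x) (snd y))"

definition meet2 :: "pt \<Rightarrow> pt \<Rightarrow> pt" where
  "meet2 x y = (min (fst x) (fst y), min (snd x) (snd y))"

definition is_sublattice2 :: "pt set \<Rightarrow> bool" where
  "is_sublattice2 M \<longleftrightarrow> (\<forall>x\<in>M. \<forall>y\<in>M. join2 x y \<in> M \<and> meet2 x y \<in> M)"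

definition planar_distributive_lattice :: "pt set \<Rightarrow> bool" where
  "planar_distributive_lattice L \<longleftrightarrow>
     finite L \<and> is_sublattice2 L \<and> (0,0) \<in> L \<and>
     (\<forall>x\<in>L. \<forall>y\<in>L. le2 x y \<longrightarrow>
        (\<exists>xs. xs \<noteq> [] \<and> hd xs = x \<and> last xs = y \<and> set xs \<subseteq> L \<and>
              (\<forall>k. Suc k < length xs \<longrightarrow>
                 lt2 (xs ! k) (xs ! Suc k) \<and>
                 fst (xs ! Suc k) + snd (xs ! Suc k) = fst (xs ! k) + snd (xs ! k) + 1)))"

definition covers :: "pt set \<Rightarrow> pt \<Rightarrow> pt \<Rightarrow> bool" where
  "covers M a b \<longleftrightarrow> a \<in> M \<and> b \<in> M \<and> lt2 a b \<and> \<not> (\<exists>c\<in>M. lt2 a c \<and> lt2 c b)"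

definition rank_in :: "pt set \<Rightarrow> pt \<Rightarrow> nat" where
  "rank_in M x = Max {length xs - 1 | xs. xs \<noteq> [] \<and> set xs \<subseteq> M \<and> last xs = x \<and>
                        (\<forall>k. Suc k < length xs \<longrightarrow> lt2 (xs ! k) (xs ! Suc k))}"

definition cut_edge :: "pt set \<Rightarrow> pt \<Rightarrow> pt \<Rightarrow> bool" where
  "cut_edge M a b \<longleftrightarrow> covers M a b \<and> rank_in M b = rank_in M a + 1 \<and>
     {c \<in> M. rank_in M c = rank_in M a} = {a} \<and>
     {c \<in> M. rank_in M c = rank_in M b} = {b}"

definition simple_lattice :: "pt set \<Rightarrow> bool" where
  "simple_lattice L \<longleftrightarrow> \<not> (\<exists>a b. cut_edge L a b)"

definition is_square :: "pt set \<Rightarrow> pt \<times> pt \<times> pt \<times> pt \<Rightarrow> bool" where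
  "is_square L q = (case q of (a,b,c,d) \<Rightarrow>
      is_sublattice2 {a,b,c,d} \<and> {a,b,c,d} \<subseteq> L \<and>
      covers L a b \<and> covers L b d \<and> covers L a c \<and> covers L c d \<and>
      \<not> le2 b c \<and> \<not> le2 c b)"

definition sq_bot :: "pt \<times> pt \<times> pt \<times> pt \<Rightarrow> pt" where
  "sq_bot q = (case q of (a,b,c,d) \<Rightarrow> a)"
definition sq_top :: "pt \<times> pt \<times> pt \<times> pt \<Rightarrow> pt" where
  "sq_top q = (case q of (a,b,c,d) \<Rightarrow> d)"
definition sq_set :: "pt \<times> pt \<times> pt \<times> pt \<Rightarrow> pt set" where
  "sq_set q = (case q of (a,b,c,d) \<Rightarrow> {a,b,c,d})"

definition cyclic_sublattice :: "pt set \<Rightarrow> pt set \<Rightarrow> nat \<Rightarrow> bool" where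
  "cyclic_sublattice L C m \<longleftrightarrow>
     C \<subseteq> L \<and> is_sublattice2 C \<and>
     (\<exists>q :: nat \<Rightarrow> pt \<times> pt \<times> pt \<times> pt. \<exists>ch :: nat \<Rightarrow> pt list.
        (\<forall>i<m. is_square L (q i)) \<and>
        (\<forall>i. Suc i < m \<longrightarrow>
           ch i \<noteq> [] \<and> hd (ch i) = sq_top (q i) \<and> last (ch i) = sq_bot (q (Suc i)) \<and>
           (\<forall>k. Suc k < length (ch i) \<longrightarrow> cut_edge C (ch i ! k) (ch i ! Suc k))) \<and>
        C = (\<Union>i<m. sq_set (q i)) \<union> (\<Union>i\<in>{i. Suc i < m}. set (ch i)))"

definition max_cyclic_squares :: "pt set \<Rightarrow> nat" where
  "max_cyclic_squares L = Max {m. \<exists>C. cyclic_sublattice L C m}"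

type_synonym 'k mpoly = "(pt \<Rightarrow>\<^sub>0 nat) \<Rightarrow>\<^sub>0 'k"

definition Var :: "pt \<Rightarrow> ('k::field) mpoly" where
  "Var a = Poly_Mapping.single (Poly_Mapping.single a 1) 1"

definition polyring :: "pt set \<Rightarrow> ('k::field) mpoly set" where
  "polyring L = {p. \<forall>m\<in>Poly_Mapping.keys p. Poly_Mapping.keys m \<subseteq> L}"

definition mdeg :: "(pt \<Rightarrow>\<^sub>0 nat) \<Rightarrow> nat" where
  "mdeg m = (\<Sum>v\<in>Poly_Mapping.keys m. Poly_Mapping.lookup m v)"

text \<open>Homogeneous of (integer) degree e; the zero polynomial is homogeneous of every degree.\<close>
definition homog :: "('k::field) mpoly \<Rightarrow> int \<Rightarrow> bool" where
  "homog p e \<longleftrightarrow> (\<forall>m\<in>Poly_Mapping.keys p. int (mdeg m) = e)"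

definition hibi_gens :: "pt set \<Rightarrow> ('k::field) mpoly set" where
  "hibi_gens L = {Var a * Var b - Var (join2 a b) * Var (meet2 a b) | a b.
                    a \<in> L \<and> b \<in> L \<and> \<not> le2 a b \<and> \<not> le2 b a}"

definition ideal_gen :: "('k::field) mpoly set \<Rightarrow> 'k mpoly set \<Rightarrow> 'k mpoly set" where
  "ideal_gen S G = {p. \<exists>(n::nat) c g. (\<forall>j<n. c j \<in> S \<and> g j \<in> G) \<and> p = (\<Sum>j<n. c j * g j)}"

definition hibi_ideal :: "pt set \<Rightarrow> ('k::field) mpoly set" where
  "hibi_ideal L = ideal_gen (polyring L) (hibi_gens L)"

definition freemod :: "pt set \<Rightarrow> nat \<Rightarrow> (nat \<Rightarrow> ('k::field) mpoly) set" where
  "freemod L r = {v. (\<forall>k<r. v k \<in> polyring L) \<and> (\<forall>k\<ge>r. v k = 0)}"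

definition dmap :: "(nat \<Rightarrow> nat) \<Rightarrow> (nat \<Rightarrow> nat \<Rightarrow> nat \<Rightarrow> ('k::field) mpoly) \<Rightarrow> nat \<Rightarrow>
                    (nat \<Rightarrow> 'k mpoly) \<Rightarrow> (nat \<Rightarrow> 'k mpoly)" where
  "dmap r D i v = (\<lambda>l. if l < r (i - 1) then (\<Sum>k<r i. D i l k * v k) else 0)"

text \<open>A finite graded free resolution of R(L) = K[L]/I_L:
  0 \<rightarrow> F_n \<rightarrow> ... \<rightarrow> F_1 \<rightarrow> F_0 = K[L] \<rightarrow> R(L) \<rightarrow> 0,
  F_i = \<Oplus>_{k < r i} K[L](- a i k), with d_i given by the matrix D i of homogeneous
  polynomials of degree a i k - a (i-1) l.\<close>
definition graded_free_resolution ::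
  "pt set \<Rightarrow> (nat \<Rightarrow> nat) \<Rightarrow> (nat \<Rightarrow> nat \<Rightarrow> int) \<Rightarrow> (nat \<Rightarrow> nat \<Rightarrow> nat \<Rightarrow> ('k::field) mpoly) \<Rightarrow> bool"
  where
  "graded_free_resolution L r a D \<longleftrightarrow>
     r 0 = 1 \<and> a 0 0 = 0 \<and> (\<exists>n. \<forall>i>n. r i = 0) \<and>
     (\<forall>i\<ge>1. \<forall>l<r (i - 1). \<forall>k<r i. D i l k \<in> polyring L \<and> homog (D i l k) (a i k - a (i - 1) l)) \<and>
     dmap r D 1 ` freemod L (r 1) = {v \<in> freemod L 1. v 0 \<in> hibi_ideal L} \<and>
     (\<forall>i\<ge>1. {v \<in> freemod L (r i). dmap r D i v = (\<lambda>_. 0)} = dmap r D (Suc i) ` freemod L (r (Suc i)))"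

definition resolution_reg :: "(nat \<Rightarrow> nat) \<Rightarrow> (nat \<Rightarrow> nat \<Rightarrow> int) \<Rightarrow> int" where
  "resolution_reg r a = Max {a i k - int i | i k. k < r i}"

text \<open>Castelnuovo-Mumford regularity of R(L) over the field 'k: the minimum over all
  finite graded free resolutions of max_{i,k} (a i k - i); this minimum is attained by the
  minimal graded free resolution.\<close>
definition reg_hibi :: "'k::field itself \<Rightarrow> pt set \<Rightarrow> int" where
  "reg_hibi TYPE('k) L = Inf {resolution_reg r a | r a (D :: nat \<Rightarrow> nat \<Rightarrow> nat \<Rightarrow> 'k mpoly).
                               graded_free_resolution L r a D}"

end

theory Submission
  imports Defs "HOL-Library.Function_Algebras" "HOL-Library.Product_Lexorder"
begin

text \<open>
  Straightening makes the monomials supported on chains a vector space basis of \<open>R(L)\<close>. A chain in \<open>L\<close>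
  is contained in a rightmost maximal lattice path, and the corners of that path that can be flipped
  to the right are the upper left corners of a stack of squares. Sending a chain monomial to its
  corners and the ranks of its remaining factors is a bijection, and triangularity turns it into the
  statement that \<open>R(L)\<close> is a free module over \<open>A = K[\<theta>_0, ..., \<theta>_d]\<close>, where \<open>\<theta>_r\<close> is the sum of the
  variables of rank \<open>r\<close>, with one basis element of degree \<open>k\<close> for every stack of \<open>k\<close> squares.

  After a linear change of coordinates \<open>K[L] = A[Y]\<close>. Every \<open>y \<in> Y\<close> acts on \<open>R(L)\<close> by a matrix \<open>C_y\<close>
  over \<open>A\<close>, and the Koszul complex of the commuting operators \<open>y - C_y\<close> on \<open>K[L] \<otimes>_A R(L)\<close> is a finite
  free resolution. Its generators in position \<open>i\<close> have degree at most \<open>i + m\<close>, where \<open>m\<close> is the largest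
  size of a stack. In the last position \<open>c = card Y\<close> there is a generator of degree \<open>c + m\<close>, which no
  resolution can avoid: comparing two resolutions, the identity would be homotopic to a map that
  vanishes on this generator modulo the variables.
\<close>

text \<open>Freeness over \<open>A\<close> makes the Cohen-Macaulay property explicit: the rank sums
  form a linear system of parameters, and the number of basis elements of degree k is the k-th
  coefficient of the h-polynomial. The theorem then says that the regularity is the degree of this
  polynomial.

  The regularity is defined as an infimum over all finite graded free resolutions, and no minimal
  one is constructed. The Koszul complex has one generator in position 0 for every stack, whereas a
  resolution of a quotient of K[L] must have exactly one there; repairing this adds redundant
  generators. The lower bound therefore has to be read off a resolution that is not minimal. This
  works at the generator of degree \<open>c + m\<close> in position \<open>c\<close> because its
  neighbours have other degrees: at most \<open>c - 1 + m\<close> in position \<open>c - 1\<close>,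
  and at most \<open>m\<close> for whatever the repair leaves in position \<open>c + 1\<close>.
  Hence no nonzero constant stands next to it in the matrices.\<close>

abbreviation lookup :: "('a \<Rightarrow>\<^sub>0 'b::zero) \<Rightarrow> 'a \<Rightarrow> 'b" where "lookup \<equiv> Poly_Mapping.lookup"
abbreviation keys :: "('a \<Rightarrow>\<^sub>0 'b::zero) \<Rightarrow> 'a set" where "keys \<equiv> Poly_Mapping.keys"
abbreviation single :: "'a \<Rightarrow> 'b \<Rightarrow> ('a \<Rightarrow>\<^sub>0 'b::zero)" where "single \<equiv> Poly_Mapping.single"

type_synonym mon = "pt \<Rightarrow>\<^sub>0 nat"

section \<open>Polynomials as finitely supported functions\<close>

lemma sum_single_keys: "(\<Sum>m\<in>keys p. single m (lookup p m)) = p"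
  by (rule poly_mapping_eqI)
    (auto simp: lookup_sum lookup_single when_def not_in_keys_iff_lookup_eq_zero)

lemma poly_mapping_add_induct [case_names zero single add]:
  fixes p :: "'a \<Rightarrow>\<^sub>0 'b::comm_monoid_add"
  assumes "P 0" "\<And>m c. P (single m c)" "\<And>p q. P p \<Longrightarrow> P q \<Longrightarrow> P (p + q)"
  shows "P p"
proof -
  have "P (\<Sum>m\<in>A. single m (lookup p m))" if "finite A" for A
    using that by (induction A) (auto intro: assms)
  from this[of "keys p"] show ?thesis by (simp add: sum_single_keys)
qed

lemma keys_plus_nat: "keys (m + n :: 'a \<Rightarrow>\<^sub>0 nat) = keys m \<union> keys n"
  by (auto simp: in_keys_iff lookup_add)

lemma lookup_single_times:
  fixes p :: "'k::field mpoly"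
  shows "lookup (single m c * p) (m + n) = c * lookup p n"
proof (induction p rule: poly_mapping_add_induct)
  case zero
  then show ?case by simp
next
  case (single m' c')
  then show ?case by (auto simp: mult_single lookup_single when_def)
next
  case (add p q)
  then show ?case by (simp add: lookup_add algebra_simps)
qed

lemma keys_single_times:
  fixes p :: "'k::field mpoly"
  shows "keys (single m c * p) \<subseteq> (+) m ` keys p"
  using keys_mult[of "single m c" p] by (auto split: if_splits)

lemma keys_Var_times:
  fixes p :: "'k::field mpoly"
  shows "keys (Var y * p) = (\<lambda>n. single y 1 + n) ` keys p"
proof -
  have "n \<in> keys p \<Longrightarrow> single y 1 + n \<in> keys (Var y * p)" for n
    using lookup_single_times[of "single y 1" 1 p n] by (simp add: Var_def in_keys_iff)
  with keys_single_times[of "single y 1" 1 p] show ?thesis by (auto simp: Var_def)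
qed

lemma single_plus_minus:
  assumes "a \<in> keys m" shows "single a 1 + (m - single a 1) = (m :: 'a \<Rightarrow>\<^sub>0 nat)"
  using assms by (intro poly_mapping_eqI) (auto simp: lookup_add lookup_minus lookup_single when_def in_keys_iff)

lemma lookup_Var_times:
  fixes p :: "'k::field mpoly"
  shows "lookup (Var a * p) m = (if a \<in> keys m then lookup p (m - single a 1) else 0)"
proof (cases "a \<in> keys m")
  case True
  then show ?thesis using lookup_single_times[of "single a 1" 1 p "m - single a 1"]
    by (simp only: single_plus_minus Var_def if_True mult_1_left)
next
  case False
  then have "m \<notin> keys (Var a * p)" by (auto simp: keys_Var_times keys_plus_nat)
  then show ?thesis using False by (simp add: in_keys_iff)
qed

subsection \<open>The subring on a set of variables\<close>

lemma polyring_mono: "A \<subseteq> B \<Longrightarrow> p \<in> polyring A \<Longrightarrow> p \<in> polyring B"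
  by (fastforce simp: polyring_def)

lemma polyring_0 [simp]: "0 \<in> polyring A"
  by (simp add: polyring_def)

lemma polyring_add [intro]: "p \<in> polyring A \<Longrightarrow> q \<in> polyring A \<Longrightarrow> p + q \<in> polyring A"
  using Poly_Mapping.keys_add[of p q] by (fastforce simp: polyring_def)

lemma polyring_uminus [intro]: "p \<in> polyring A \<Longrightarrow> - p \<in> polyring A"
  by (simp add: polyring_def)

lemma polyring_diff [intro]: "p \<in> polyring A \<Longrightarrow> q \<in> polyring A \<Longrightarrow> p - q \<in> polyring A"
  using polyring_add[of p A "- q"] polyring_uminus[of q A] by simp

lemma polyring_times [intro]: "p \<in> polyring A \<Longrightarrow> q \<in> polyring A \<Longrightarrow> p * q \<in> polyring A"
  using keys_mult[of p q] by (fastforce simp: polyring_def keys_plus_nat)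

lemma polyring_single [intro]: "keys m \<subseteq> A \<Longrightarrow> single m c \<in> polyring A"
  by (simp add: polyring_def)

lemma polyring_1 [simp]: "1 \<in> polyring A"
  by (metis empty_subsetI keys_zero polyring_single single_one)

lemma polyring_Var [intro]: "a \<in> A \<Longrightarrow> Var a \<in> polyring A"
  by (simp add: Var_def polyring_def)

lemma polyring_sum [intro]: "(\<And>i. i \<in> I \<Longrightarrow> f i \<in> polyring A) \<Longrightarrow> sum f I \<in> polyring A"
  by (induction I rule: infinite_finite_induct) auto

lemma polyring_prod [intro]: "(\<And>i. i \<in> I \<Longrightarrow> f i \<in> polyring A) \<Longrightarrow> prod f I \<in> polyring A"
  by (induction I rule: infinite_finite_induct) auto

lemma polyring_power [intro]: "p \<in> polyring A \<Longrightarrow> p ^ k \<in> polyring A"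
  by (induction k) auto

subsection \<open>Weighted degrees\<close>

text \<open>One notion covers the degree (weight 1), \<open>spread\<close> (squared rank), the sum
  of first coordinates (weight \<open>fst\<close>) and, through indicator weights, single exponents.
  Equality for all weights that factor through a function of the variables compares multisets of its
  values.\<close>

definition wsum :: "('a \<Rightarrow> nat) \<Rightarrow> ('a \<Rightarrow>\<^sub>0 nat) \<Rightarrow> nat" where
  "wsum w m = (\<Sum>a\<in>keys m. lookup m a * w a)"

lemma wsum_superset: "finite A \<Longrightarrow> keys m \<subseteq> A \<Longrightarrow> wsum w m = (\<Sum>a\<in>A. lookup m a * w a)"
  unfolding wsum_def by (intro sum.mono_neutral_left) (auto simp: in_keys_iff)

lemma wsum_0 [simp]: "wsum w 0 = 0"
  by (simp add: wsum_def)

lemma wsum_add: "wsum w (m + n) = wsum w m + wsum w n"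
  by (simp add: wsum_superset[of "keys m \<union> keys n"] keys_plus_nat lookup_add algebra_simps sum.distrib)

lemma wsum_single [simp]: "wsum w (single a k) = k * w a"
  by (simp add: wsum_def)

lemma wsum_sum: "wsum w (sum f I) = (\<Sum>i\<in>I. wsum w (f i))"
  by (induction I rule: infinite_finite_induct) (auto simp: wsum_add)

lemma wsum_cong: "(\<And>a. a \<in> keys m \<Longrightarrow> w a = w' a) \<Longrightarrow> wsum w m = wsum w' m"
  by (simp add: wsum_def)

lemma wsum_less:
  assumes "\<And>a. a \<in> keys m \<Longrightarrow> w a \<le> w' a" "b \<in> keys m" "w b < w' b"
  shows "wsum w m < wsum w' m"
  unfolding wsum_def using assms
  by (intro sum_strict_mono_ex1) (auto simp: in_keys_iff intro!: bexI[of _ b])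

lemma mdeg_wsum: "mdeg m = wsum (\<lambda>_. 1) m"
  by (simp add: mdeg_def wsum_def)

lemma mdeg_add: "mdeg (m + n) = mdeg m + mdeg n"
  by (simp add: mdeg_wsum wsum_add)

lemma mdeg_0 [simp]: "mdeg 0 = 0"
  by (simp add: mdeg_def)

lemma mdeg_single [simp]: "mdeg (single a k) = k"
  by (simp add: mdeg_wsum)

lemma mdeg_eq_0_iff: "mdeg m = 0 \<longleftrightarrow> m = 0"
  by (metis finite_keys in_keys_iff keys_eq_empty mdeg_0 mdeg_def sum_eq_0_iff all_not_in_conv)

subsection \<open>Homogeneous components\<close>

lemma homog_0 [simp]: "homog 0 e"
  by (simp add: homog_def)

lemma homog_add: "homog p e \<Longrightarrow> homog q e \<Longrightarrow> homog (p + q) e"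
  using Poly_Mapping.keys_add[of p q] by (fastforce simp: homog_def)

lemma homog_uminus: "homog p e \<Longrightarrow> homog (- p) e"
  by (simp add: homog_def)

lemma homog_diff: "homog p e \<Longrightarrow> homog q e \<Longrightarrow> homog (p - q) e"
  using homog_add[of p e "- q"] homog_uminus[of q e] by simp

lemma homog_sum: "(\<And>i. i \<in> I \<Longrightarrow> homog (f i) e) \<Longrightarrow> homog (sum f I) e"
  by (induction I rule: infinite_finite_induct) (auto intro: homog_add)

lemma homog_times: "homog p d \<Longrightarrow> homog q e \<Longrightarrow> homog (p * q) (d + e)"
  using keys_mult[of p q] by (fastforce simp: homog_def mdeg_add)

lemma homog_single: "int (mdeg m) = e \<Longrightarrow> homog (single m c) e"
  by (simp add: homog_def)

lemma homog_1 [simp]: "homog 1 0"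
  by (metis homog_single mdeg_0 of_nat_0 single_one)

lemma homog_Var [simp]: "homog (Var a) 1"
  by (simp add: Var_def homog_single)

lemma homog_power: "homog p d \<Longrightarrow> homog (p ^ k) (int k * d)"
proof (induction k)
  case (Suc k)
  then show ?case using homog_times[of p d "p ^ k" "int k * d"] by (simp add: algebra_simps)
qed simp

lemma homog_const_0:
  assumes "homog p e" "e \<noteq> 0" shows "lookup p 0 = 0"
  using assms by (auto simp: homog_def simp flip: not_in_keys_iff_lookup_eq_zero)

definition hcomp :: "int \<Rightarrow> 'k::field mpoly \<Rightarrow> 'k mpoly" where
  "hcomp e p = Poly_Mapping.mapp (\<lambda>m c. if int (mdeg m) = e then c else 0) p"

lemma lookup_hcomp: "lookup (hcomp e p) m = (if int (mdeg m) = e then lookup p m else 0)"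
  by (auto simp: hcomp_def lookup_mapp when_def in_keys_iff)

lemma keys_hcomp: "keys (hcomp e p) = {m \<in> keys p. int (mdeg m) = e}"
  by (auto simp: in_keys_iff lookup_hcomp split: if_splits)

lemma homog_hcomp [simp]: "homog (hcomp e p) e"
  by (simp add: homog_def keys_hcomp)

lemma polyring_hcomp [intro]: "p \<in> polyring A \<Longrightarrow> hcomp e p \<in> polyring A"
  by (simp add: polyring_def keys_hcomp)

lemma hcomp_0 [simp]: "hcomp e 0 = 0"
  by (rule poly_mapping_eqI) (simp add: lookup_hcomp)

lemma hcomp_add: "hcomp e (p + q) = hcomp e p + hcomp e q"
  by (rule poly_mapping_eqI) (simp add: lookup_hcomp lookup_add)

lemma hcomp_diff: "hcomp e (p - q) = hcomp e p - hcomp e q"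
  by (rule poly_mapping_eqI) (simp add: lookup_hcomp lookup_minus)

lemma hcomp_sum: "hcomp e (sum f I) = (\<Sum>i\<in>I. hcomp e (f i))"
  by (induction I rule: infinite_finite_induct) (auto simp: hcomp_add)

lemma hcomp_homog: "homog p d \<Longrightarrow> hcomp e p = (if d = e then p else 0)"
  by (rule poly_mapping_eqI) (auto simp: lookup_hcomp homog_def in_keys_iff)

lemma homog_iff_hcomp: "homog p e \<longleftrightarrow> hcomp e p = p"
  by (metis hcomp_homog homog_hcomp)

text \<open>Once its component of degree \<open>e - d\<close> is removed, q has no monomial of that
  degree, and multiplication by p shifts every degree by d.\<close>

lemma hcomp_times:
  assumes "homog p d" shows "hcomp e (p * q) = p * hcomp (e - d) q"
proof -
  define r where "r = q - hcomp (e - d) q"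
  have "m \<notin> keys (p * r)" if "int (mdeg m) = e" for m
  proof
    assume "m \<in> keys (p * r)"
    then obtain a b where "a \<in> keys p" "b \<in> keys r" "m = a + b" using keys_mult by blast
    with assms that have "int (mdeg b) = e - d" "b \<in> keys r" by (auto simp: homog_def mdeg_add)
    then show False by (simp add: r_def in_keys_iff lookup_minus lookup_hcomp)
  qed
  then have "hcomp e (p * r) = 0"
    by (intro poly_mapping_eqI) (auto simp: lookup_hcomp in_keys_iff)
  moreover have "p * q = p * hcomp (e - d) q + p * r" by (simp add: r_def algebra_simps)
  moreover have "homog (p * hcomp (e - d) q) e" using homog_times[OF assms homog_hcomp[of "e - d" q]] by simp
  ultimately show ?thesis by (simp add: hcomp_add hcomp_homog)
qed

text \<open>The constant term is reduction modulo the variables. The comparison of resolutions ends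
  with an entrywise computation there.\<close>

lemma lookup_times_0:
  fixes p q :: "'k::field mpoly"
  shows "lookup (p * q) 0 = lookup p 0 * lookup q 0"
proof -
  have "lookup (single m c * q) 0 = lookup (single m c) 0 * lookup q 0" for m c
  proof (cases "m = 0")
    case True
    then show ?thesis using lookup_single_times[of 0 c q 0] by simp
  next
    case False
    have "0 \<notin> (+) m ` keys q" using False
      by (metis imageE keys_plus_nat keys_zero keys_eq_empty Un_empty)
    then have "0 \<notin> keys (single m c * q)" using keys_single_times by blast
    then show ?thesis using False by (simp add: in_keys_iff lookup_single)
  qed
  then show ?thesis
    by (induction p rule: poly_mapping_add_induct) (auto simp: lookup_add algebra_simps)
qed

subsection \<open>Substitution\<close>

definition mon_eval :: "(pt \<Rightarrow> 'k::field mpoly) \<Rightarrow> mon \<Rightarrow> 'k mpoly" where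
  "mon_eval f m = (\<Prod>v\<in>keys m. f v ^ lookup m v)"

definition subst :: "(pt \<Rightarrow> 'k::field mpoly) \<Rightarrow> 'k mpoly \<Rightarrow> 'k mpoly" where
  "subst f p = (\<Sum>m\<in>keys p. single 0 (lookup p m) * mon_eval f m)"

lemma mon_eval_superset:
  "finite A \<Longrightarrow> keys m \<subseteq> A \<Longrightarrow> mon_eval f m = (\<Prod>v\<in>A. f v ^ lookup m v)"
  unfolding mon_eval_def by (intro prod.mono_neutral_left) (auto simp: in_keys_iff)

lemma mon_eval_add: "mon_eval f (m + n) = mon_eval f m * mon_eval f n"
  by (simp add: mon_eval_superset[of "keys m \<union> keys n"] keys_plus_nat lookup_add
      power_add prod.distrib)

lemma mon_eval_0 [simp]: "mon_eval f 0 = 1"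
  by (simp add: mon_eval_def)

lemma mon_eval_single [simp]: "mon_eval f (single a k) = f a ^ k"
  by (simp add: mon_eval_def)

lemma subst_superset:
  "finite A \<Longrightarrow> keys p \<subseteq> A \<Longrightarrow> subst f p = (\<Sum>m\<in>A. single 0 (lookup p m) * mon_eval f m)"
  unfolding subst_def by (intro sum.mono_neutral_left) (auto simp: in_keys_iff)

lemma subst_add: "subst f (p + q) = subst f p + subst f q"
  using Poly_Mapping.keys_add[of p q]
  by (simp add: subst_superset[of "keys p \<union> keys q"] lookup_add single_add algebra_simps sum.distrib)

lemma subst_0 [simp]: "subst f 0 = 0"
  by (simp add: subst_def)

lemma subst_uminus: "subst f (- p) = - subst f p"
  using subst_add[of f p "- p"] by (simp add: eq_neg_iff_add_eq_0 add.commute)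

lemma subst_diff: "subst f (p - q) = subst f p - subst f q"
  using subst_add[of f p "- q"] by (simp add: subst_uminus)

lemma subst_sum: "subst f (sum g I) = (\<Sum>i\<in>I. subst f (g i))"
  by (induction I rule: infinite_finite_induct) (auto simp: subst_add)

lemma subst_single: "subst f (single m c) = single 0 c * mon_eval f m"
  by (simp add: subst_superset[of "{m}"])

lemma subst_times: "subst f (p * q) = subst f p * subst f q"
proof (induction p rule: poly_mapping_add_induct)
  case (single m c)
  show ?case
  proof (induction q rule: poly_mapping_add_induct)
    case (single m' c')
    have "single 0 (c * c') = single 0 c * (single 0 c' :: 'a mpoly)" by (simp add: mult_single)
    then show ?case by (simp add: mult_single subst_single mon_eval_add algebra_simps)
  qed (auto simp: subst_add algebra_simps)
qed (auto simp: subst_add algebra_simps)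

lemma subst_1 [simp]: "subst f 1 = 1"
  using subst_single[of f 0 1] by simp

lemma subst_Var [simp]: "subst f (Var a) = f a"
  by (simp add: Var_def subst_single)

lemma subst_power: "subst f (p ^ k) = subst f p ^ k"
  by (induction k) (auto simp: subst_times)

lemma subst_prod: "subst f (prod g I) = (\<Prod>i\<in>I. subst f (g i))"
  by (induction I rule: infinite_finite_induct) (auto simp: subst_times)

lemma subst_const [simp]: "subst f (single 0 c) = single 0 c"
  by (simp add: subst_single)

lemma subst_mon_eval: "subst g (mon_eval f m) = mon_eval (\<lambda>a. subst g (f a)) m"
  by (simp add: mon_eval_def subst_prod subst_power)

lemma subst_subst: "subst g (subst f p) = subst (\<lambda>a. subst g (f a)) p"
  by (simp add: subst_def[of f] subst_sum subst_times subst_mon_eval) (simp add: subst_def)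

lemma mon_eval_Var: "mon_eval Var m = single m 1"
proof -
  have "(\<Prod>v\<in>A. Var v ^ lookup m v) = single (\<Sum>v\<in>A. single v (lookup m v)) (1::'k::field)"
    if "finite A" for A
    using that
  proof (induction A)
    case (insert x A)
    have "Var x ^ k = single (single x k) (1::'k)" for k
      by (induction k) (auto simp: Var_def mult_single simp flip: single_add)
    then show ?case using insert by (simp add: mult_single)
  qed auto
  from this[of "keys m"] show ?thesis by (simp add: mon_eval_def sum_single_keys)
qed

lemma subst_cong:
  assumes "p \<in> polyring A" "\<And>a. a \<in> A \<Longrightarrow> f a = g a" shows "subst f p = subst g p"
proof -
  have "mon_eval f m = mon_eval g m" if "m \<in> keys p" for m
    unfolding mon_eval_def
  proof (intro prod.cong refl)
    fix v assume "v \<in> keys m"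
    then have "v \<in> A" using assms(1) that by (auto simp: polyring_def)
    then show "f v ^ lookup m v = g v ^ lookup m v" by (simp add: assms(2))
  qed
  then show ?thesis by (simp add: subst_def)
qed

lemma subst_id: "subst Var p = p"
  by (simp add: subst_def mon_eval_Var mult_single sum_single_keys)

lemma polyring_mon_eval [intro]:
  "keys m \<subseteq> A \<Longrightarrow> (\<And>a. a \<in> A \<Longrightarrow> f a \<in> polyring B) \<Longrightarrow> mon_eval f m \<in> polyring B"
  unfolding mon_eval_def by (intro polyring_prod polyring_power) auto

lemma polyring_subst [intro]:
  "p \<in> polyring A \<Longrightarrow> (\<And>a. a \<in> A \<Longrightarrow> f a \<in> polyring B) \<Longrightarrow> subst f p \<in> polyring B"
  unfolding subst_def
  by (intro polyring_sum polyring_times polyring_single polyring_mon_eval[of _ A])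
    (auto simp: polyring_def)

lemma homog_mon_eval:
  assumes "\<And>a. a \<in> keys m \<Longrightarrow> homog (f a) 1" shows "homog (mon_eval f m) (int (mdeg m))"
proof -
  have "homog (\<Prod>v\<in>A. f v ^ lookup m v) (int (\<Sum>v\<in>A. lookup m v))" if "finite A" "A \<subseteq> keys m" for A
    using that
  proof (induction A)
    case (insert x A)
    then show ?case
      using homog_times[OF homog_power[of "f x" 1 "lookup m x"], of _ "int (\<Sum>v\<in>A. lookup m v)"] assms
      by auto
  qed auto
  then show ?thesis by (simp add: mon_eval_def mdeg_def)
qed

lemma homog_subst:
  assumes "p \<in> polyring A" "\<And>a. a \<in> A \<Longrightarrow> homog (f a) 1" "homog p e"
  shows "homog (subst f p) e"
  unfolding subst_def
proof (intro homog_sum)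
  fix m assume m: "m \<in> keys p"
  then have "homog (mon_eval f m) (int (mdeg m))"
    using assms by (intro homog_mon_eval) (auto simp: polyring_def)
  moreover have "int (mdeg m) = e" using m assms by (simp add: homog_def)
  ultimately show "homog (single 0 (lookup p m) * mon_eval f m) e"
    using homog_times[OF homog_single[of 0 0 "lookup p m"]] by fastforce
qed

section \<open>Comparison of graded free resolutions\<close>

text \<open>The ideal is a parameter because the resolution is built for the image of the Hibi ideal
  under a change of coordinates and transported back afterwards.\<close>

definition graded_res ::
  "pt set \<Rightarrow> 'k mpoly set \<Rightarrow> (nat \<Rightarrow> nat) \<Rightarrow> (nat \<Rightarrow> nat \<Rightarrow> int) \<Rightarrow>
    (nat \<Rightarrow> nat \<Rightarrow> nat \<Rightarrow> ('k::field) mpoly) \<Rightarrow> bool"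
  where
  "graded_res L J r a D \<longleftrightarrow>
     r 0 = 1 \<and> a 0 0 = 0 \<and> (\<exists>n. \<forall>i>n. r i = 0) \<and>
     (\<forall>i\<ge>1. \<forall>l<r (i - 1). \<forall>k<r i. D i l k \<in> polyring L \<and> homog (D i l k) (a i k - a (i - 1) l)) \<and>
     dmap r D 1 ` freemod L (r 1) = {v \<in> freemod L 1. v 0 \<in> J} \<and>
     (\<forall>i\<ge>1. {v \<in> freemod L (r i). dmap r D i v = (\<lambda>_. 0)} = dmap r D (Suc i) ` freemod L (r (Suc i)))"

lemma graded_free_resolution_iff:
  "graded_free_resolution L = graded_res L (hibi_ideal L)"
  by (simp add: fun_eq_iff graded_free_resolution_def graded_res_def)

text \<open>A map of free modules is stored by its columns, the images \<open>f k\<close> of the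
  unit vectors, so that composition (\<open>lin_lin\<close>) only applies a map to columns.\<close>

definition lin :: "nat \<Rightarrow> (nat \<Rightarrow> nat \<Rightarrow> 'k::field mpoly) \<Rightarrow> (nat \<Rightarrow> 'k mpoly) \<Rightarrow> nat \<Rightarrow> 'k mpoly" where
  "lin n f x = (\<lambda>l. \<Sum>k<n. f k l * x k)"

definition unit :: "nat \<Rightarrow> nat \<Rightarrow> 'k::field mpoly" where
  "unit k = (\<lambda>l. if l = k then 1 else 0)"

text \<open>The cut-off at \<open>r (i - 1)\<close> puts the columns into \<open>freemod\<close>,
  whose vectors vanish beyond the rank.\<close>

definition dcol :: "(nat \<Rightarrow> nat) \<Rightarrow> (nat \<Rightarrow> nat \<Rightarrow> nat \<Rightarrow> 'k::field mpoly) \<Rightarrow> nat \<Rightarrow> nat \<Rightarrow> nat \<Rightarrow> 'k mpoly" where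
  "dcol r D i k = (\<lambda>l. if l < r (i - 1) then D i l k else 0)"

lemma dmap_lin: "dmap r D i = lin (r i) (dcol r D i)"
  by (auto simp: fun_eq_iff dmap_def lin_def dcol_def)

lemma lin_diff: "lin n f (\<lambda>l. x l - y l) = (\<lambda>l. lin n f x l - lin n f y l)"
  by (simp add: lin_def fun_eq_iff algebra_simps sum_subtractf)

lemma lin_diff_left: "lin n (\<lambda>k l. f k l - g k l) x = (\<lambda>l. lin n f x l - lin n g x l)"
  by (simp add: lin_def fun_eq_iff algebra_simps sum_subtractf)

lemma lin_lin: "lin n f (lin m g x) = lin m (\<lambda>k. lin n f (g k)) x"
  by (simp add: lin_def fun_eq_iff sum_distrib_left sum_distrib_right mult.assoc)
    (intro allI sum.swap)

lemma lin_unit: "k < n \<Longrightarrow> lin n f (unit k) = f k"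
  by (simp add: lin_def fun_eq_iff unit_def if_distrib[of "\<lambda>x. _ * x"] cong: if_cong)

lemma lin_cong: "(\<And>k. k < n \<Longrightarrow> f k = g k) \<Longrightarrow> lin n f x = lin n g x"
  by (simp add: lin_def)

lemma lin_0 [simp]: "lin n f (\<lambda>_. 0) = (\<lambda>_. 0)" "lin n (\<lambda>_ _. 0) x = (\<lambda>_. 0)"
  by (simp_all add: lin_def)

lemma lin_unit_id: "x \<in> freemod L n \<Longrightarrow> lin n unit x = x"
  by (auto simp: lin_def fun_eq_iff unit_def freemod_def if_distrib[of "\<lambda>x. x * _"] cong: if_cong)

lemma unit_freemod: "k < n \<Longrightarrow> unit k \<in> freemod L n"
  by (auto simp: unit_def freemod_def)

lemma freemod_lin:
  "x \<in> freemod L n \<Longrightarrow> (\<And>k. k < n \<Longrightarrow> f k \<in> freemod L n') \<Longrightarrow> lin n f x \<in> freemod L n'"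
  by (auto simp: freemod_def lin_def intro!: polyring_sum polyring_times sum.neutral)

lemma freemod_diff:
  "x \<in> freemod L n \<Longrightarrow> y \<in> freemod L n \<Longrightarrow> (\<lambda>l. x l - y l) \<in> freemod L n"
  by (auto simp: freemod_def)

context
  fixes L :: "pt set" and J :: "'k::field mpoly set" and r a D
  assumes res: "graded_res L J r a D"
begin

lemma dcol_freemod: "i \<ge> 1 \<Longrightarrow> k < r i \<Longrightarrow> dcol r D i k \<in> freemod L (r (i - 1))"
  using res by (auto simp: graded_res_def freemod_def dcol_def)

lemma dcol_homog: "i \<ge> 1 \<Longrightarrow> k < r i \<Longrightarrow> homog (dcol r D i k l) (a i k - a (i - 1) l)"
  using res by (auto simp: graded_res_def dcol_def)

lemma dmap_freemod: "i \<ge> 1 \<Longrightarrow> x \<in> freemod L (r i) \<Longrightarrow> dmap r D i x \<in> freemod L (r (i - 1))"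
  unfolding dmap_lin using dcol_freemod by (intro freemod_lin) blast+

lemma dmap_unit_in_range: "k < r (Suc i) \<Longrightarrow>
    dcol r D (Suc i) k \<in> dmap r D (Suc i) ` freemod L (r (Suc i))"
  by (rule image_eqI[of _ _ "unit k"]) (auto simp: dmap_lin lin_unit unit_freemod)

lemma kernel_eq: "i \<ge> 1 \<Longrightarrow> x \<in> freemod L (r i) \<Longrightarrow> dmap r D i x = (\<lambda>_. 0) \<longleftrightarrow>
    x \<in> dmap r D (Suc i) ` freemod L (r (Suc i))"
  using res unfolding graded_res_def by blast

lemma dmap_dmap: "i \<ge> 1 \<Longrightarrow> x \<in> dmap r D (Suc i) ` freemod L (r (Suc i)) \<Longrightarrow> dmap r D i x = (\<lambda>_. 0)"
  using res unfolding graded_res_def by blast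

text \<open>Any preimage can be cut down to the right degree in each coordinate: the matrix entries
  are homogeneous, so the differential commutes with taking components.\<close>

lemma homog_lift:
  assumes w: "w \<in> dmap r D (Suc i) ` freemod L (r (Suc i))"
    and hw: "\<And>l. homog (w l) (e - a i l)"
  shows "\<exists>y \<in> freemod L (r (Suc i)). (\<forall>l. homog (y l) (e - a (Suc i) l)) \<and> dmap r D (Suc i) y = w"
proof -
  obtain y where y: "y \<in> freemod L (r (Suc i))" "w = dmap r D (Suc i) y" using w by blast
  define y' where "y' l = hcomp (e - a (Suc i) l) (y l)" for l
  have "y' \<in> freemod L (r (Suc i))" using y by (auto simp: freemod_def y'_def)
  moreover have "homog (y' l) (e - a (Suc i) l)" for l by (simp add: y'_def)
  moreover have "dmap r D (Suc i) y' l = w l" for l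
  proof -
    have "dmap r D (Suc i) y' l = (\<Sum>k<r (Suc i). dcol r D (Suc i) k l * hcomp (e - a (Suc i) k) (y k))"
      by (simp add: dmap_lin lin_def y'_def)
    also have "\<dots> = (\<Sum>k<r (Suc i). hcomp (e - a i l) (dcol r D (Suc i) k l * y k))"
    proof (intro sum.cong refl)
      fix k assume "k \<in> {..<r (Suc i)}"
      then have "homog (dcol r D (Suc i) k l) (a (Suc i) k - a i l)"
        using dcol_homog[of "Suc i" k l] by simp
      from hcomp_times[OF this, of "e - a i l" "y k"]
      show "dcol r D (Suc i) k l * hcomp (e - a (Suc i) k) (y k) =
          hcomp (e - a i l) (dcol r D (Suc i) k l * y k)" by simp
    qed
    also have "\<dots> = hcomp (e - a i l) (w l)" by (simp add: y dmap_lin lin_def hcomp_sum)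
    also have "\<dots> = w l" using hw homog_iff_hcomp by blast
    finally show ?thesis .
  qed
  ultimately show ?thesis by (intro bexI[of _ y']) auto
qed

end

text \<open>The comparison theorem with degrees. Both complexes resolve the same quotient, so the
  identity works in position 0; above it the images of the generators are lifted one position at a
  time by \<open>homog_lift\<close>.\<close>

lemma chain_map_exists:
  fixes L :: "pt set" and J :: "'k::field mpoly set"
  assumes G: "graded_res L J r a D" and F: "graded_res L J r' a' D'"
  shows "\<exists>\<phi>. \<phi> 0 = unit \<and>
    (\<forall>i. \<forall>k<r' i. \<phi> i k \<in> freemod L (r i) \<and> (\<forall>l. homog (\<phi> i k l) (a' i k - a i l))) \<and>
    (\<forall>i x. lin (r' i) (\<phi> i) (dmap r' D' (Suc i) x) =
       dmap r D (Suc i) (lin (r' (Suc i)) (\<phi> (Suc i)) x))"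
proof -
  define B where "B i = dmap r D (Suc i) ` freemod L (r (Suc i))" for i
  define B' where "B' i = dmap r' D' (Suc i) ` freemod L (r' (Suc i))" for i
  have B0: "B 0 = {v \<in> freemod L 1. v 0 \<in> J}" "B' 0 = {v \<in> freemod L 1. v 0 \<in> J}"
    and r0: "r 0 = 1" "r' 0 = 1" "a 0 0 = 0" "a' 0 0 = 0"
    using G F by (auto simp: graded_res_def B_def B'_def)
  \<comment> \<open>The invariant speaks of boundaries instead of cycles. It then covers position 0
    as well, where the image of the differential is given by the ideal and not by a kernel.\<close>
  define P where "P i f \<longleftrightarrow> (\<forall>k<r' i. f k \<in> freemod L (r i) \<and> (\<forall>l. homog (f k l) (a' i k - a i l))) \<and>
      (\<forall>x \<in> B' i. lin (r' i) f x \<in> B i) \<and> (i = 0 \<longrightarrow> f = unit)" for i f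
  define Q where "Q i f g \<longleftrightarrow> (\<forall>x. lin (r' i) f (dmap r' D' (Suc i) x) =
       dmap r D (Suc i) (lin (r' (Suc i)) g x))" for i f g
  have P0: "P 0 unit"
    using r0 B0 by (auto simp: P_def unit_freemod lin_unit_id) (auto simp: unit_def)
  have step: "\<exists>g. P (Suc i) g \<and> Q i f g" if f: "P i f" for i f
  proof -
    have "\<exists>y\<in>freemod L (r (Suc i)). (\<forall>l. homog (y l) (a' (Suc i) k - a (Suc i) l)) \<and>
       dmap r D (Suc i) y = lin (r' i) f (dcol r' D' (Suc i) k)" if k: "k < r' (Suc i)" for k
    proof (intro homog_lift[OF G])
      show "lin (r' i) f (dcol r' D' (Suc i) k) \<in> dmap r D (Suc i) ` freemod L (r (Suc i))"
        using f dmap_unit_in_range[OF F k] by (auto simp: P_def B_def B'_def)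
    next
      fix l
      have "homog (f m l * dcol r' D' (Suc i) k m) (a' (Suc i) k - a i l)" if "m < r' i" for m
        using homog_times[of "f m l" "a' i m - a i l" "dcol r' D' (Suc i) k m" "a' (Suc i) k - a' i m"]
          dcol_homog[OF F, of "Suc i" k m] f k that by (simp add: P_def)
      then show "homog (lin (r' i) f (dcol r' D' (Suc i) k) l) (a' (Suc i) k - a i l)"
        unfolding lin_def by (intro homog_sum) auto
    qed
    then obtain g where g: "\<And>k. k < r' (Suc i) \<Longrightarrow> g k \<in> freemod L (r (Suc i)) \<and>
        (\<forall>l. homog (g k l) (a' (Suc i) k - a (Suc i) l)) \<and>
       dmap r D (Suc i) (g k) = lin (r' i) f (dcol r' D' (Suc i) k)" by metis
    have Q: "Q i f g"
      unfolding Q_def using g by (auto simp: dmap_lin lin_lin intro!: lin_cong)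
    have "lin (r' (Suc i)) g x \<in> B (Suc i)" if x: "x \<in> B' (Suc i)" for x
    proof -
      have fx: "x \<in> freemod L (r' (Suc i))" using x dmap_freemod[OF F, of "Suc (Suc i)"] by (auto simp: B'_def)
      have "dmap r D (Suc i) (lin (r' (Suc i)) g x) = lin (r' i) f (dmap r' D' (Suc i) x)"
        using Q by (simp add: Q_def)
      also have "dmap r' D' (Suc i) x = (\<lambda>_. 0)" using x by (intro dmap_dmap[OF F]) (simp_all add: B'_def)
      finally have "dmap r D (Suc i) (lin (r' (Suc i)) g x) = (\<lambda>_. 0)" by simp
      moreover have "lin (r' (Suc i)) g x \<in> freemod L (r (Suc i))" using fx g by (intro freemod_lin) auto
      ultimately show ?thesis using kernel_eq[OF G, of "Suc i"] by (simp add: B_def)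
    qed
    then have "P (Suc i) g" using g by (auto simp: P_def)
    with Q show ?thesis by blast
  qed
  obtain \<phi> where "\<And>i. P i (\<phi> i)" "\<And>i. Q i (\<phi> i) (\<phi> (Suc i))"
    using dependent_nat_choice[of P Q] P0 step by metis
  then show ?thesis by (intro exI[of _ \<phi>]) (auto simp: P_def Q_def)
qed

text \<open>In position 0 the identity and \<theta> agree, so the homotopy can start with 0.
  Afterwards the image of the k-th generator is a preimage of the cycle e_k - \<theta>(e_k) - h(d
  e_k).\<close>

lemma homotopy_exists:
  fixes L :: "pt set" and J :: "'k::field mpoly set"
  assumes F: "graded_res L J r a D"
    and \<theta>0: "\<theta> 0 = unit" and \<theta>: "\<And>i k. k < r i \<Longrightarrow> \<theta> i k \<in> freemod L (r i)"
    and comm: "\<And>i x. lin (r i) (\<theta> i) (dmap r D (Suc i) x) = dmap r D (Suc i) (lin (r (Suc i)) (\<theta> (Suc i)) x)"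
  shows "\<exists>h. \<forall>i. \<forall>k<r (Suc i). \<forall>l. unit k l = \<theta> (Suc i) k l + lin (r i) (h i) (dcol r D (Suc i) k) l
     + dmap r D (Suc (Suc i)) (h (Suc i) k) l"
proof -
  define B where "B i = dmap r D (Suc i) ` freemod L (r (Suc i))" for i
  \<comment> \<open>Only boundaries are considered, because there the summand h d of the homotopy
    identity vanishes.\<close>
  define P where "P i h \<longleftrightarrow> (\<forall>k<r i. h k \<in> freemod L (r (Suc i))) \<and>
      (\<forall>x\<in>B i. (\<lambda>l. x l - lin (r i) (\<theta> i) x l) = dmap r D (Suc i) (lin (r i) h x))" for i h
  define Q where "Q i h h' \<longleftrightarrow> (\<forall>k<r (Suc i). dmap r D (Suc (Suc i)) (h' k) =
      (\<lambda>l. unit k l - \<theta> (Suc i) k l - lin (r i) h (dcol r D (Suc i) k) l))" for i h h'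
  have r0: "r 0 = 1" using F by (simp add: graded_res_def)
  have BF: "x \<in> freemod L (r i)" if "x \<in> B i" for x i
    using that dmap_freemod[OF F, of "Suc i"] by (auto simp: B_def)
  have "P 0 (\<lambda>_ _. 0)"
    unfolding P_def
  proof (intro conjI ballI allI impI)
    fix x assume "x \<in> B 0"
    then have "lin (r 0) (\<theta> 0) x = x" using BF lin_unit_id \<theta>0 by metis
    then show "(\<lambda>l. x l - lin (r 0) (\<theta> 0) x l) = dmap r D (Suc 0) (lin (r 0) (\<lambda>_ _. 0) x)"
      by (simp add: dmap_lin)
  qed (auto simp: freemod_def)
  moreover have "\<exists>h'. P (Suc i) h' \<and> Q i h h'" if h: "P i h" for i h
  proof -
    define u where "u k = (\<lambda>l. unit k l - \<theta> (Suc i) k l - lin (r i) h (dcol r D (Suc i) k) l)" for k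
    have "u k \<in> B (Suc i)" if k: "k < r (Suc i)" for k
    proof -
      have dk: "dcol r D (Suc i) k \<in> B i" using dmap_unit_in_range[OF F k] by (simp add: B_def)
      have u: "u k \<in> freemod L (r (Suc i))" unfolding u_def
        using unit_freemod[OF k] \<theta>[OF k] BF[OF dk] h
        by (intro freemod_diff freemod_lin) (auto simp: P_def)
      have d: "dmap r D (Suc i) (unit k) = dcol r D (Suc i) k" by (simp add: dmap_lin lin_unit k)
      have "dmap r D (Suc i) (\<theta> (Suc i) k) = lin (r i) (\<theta> i) (dcol r D (Suc i) k)"
        using comm[of i "unit k"] d by (simp add: lin_unit k)
      moreover have "dmap r D (Suc i) (lin (r i) h (dcol r D (Suc i) k)) =
          (\<lambda>l. dcol r D (Suc i) k l - lin (r i) (\<theta> i) (dcol r D (Suc i) k) l)"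
        using h dk by (simp add: P_def)
      ultimately have "dmap r D (Suc i) (u k) = (\<lambda>_. 0)"
        unfolding u_def using d by (simp add: dmap_lin lin_diff)
      with u kernel_eq[OF F, of "Suc i"] show ?thesis by (simp add: B_def)
    qed
    then have "\<exists>y. y \<in> freemod L (r (Suc (Suc i))) \<and> dmap r D (Suc (Suc i)) y = u k" if "k < r (Suc i)" for k
      using that by (fastforce simp: B_def)
    then obtain h' where h': "\<And>k. k < r (Suc i) \<Longrightarrow> h' k \<in> freemod L (r (Suc (Suc i))) \<and>
        dmap r D (Suc (Suc i)) (h' k) = u k" by metis
    have Q: "Q i h h'" using h' by (auto simp: Q_def u_def)
    have "(\<lambda>l. x l - lin (r (Suc i)) (\<theta> (Suc i)) x l) = dmap r D (Suc (Suc i)) (lin (r (Suc i)) h' x)"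
      if x: "x \<in> B (Suc i)" for x
    proof -
      have "dmap r D (Suc (Suc i)) (lin (r (Suc i)) h' x) = lin (r (Suc i)) u x"
        using h' by (auto simp: dmap_lin lin_lin intro!: lin_cong)
      also have "\<dots> = (\<lambda>l. lin (r (Suc i)) unit x l - lin (r (Suc i)) (\<theta> (Suc i)) x l
            - lin (r i) h (dmap r D (Suc i) x) l)"
        unfolding u_def lin_diff_left by (simp add: dmap_lin lin_lin)
      also have "dmap r D (Suc i) x = (\<lambda>_. 0)" using x by (intro dmap_dmap[OF F]) (simp_all add: B_def)
      also have "lin (r (Suc i)) unit x = x" using BF[OF x] by (rule lin_unit_id)
      finally show ?thesis by simp
    qed
    then have "P (Suc i) h'" using h' by (auto simp: P_def)
    with Q show ?thesis by blast
  qed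
  ultimately obtain h where "\<And>i. P i (h i)" "\<And>i. Q i (h i) (h (Suc i))"
    using dependent_nat_choice[of P Q] by metis
  then show ?thesis by (intro exI[of _ h]) (auto simp: Q_def)
qed

text \<open>The degree conditions force the row and the column of the generator to have no units, so a
  homotopy between the identity and a composite of comparison maps vanishes on it modulo the variables.\<close>
lemma generator_degree_unavoidable:
  fixes L :: "pt set" and J :: "'k::field mpoly set"
  assumes G: "graded_res L J r a D" and F: "graded_res L J r' a' D'"
    and k0: "k0 < r' (Suc i)"
    and below: "\<And>l. l < r' i \<Longrightarrow> a' i l \<noteq> a' (Suc i) k0"
    and above: "\<And>k. k < r' (Suc (Suc i)) \<Longrightarrow> a' (Suc (Suc i)) k \<noteq> a' (Suc i) k0"
  shows "\<exists>k<r (Suc i). a (Suc i) k = a' (Suc i) k0"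
proof (rule ccontr)
  assume contr: "\<not> ?thesis"
  obtain \<phi> where \<phi>: "\<phi> 0 = unit"
    "\<And>i k. k < r' i \<Longrightarrow> \<phi> i k \<in> freemod L (r i)"
    "\<And>i k l. k < r' i \<Longrightarrow> homog (\<phi> i k l) (a' i k - a i l)"
    "\<And>i x. lin (r' i) (\<phi> i) (dmap r' D' (Suc i) x) = dmap r D (Suc i) (lin (r' (Suc i)) (\<phi> (Suc i)) x)"
    using chain_map_exists[OF G F] by blast
  obtain \<psi> where \<psi>: "\<psi> 0 = unit"
    "\<And>i k. k < r i \<Longrightarrow> \<psi> i k \<in> freemod L (r' i)"
    "\<And>i x. lin (r i) (\<psi> i) (dmap r D (Suc i) x) = dmap r' D' (Suc i) (lin (r (Suc i)) (\<psi> (Suc i)) x)"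
    using chain_map_exists[OF F G] by blast
  \<comment> \<open>Position 0 is set to \<open>unit\<close> by hand: the composite of the two
    comparison maps agrees with it only below the rank 1, while \<open>homotopy_exists\<close> asks
    for equality as functions.\<close>
  define \<theta> where "\<theta> i k = (if i = 0 then unit k else lin (r i) (\<psi> i) (\<phi> i k))" for i k
  have lin_\<theta>: "lin (r' i) (\<theta> i) x = lin (r i) (\<psi> i) (lin (r' i) (\<phi> i) x)" if "x \<in> freemod L (r' i)" for i x
  proof (cases "i = 0")
    case True
    have "r 0 = 1" "r' 0 = 1" using G F by (auto simp: graded_res_def)
    moreover have "lin 1 unit x = x" using that True calculation lin_unit_id by metis
    moreover have "lin 1 (\<theta> 0) x = lin 1 unit x" by (intro lin_cong) (simp add: \<theta>_def fun_eq_iff)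
    ultimately show ?thesis using True \<phi>(1) \<psi>(1) by simp
  next
    case False
    then have "\<theta> i = (\<lambda>k. lin (r i) (\<psi> i) (\<phi> i k))" by (simp add: \<theta>_def fun_eq_iff)
    then show ?thesis by (simp add: lin_lin)
  qed
  have \<theta>F: "\<theta> i k \<in> freemod L (r' i)" if "k < r' i" for i k
    using that \<phi>(2)[of k i] \<psi>(2)[of _ i] unit_freemod by (auto simp: \<theta>_def intro!: freemod_lin)
  have "\<exists>h. \<forall>i. \<forall>k<r' (Suc i). \<forall>l. unit k l = \<theta> (Suc i) k l + lin (r' i) (h i) (dcol r' D' (Suc i) k) l
     + dmap r' D' (Suc (Suc i)) (h (Suc i) k) l"
  proof (rule homotopy_exists[OF F])
    show "\<theta> 0 = unit" by (simp add: \<theta>_def fun_eq_iff)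
    show "\<theta> i k \<in> freemod L (r' i)" if "k < r' i" for i k using \<theta>F that .
    fix i x
    have "lin (r' i) (\<theta> i) (dcol r' D' (Suc i) k) = dmap r' D' (Suc i) (\<theta> (Suc i) k)" if k: "k < r' (Suc i)" for k
    proof -
      have "lin (r' i) (\<theta> i) (dcol r' D' (Suc i) k) = lin (r i) (\<psi> i) (lin (r' i) (\<phi> i) (dmap r' D' (Suc i) (unit k)))"
        using lin_\<theta> dcol_freemod[OF F, of "Suc i" k] k by (simp add: dmap_lin lin_unit)
      also have "\<dots> = dmap r' D' (Suc i) (lin (r (Suc i)) (\<psi> (Suc i)) (lin (r' (Suc i)) (\<phi> (Suc i)) (unit k)))"
        by (simp add: \<phi>(4) \<psi>(3))
      also have "\<dots> = dmap r' D' (Suc i) (\<theta> (Suc i) k)" using k by (simp add: lin_unit \<theta>_def)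
      finally show ?thesis .
    qed
    then show "lin (r' i) (\<theta> i) (dmap r' D' (Suc i) x) = dmap r' D' (Suc i) (lin (r' (Suc i)) (\<theta> (Suc i)) x)"
      unfolding dmap_lin lin_lin by (auto intro!: lin_cong)
  qed
  then obtain h where h: "unit k0 k0 = \<theta> (Suc i) k0 k0 + lin (r' i) (h i) (dcol r' D' (Suc i) k0) k0
     + dmap r' D' (Suc (Suc i)) (h (Suc i) k0) k0" using k0 by blast
  \<comment> \<open>The three summands of the diagonal entry have constant term 0, by the contrary
    assumption, by \<open>below\<close> and by \<open>above\<close> respectively; the unit vector
    has constant term 1.\<close>
  have "lookup (\<theta> (Suc i) k0 k0) 0 = (\<Sum>l<r (Suc i). lookup (\<psi> (Suc i) l k0) 0 * lookup (\<phi> (Suc i) k0 l) 0)"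
    by (simp add: \<theta>_def lin_def lookup_sum lookup_times_0)
  also have "\<dots> = 0"
  proof (intro sum.neutral ballI)
    fix l assume "l \<in> {..<r (Suc i)}"
    with contr have "a' (Suc i) k0 - a (Suc i) l \<noteq> 0" by force
    with \<phi>(3)[OF k0] have "lookup (\<phi> (Suc i) k0 l) 0 = 0" by (rule homog_const_0)
    then show "lookup (\<psi> (Suc i) l k0) 0 * lookup (\<phi> (Suc i) k0 l) 0 = 0" by simp
  qed
  finally have 1: "lookup (\<theta> (Suc i) k0 k0) 0 = 0" .
  have "lookup (lin (r' i) (h i) (dcol r' D' (Suc i) k0) k0) 0 =
      (\<Sum>l<r' i. lookup (h i l k0) 0 * lookup (dcol r' D' (Suc i) k0 l) 0)"
    by (simp add: lin_def lookup_sum lookup_times_0)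
  also have "\<dots> = 0"
  proof (intro sum.neutral ballI)
    fix l assume "l \<in> {..<r' i}"
    with below have "a' (Suc i) k0 - a' i l \<noteq> 0" by force
    moreover have "homog (dcol r' D' (Suc i) k0 l) (a' (Suc i) k0 - a' i l)"
      using dcol_homog[OF F, of "Suc i" k0 l] k0 by simp
    ultimately have "lookup (dcol r' D' (Suc i) k0 l) 0 = 0" by (intro homog_const_0)
    then show "lookup (h i l k0) 0 * lookup (dcol r' D' (Suc i) k0 l) 0 = 0" by simp
  qed
  finally have 2: "lookup (lin (r' i) (h i) (dcol r' D' (Suc i) k0) k0) 0 = 0" .
  have "lookup (dmap r' D' (Suc (Suc i)) (h (Suc i) k0) k0) 0 =
      (\<Sum>l<r' (Suc (Suc i)). lookup (dcol r' D' (Suc (Suc i)) l k0) 0 * lookup (h (Suc i) k0 l) 0)"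
    by (simp add: dmap_lin lin_def lookup_sum lookup_times_0)
  also have "\<dots> = 0"
  proof (intro sum.neutral ballI)
    fix l assume l: "l \<in> {..<r' (Suc (Suc i))}"
    with above have "a' (Suc (Suc i)) l - a' (Suc i) k0 \<noteq> 0" by force
    moreover have "homog (dcol r' D' (Suc (Suc i)) l k0) (a' (Suc (Suc i)) l - a' (Suc i) k0)"
      using dcol_homog[OF F, of "Suc (Suc i)" l k0] l by simp
    ultimately have "lookup (dcol r' D' (Suc (Suc i)) l k0) 0 = 0" by (intro homog_const_0)
    then show "lookup (dcol r' D' (Suc (Suc i)) l k0) 0 * lookup (h (Suc i) k0 l) 0 = 0" by simp
  qed
  finally have 3: "lookup (dmap r' D' (Suc (Suc i)) (h (Suc i) k0) k0) 0 = 0" .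
  have "lookup (unit k0 k0 :: 'k mpoly) 0 = 1" by (simp add: unit_def)
  then show False unfolding h using 1 2 3 by (simp add: lookup_add)
qed

section \<open>Koszul complexes of commuting operators\<close>

text \<open>The coefficients form a mere abelian group, so a sign is a boolean acting on them:
  \<open>True\<close> is plus, and composition of signs is equality of booleans. With
  \<open>par\<close> it yields the usual Koszul sign of adding t to T.\<close>

definition sgop :: "bool \<Rightarrow> 'n::ab_group_add \<Rightarrow> 'n" where
  "sgop b g = (if b then g else - g)"

definition par :: "'y::linorder \<Rightarrow> 'y set \<Rightarrow> bool" where
  "par t T \<longleftrightarrow> even (card {s \<in> T. s < t})"

lemma par_insert:
  assumes "finite T" "s \<notin> T" shows "par t (insert s T) \<longleftrightarrow> (par t T \<noteq> (s < t))"
proof -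
  have "{u \<in> insert s T. u < t} = (if s < t then insert s {u \<in> T. u < t} else {u \<in> T. u < t})" by auto
  with assms show ?thesis by (simp add: par_def)
qed

lemma sgop_sum: "sgop b (sum f I) = (\<Sum>i\<in>I. sgop b (f i))"
  by (simp add: sgop_def sum_negf)

lemma sgop_sgop: "sgop b (sgop c g) = sgop (b = c) g"
  by (auto simp: sgop_def)

lemma sgop_0 [simp]: "sgop b 0 = 0"
  by (simp add: sgop_def)

lemma sgop_True [simp]: "sgop True g = g"
  by (simp add: sgop_def)

lemma sgop_not: "sgop (\<not> b) g = - sgop b g"
  by (simp add: sgop_def)

lemma sgop_diff: "sgop b (g - h) = sgop b g - sgop b h"
  by (simp add: sgop_def)

text \<open>The sum is split into the pairs above and below the diagonal, which cancel. Showing that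
  twice the sum vanishes would not suffice in characteristic 2.\<close>

lemma sum_antisym_0:
  fixes f :: "'y::linorder \<Rightarrow> 'y \<Rightarrow> 'n::ab_group_add"
  assumes "finite A" and "\<And>s t. s \<in> A \<Longrightarrow> t \<in> A \<Longrightarrow> s \<noteq> t \<Longrightarrow> f s t = - f t s"
  shows "(\<Sum>t\<in>A. \<Sum>s\<in>A - {t}. f t s) = 0"
proof -
  have "(\<Sum>t\<in>A. \<Sum>s\<in>A - {t}. f t s) = (\<Sum>t\<in>A. (\<Sum>s\<in>{s\<in>A. s < t}. f t s) + (\<Sum>s\<in>{s\<in>A. t < s}. f t s))"
  proof (intro sum.cong refl)
    fix t
    have *: "A - {t} = {s\<in>A. s < t} \<union> {s\<in>A. t < s}" by auto
    then show "(\<Sum>s\<in>A - {t}. f t s) = (\<Sum>s\<in>{s\<in>A. s < t}. f t s) + (\<Sum>s\<in>{s\<in>A. t < s}. f t s)"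
      unfolding * using assms(1) by (intro sum.union_disjoint) auto
  qed
  also have "\<dots> = (\<Sum>t\<in>A. \<Sum>s\<in>{s\<in>A. s < t}. f t s) + (\<Sum>s\<in>A. \<Sum>t\<in>{t\<in>A. t < s}. f t s)"
    using sum.swap_restrict[OF assms(1,1), of "\<lambda>t s. f t s" "\<lambda>t s. t < s"] by (simp add: sum.distrib)
  also have "(\<Sum>s\<in>A. \<Sum>t\<in>{t\<in>A. t < s}. f t s) = (\<Sum>s\<in>A. \<Sum>t\<in>{t\<in>A. t < s}. - f s t)"
    using assms(2) by (intro sum.cong refl) auto
  finally show ?thesis by (simp add: sum_negf)
qed

text \<open>Division with remainder in the abstract: \<open>Q y g\<close> is the quotient of g by
  \<open>\<delta> y\<close>. \<open>Q_\<delta>\<close> makes \<open>\<delta> y\<close> injective,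
  and \<open>Q_comm\<close> lets division by y pass the other operators. Together with commutation
  this gives exactness in positive positions.\<close>

locale koszul_ops =
  fixes Y :: "'y::linorder set" and N :: "'n::ab_group_add set"
    and \<delta> Q :: "'y \<Rightarrow> 'n \<Rightarrow> 'n"
  assumes fin_Y: "finite Y"
    and N_0: "0 \<in> N" and N_diff: "\<And>g h. g \<in> N \<Longrightarrow> h \<in> N \<Longrightarrow> g - h \<in> N"
    and \<delta>_N: "\<And>y g. y \<in> Y \<Longrightarrow> g \<in> N \<Longrightarrow> \<delta> y g \<in> N"
    and \<delta>_diff: "\<And>y g h. y \<in> Y \<Longrightarrow> g \<in> N \<Longrightarrow> h \<in> N \<Longrightarrow> \<delta> y (g - h) = \<delta> y g - \<delta> y h"
    and \<delta>_comm: "\<And>y z g. y \<in> Y \<Longrightarrow> z \<in> Y \<Longrightarrow> g \<in> N \<Longrightarrow> \<delta> y (\<delta> z g) = \<delta> z (\<delta> y g)"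
    and Q_N: "\<And>y g. y \<in> Y \<Longrightarrow> g \<in> N \<Longrightarrow> Q y g \<in> N"
    and Q_diff: "\<And>y g h. y \<in> Y \<Longrightarrow> g \<in> N \<Longrightarrow> h \<in> N \<Longrightarrow> Q y (g - h) = Q y g - Q y h"
    and Q_\<delta>: "\<And>y g. y \<in> Y \<Longrightarrow> g \<in> N \<Longrightarrow> Q y (\<delta> y g) = g"
    and Q_comm: "\<And>y z g. y \<in> Y \<Longrightarrow> z \<in> Y \<Longrightarrow> y \<noteq> z \<Longrightarrow> g \<in> N \<Longrightarrow> Q y (\<delta> z g) = \<delta> z (Q y g)"
begin

lemma N_uminus: "g \<in> N \<Longrightarrow> - g \<in> N"
  using N_diff[OF N_0] by fastforce

lemma N_add: "g \<in> N \<Longrightarrow> h \<in> N \<Longrightarrow> g + h \<in> N"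
  using N_diff[of g "- h"] N_uminus by fastforce

lemma N_sgop: "g \<in> N \<Longrightarrow> sgop b g \<in> N"
  by (simp add: sgop_def N_uminus)

lemma N_sum: "(\<And>i. i \<in> I \<Longrightarrow> f i \<in> N) \<Longrightarrow> sum f I \<in> N"
  by (induction I rule: infinite_finite_induct) (auto simp: N_0 N_add)

lemma additive_on_N:
  assumes f: "\<And>g h. g \<in> N \<Longrightarrow> h \<in> N \<Longrightarrow> f (g - h) = f g - (f h :: 'n)"
  shows "f 0 = 0" "g \<in> N \<Longrightarrow> f (sgop b g) = sgop b (f g)"
    "(\<And>i. i \<in> I \<Longrightarrow> F i \<in> N) \<Longrightarrow> f (sum F I) = (\<Sum>i\<in>I. f (F i))"
proof -
  show 0: "f 0 = 0" using f[OF N_0 N_0] by simp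
  have neg: "f (- g) = - f g" if "g \<in> N" for g using f[OF N_0 that] 0 by simp
  show "f (sgop b g) = sgop b (f g)" if "g \<in> N" using neg[OF that] by (simp add: sgop_def)
  have add: "f (g + h) = f g + f h" if "g \<in> N" "h \<in> N" for g h
    using f[OF that(1) N_uminus[OF that(2)]] neg[OF that(2)] by simp
  show "(\<And>i. i \<in> I \<Longrightarrow> F i \<in> N) \<Longrightarrow> f (sum F I) = (\<Sum>i\<in>I. f (F i))"
    by (induction I rule: infinite_finite_induct) (auto simp: 0 add N_sum)
qed

lemmas \<delta>_additive = additive_on_N[of "\<delta> y" for y, OF \<delta>_diff]
lemmas Q_additive = additive_on_N[of "Q y" for y, OF Q_diff]

text \<open>A chain assigns to T its coefficient at the wedge product of the elements of T. The
  boundary \<open>kos\<close> accordingly collects at T the contributions of all sets with one more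
  element.\<close>

definition Ch :: "nat \<Rightarrow> ('y set \<Rightarrow> 'n) set" where
  "Ch p = {z. (\<forall>T. z T \<in> N) \<and> (\<forall>T. z T \<noteq> 0 \<longrightarrow> T \<subseteq> Y \<and> card T = p)}"

definition kos :: "('y set \<Rightarrow> 'n) \<Rightarrow> 'y set \<Rightarrow> 'n" where
  "kos z T = (\<Sum>t\<in>Y - T. sgop (par t T) (\<delta> t (z (insert t T))))"

lemma Ch_N: "z \<in> Ch p \<Longrightarrow> z T \<in> N"
  by (simp add: Ch_def)

lemma Ch_diff: "z \<in> Ch p \<Longrightarrow> w \<in> Ch p \<Longrightarrow> z - w \<in> Ch p"
proof -
  assume z: "z \<in> Ch p" and w: "w \<in> Ch p"
  have "T \<subseteq> Y \<and> card T = p" if "(z - w) T \<noteq> 0" for T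
  proof -
    have "z T \<noteq> 0 \<or> w T \<noteq> 0" using that by auto
    then show ?thesis using z w unfolding Ch_def by blast
  qed
  then show ?thesis using z w by (simp add: Ch_def N_diff)
qed

lemma kos_diff: "z \<in> Ch p \<Longrightarrow> w \<in> Ch q \<Longrightarrow> kos (z - w) = kos z - kos w"
  by (simp add: fun_eq_iff kos_def \<delta>_diff Ch_N sgop_diff sum_subtractf)

lemma kos_nonzero:
  assumes z: "z \<in> Ch p" and nz: "kos z T \<noteq> 0" shows "T \<subseteq> Y" "p = Suc (card T)"
proof -
  have "\<exists>t\<in>Y - T. z (insert t T) \<noteq> 0"
  proof (rule ccontr)
    assume "\<not> ?thesis"
    then have "kos z T = 0" unfolding kos_def by (intro sum.neutral) (simp add: \<delta>_additive(1))
    with nz show False by simp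
  qed
  then obtain t where t: "t \<in> Y - T" "z (insert t T) \<noteq> 0" by blast
  then have "insert t T \<subseteq> Y" "card (insert t T) = p" using z unfolding Ch_def by blast+
  then show "T \<subseteq> Y" "p = Suc (card T)" using t fin_Y finite_subset[of T Y] by auto
qed

lemma kos_Ch: "z \<in> Ch (Suc p) \<Longrightarrow> kos z \<in> Ch p"
proof -
  assume z: "z \<in> Ch (Suc p)"
  have "kos z T \<in> N" for T
    unfolding kos_def using Ch_N[OF z] by (intro N_sum N_sgop \<delta>_N) auto
  moreover have "T \<subseteq> Y \<and> card T = p" if "kos z T \<noteq> 0" for T
    using kos_nonzero[OF z that] by simp
  ultimately show ?thesis by (simp add: Ch_def)
qed

text \<open>Adding t and then s to T, or s and then t, gives the same value with opposite signs
  because the operators commute.\<close>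

lemma kos_kos:
  assumes z: "z \<in> Ch p" shows "kos (kos z) = 0"
proof
  fix T
  show "kos (kos z) T = 0 T"
  proof (cases "T \<subseteq> Y")
    case False
    have "kos (kos z) T = 0" unfolding kos_def[of "kos z"]
    proof (intro sum.neutral ballI)
      fix t assume "t \<in> Y - T"
      have "kos z (insert t T) = 0" using kos_nonzero[OF z, of "insert t T"] False by blast
      then show "sgop (par t T) (\<delta> t (kos z (insert t T))) = 0"
        using \<open>t \<in> Y - T\<close> by (simp add: \<delta>_additive(1))
    qed
    then show ?thesis by simp
  next
    case True
    then have finT: "finite T" using fin_Y finite_subset by blast
    define f where "f t s = sgop (par t T = par s (insert t T)) (\<delta> t (\<delta> s (z (insert s (insert t T)))))" for t s
    have "kos (kos z) T = (\<Sum>t\<in>Y - T. \<Sum>s\<in>(Y - T) - {t}. f t s)"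
      unfolding kos_def[of "kos z"]
    proof (intro sum.cong refl)
      fix t assume t: "t \<in> Y - T"
      have N: "sgop (par s (insert t T)) (\<delta> s (z (insert s (insert t T)))) \<in> N" if "s \<in> Y - insert t T" for s
        using that z by (intro N_sgop \<delta>_N Ch_N) auto
      have "\<delta> t (kos z (insert t T)) =
          (\<Sum>s\<in>Y - insert t T. sgop (par s (insert t T)) (\<delta> t (\<delta> s (z (insert s (insert t T))))))"
        unfolding kos_def using t N z
        by (subst \<delta>_additive(3)) (auto intro!: sum.cong \<delta>_additive(2) \<delta>_N Ch_N[OF z])
      moreover have "Y - insert t T = (Y - T) - {t}" by auto
      ultimately show "sgop (par t T) (\<delta> t (kos z (insert t T))) = (\<Sum>s\<in>(Y - T) - {t}. f t s)"
        by (simp add: f_def sgop_sum sgop_sgop)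
    qed
    also have "\<dots> = 0"
    proof (rule sum_antisym_0)
      fix s t assume st: "s \<in> Y - T" "t \<in> Y - T" "s \<noteq> t"
      have "(par s T = par t (insert s T)) = (\<not> (par t T = par s (insert t T)))"
        using st finT by (auto simp: par_insert)
      moreover have "\<delta> s (\<delta> t (z (insert t (insert s T)))) = \<delta> t (\<delta> s (z (insert s (insert t T))))"
        using st Ch_N[OF z] by (simp add: \<delta>_comm insert_commute)
      ultimately show "f s t = - f t s" by (simp only: f_def sgop_not)
    qed (simp add: fin_Y)
    finally show ?thesis by simp
  qed
qed

text \<open>The homotopy for a single variable: it contracts the part of a cycle supported on the sets
  containing \<open>y\<close>, so the variables can be removed from the support one at a time.\<close>
definition hom_op :: "'y \<Rightarrow> ('y set \<Rightarrow> 'n) \<Rightarrow> 'y set \<Rightarrow> 'n" where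
  "hom_op y z T = (if y \<in> T then sgop (par y (T - {y})) (Q y (z (T - {y}))) else 0)"

lemma hom_op_Ch:
  assumes z: "z \<in> Ch p" and y: "y \<in> Y" shows "hom_op y z \<in> Ch (Suc p)"
proof -
  have "T \<subseteq> Y \<and> card T = Suc p" if nz: "hom_op y z T \<noteq> 0" for T
  proof -
    have yT: "y \<in> T" using nz by (rule contrapos_np) (simp add: hom_op_def)
    moreover have "z (T - {y}) \<noteq> 0" using nz y by (auto simp: hom_op_def Q_additive(1) split: if_splits)
    ultimately have *: "T - {y} \<subseteq> Y" "card (T - {y}) = p" using z unfolding Ch_def by blast+
    then have "finite (T - {y})" using fin_Y finite_subset by blast
    then have "card T = Suc (card (T - {y}))" using yT card.remove[of T y] by auto
    then show ?thesis using * y yT by auto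
  qed
  moreover have "hom_op y z T \<in> N" for T
    using z y by (auto simp: hom_op_def N_0 intro!: N_sgop Q_N Ch_N[OF z])
  ultimately show ?thesis by (auto simp: Ch_def)
qed

text \<open>The homotopy is supported on sets containing y, so at a set without y only the summand
  that adds y survives.\<close>

lemma kos_hom_op_out:
  assumes z: "z \<in> Ch p" and y: "y \<in> Y" "y \<notin> T"
  shows "kos (hom_op y z) T = \<delta> y (Q y (z T))"
proof -
  have "kos (hom_op y z) T = (\<Sum>t\<in>Y - T. if t = y then \<delta> y (Q y (z T)) else 0)"
    unfolding kos_def
  proof (intro sum.cong refl)
    fix t assume t: "t \<in> Y - T"
    show "sgop (par t T) (\<delta> t (hom_op y z (insert t T))) = (if t = y then \<delta> y (Q y (z T)) else 0)"
      using t y Q_N[OF y(1) Ch_N[OF z, of T]]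
      by (auto simp: hom_op_def \<delta>_additive(1,2) sgop_sgop)
  qed
  also have "\<dots> = \<delta> y (Q y (z T))" using y fin_Y by simp
  finally show ?thesis .
qed

text \<open>Apply \<open>Q y\<close> to the cycle condition at T without y. The summand that adds y
  becomes \<open>z T\<close> by \<open>Q_\<delta>\<close>; by \<open>Q_comm\<close> the others are,
  up to sign, those of the boundary in question.\<close>

lemma kos_hom_op_in:
  assumes z: "z \<in> Ch p" and cyc: "kos z = 0" and y: "y \<in> T" and T: "T \<subseteq> Y"
  shows "kos (hom_op y z) T = z T"
proof -
  define T' where "T' = T - {y}"
  have T': "T = insert y T'" "y \<notin> T'" "finite T'" "y \<in> Y"
    using y T finite_subset[OF T fin_Y] by (auto simp: T'_def)
  define g where "g t = \<delta> t (Q y (z (insert t T')))" for t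
  have N: "\<delta> t (z (insert t T')) \<in> N" if "t \<in> Y" for t using that z by (intro \<delta>_N Ch_N)
  have "0 = Q y (kos z T')" using T' cyc by (simp add: Q_additive(1))
  also have "\<dots> = (\<Sum>t\<in>Y - T'. Q y (sgop (par t T') (\<delta> t (z (insert t T')))))"
    unfolding kos_def using T' N by (subst Q_additive(3)) (auto intro: N_sgop)
  also have "\<dots> = (\<Sum>t\<in>Y - T'. sgop (par t T') (Q y (\<delta> t (z (insert t T')))))"
    using T' N by (intro sum.cong refl Q_additive(2)) auto
  also have "Y - T' = insert y (Y - T)" using T' T by auto
  also have "(\<Sum>t\<in>insert y (Y - T). sgop (par t T') (Q y (\<delta> t (z (insert t T'))))) =
      sgop (par y T') (Q y (\<delta> y (z T))) + (\<Sum>t\<in>Y - T. sgop (par t T') (Q y (\<delta> t (z (insert t T')))))"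
    using T' y fin_Y by (subst sum.insert) auto
  also have "Q y (\<delta> y (z T)) = z T" using Q_\<delta> T' Ch_N[OF z] by simp
  also have "(\<Sum>t\<in>Y - T. sgop (par t T') (Q y (\<delta> t (z (insert t T'))))) = (\<Sum>t\<in>Y - T. sgop (par t T') (g t))"
  proof (intro sum.cong refl)
    fix t assume "t \<in> Y - T"
    then have "Q y (\<delta> t (z (insert t T'))) = g t" unfolding g_def
      using T' y Ch_N[OF z] by (intro Q_comm) auto
    then show "sgop (par t T') (Q y (\<delta> t (z (insert t T')))) = sgop (par t T') (g t)" by simp
  qed
  finally have 1: "(\<Sum>t\<in>Y - T. sgop (par t T') (g t)) = - sgop (par y T') (z T)"
    by (simp add: eq_neg_iff_add_eq_0 add.commute)
  have "kos (hom_op y z) T = (\<Sum>t\<in>Y - T. - sgop (par y T') (sgop (par t T') (g t)))"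
    unfolding kos_def
  proof (intro sum.cong refl)
    fix t assume t: "t \<in> Y - T"
    then have "insert t T - {y} = insert t T'" using T' y by auto
    then have "hom_op y z (insert t T) = sgop (par y (insert t T')) (Q y (z (insert t T')))"
      using y by (simp add: hom_op_def)
    then have "sgop (par t T) (\<delta> t (hom_op y z (insert t T))) = sgop (par t T = par y (insert t T')) (g t)"
      using t T' Q_N[OF T'(4) Ch_N[OF z, of "insert t T'"]]
      by (simp add: \<delta>_additive(2) sgop_sgop g_def)
    also have "(par t T = par y (insert t T')) = (\<not> (par y T' = par t T'))"
      using t T' y by (auto simp: T'(1) par_insert)
    finally show "sgop (par t T) (\<delta> t (hom_op y z (insert t T))) = - sgop (par y T') (sgop (par t T') (g t))"
      by (simp only: sgop_sgop sgop_not)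
  qed
  also have "\<dots> = - sgop (par y T') (\<Sum>t\<in>Y - T. sgop (par t T') (g t))"
    by (simp add: sgop_sum sum_negf)
  also have "\<dots> = z T" unfolding 1 by (simp add: sgop_def)
  finally show ?thesis .
qed

lemma kos_exact:
  assumes z: "z \<in> Ch (Suc p)" and cyc: "kos z = 0"
  shows "\<exists>w\<in>Ch (Suc (Suc p)). kos w = z"
proof -
  have "\<exists>w\<in>Ch (Suc (Suc p)). \<forall>T. T \<inter> X \<noteq> {} \<longrightarrow> (z - kos w) T = 0" if "finite X" "X \<subseteq> Y" for X
    using that
  proof (induction X)
    case empty
    have "0 \<in> Ch (Suc (Suc p))" by (simp add: Ch_def N_0)
    then show ?case by auto
  next
    case (insert y X)
    then obtain w where w: "w \<in> Ch (Suc (Suc p))" "\<And>T. T \<inter> X \<noteq> {} \<Longrightarrow> (z - kos w) T = 0" by auto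
    define z' where "z' = z - kos w"
    have z': "z' \<in> Ch (Suc p)" using z w kos_Ch Ch_diff by (simp add: z'_def)
    have c': "kos z' = 0" using kos_diff[OF z kos_Ch[OF w(1)]] kos_kos[OF w(1)] cyc by (simp add: z'_def)
    define w' where "w' = w - (- hom_op y z')"
    have h: "hom_op y z' \<in> Ch (Suc (Suc p))" using insert by (intro hom_op_Ch[OF z']) auto
    have neg: "- hom_op y z' = 0 - hom_op y z'" by simp
    have "0 \<in> Ch (Suc (Suc p))" by (simp add: Ch_def N_0)
    from Ch_diff[OF this h] kos_diff[OF this h]
    have h': "- hom_op y z' \<in> Ch (Suc (Suc p))" "kos (- hom_op y z') = - kos (hom_op y z')"
      unfolding neg by (auto simp: fun_eq_iff kos_def \<delta>_additive(1))
    have w': "w' \<in> Ch (Suc (Suc p))" unfolding w'_def by (intro Ch_diff w h')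
    have k: "z - kos w' = z' - kos (hom_op y z')"
      using kos_diff[OF w(1) h'(1)] h'(2) by (simp add: w'_def z'_def algebra_simps)
    have "(z - kos w') T = 0" if T: "T \<inter> insert y X \<noteq> {}" for T
    proof (cases "T \<subseteq> Y")
      case False
      then have "z' T = 0" "kos (hom_op y z') T = 0"
        using z' kos_nonzero[OF h, of T] unfolding Ch_def by blast+
      then show ?thesis by (simp add: k)
    next
      case True
      show ?thesis
      proof (cases "y \<in> T")
        case True
        then show ?thesis using kos_hom_op_in[OF z' c' _ \<open>T \<subseteq> Y\<close>] by (simp add: k)
      next
        case False
        \<comment> \<open>T meets X but misses y: the correction at T is
          \<open>\<delta> y (Q y 0)\<close>, so what was achieved for X is kept.\<close>
        then have "z' T = 0" using T w(2) by (auto simp: z'_def)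
        then show ?thesis using kos_hom_op_out[OF z', of y T] False insert
          by (simp add: k Q_additive(1) \<delta>_additive(1))
      qed
    qed
    with w' show ?case by blast
  qed
  from this[OF fin_Y] obtain w where w: "w \<in> Ch (Suc (Suc p))" "\<And>T. T \<inter> Y \<noteq> {} \<Longrightarrow> (z - kos w) T = 0"
    by auto
  have d: "z - kos w \<in> Ch (Suc p)" using z w kos_Ch Ch_diff by simp
  have "(z - kos w) T = 0" for T
  proof (rule ccontr)
    assume nz: "(z - kos w) T \<noteq> 0"
    with d have "T \<subseteq> Y" "card T = Suc p" unfolding Ch_def by blast+
    \<comment> \<open>Positivity of the position enters here: the empty set is the only one that
      meets no variable.\<close>
    moreover from this have "T \<noteq> {}" by auto
    ultimately show False using w(2)[of T] nz by blast
  qed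
  then have "z = kos w" by (simp add: fun_eq_iff)
  with w show ?thesis by blast
qed

end

section \<open>Resolutions with arbitrary finite index sets\<close>

definition idx_mod :: "pt set \<Rightarrow> 'b set \<Rightarrow> ('b \<Rightarrow> 'k::field mpoly) set" where
  "idx_mod L B = {x. (\<forall>b\<in>B. x b \<in> polyring L) \<and> (\<forall>b. b \<notin> B \<longrightarrow> x b = 0)}"

lemma linear_expand:
  fixes d :: "('b \<Rightarrow> 'k::field mpoly) \<Rightarrow> 'c \<Rightarrow> 'k mpoly"
  assumes fin: "finite B"
    and add: "\<And>x y. x \<in> idx_mod L B \<Longrightarrow> y \<in> idx_mod L B \<Longrightarrow> d (\<lambda>b. x b + y b) = (\<lambda>c. d x c + d y c)"
    and scale: "\<And>s x. s \<in> polyring L \<Longrightarrow> x \<in> idx_mod L B \<Longrightarrow> d (\<lambda>b. s * x b) = (\<lambda>c. s * d x c)"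
    and x: "x \<in> idx_mod L B"
  shows "d x c = (\<Sum>b\<in>B. d (\<lambda>c. if c = b then 1 else 0) c * x b)"
proof -
  have d0: "d (\<lambda>_. 0) = (\<lambda>_. 0)" using scale[of 0 "\<lambda>_. 0"] by (simp add: idx_mod_def)
  have "d (\<lambda>b. if b \<in> A then x b else 0) c = (\<Sum>b\<in>A. d (\<lambda>c. if c = b then 1 else 0) c * x b)"
    if "finite A" "A \<subseteq> B" for A
    using that
  proof (induction A)
    case empty
    then show ?case by (simp add: d0)
  next
    case (insert a A)
    let ?u = "\<lambda>b. if b = a then 1 else 0 :: 'k mpoly"
    have xa: "x a \<in> polyring L" and u: "?u \<in> idx_mod L B" using insert x by (auto simp: idx_mod_def)
    have "(\<lambda>b. if b \<in> insert a A then x b else 0) = (\<lambda>b. x a * ?u b + (if b \<in> A then x b else 0))"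
      using insert by auto
    moreover have "(\<lambda>b. x a * ?u b) \<in> idx_mod L B" "(\<lambda>b. if b \<in> A then x b else 0) \<in> idx_mod L B"
      using xa x insert by (auto simp: idx_mod_def)
    ultimately have "d (\<lambda>b. if b \<in> insert a A then x b else 0) c =
        d (\<lambda>b. x a * ?u b) c + d (\<lambda>b. if b \<in> A then x b else 0) c"
      using add by presburger
    also have "d (\<lambda>b. x a * ?u b) c = x a * d ?u c" using scale[OF xa u] by simp
    finally show ?case using insert by (simp add: mult.commute)
  qed
  from this[OF fin] have "d (\<lambda>b. if b \<in> B then x b else 0) c =
      (\<Sum>b\<in>B. d (\<lambda>c. if c = b then 1 else 0) c * x b)" by simp
  moreover have "(\<lambda>b. if b \<in> B then x b else 0) = x" using x by (auto simp: idx_mod_def)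
  ultimately show ?thesis by simp
qed

text \<open>Translates maps between modules with named bases into matrices with numbered rows and
  columns. The enumeration is kept in the conclusion so that degrees can still be read off the named
  generators.\<close>

lemma graded_res_from_maps:
  fixes B :: "nat \<Rightarrow> 'b set" and d :: "nat \<Rightarrow> ('b \<Rightarrow> 'k::field mpoly) \<Rightarrow> 'b \<Rightarrow> 'k mpoly"
    and J :: "'k mpoly set"
  assumes fin: "\<And>i. finite (B i)" and B0: "B 0 = {b0}" "deg b0 = (0::int)"
    and bounded: "\<And>i. i > n \<Longrightarrow> B i = {}"
    and add: "\<And>i x y. i \<ge> 1 \<Longrightarrow> x \<in> idx_mod L (B i) \<Longrightarrow> y \<in> idx_mod L (B i) \<Longrightarrow>
      d i (\<lambda>b. x b + y b) = (\<lambda>c. d i x c + d i y c)"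
    and scale: "\<And>i s x. i \<ge> 1 \<Longrightarrow> s \<in> polyring L \<Longrightarrow> x \<in> idx_mod L (B i) \<Longrightarrow>
      d i (\<lambda>b. s * x b) = (\<lambda>c. s * d i x c)"
    and hom: "\<And>i b b'. i \<ge> 1 \<Longrightarrow> b \<in> B i \<Longrightarrow> b' \<in> B (i - 1) \<Longrightarrow>
      homog (d i (\<lambda>c. if c = b then 1 else 0) b') (deg b - deg b')"
    and maps: "\<And>i x. i \<ge> 1 \<Longrightarrow> x \<in> idx_mod L (B i) \<Longrightarrow> d i x \<in> idx_mod L (B (i - 1))"
    and ex0: "d 1 ` idx_mod L (B 1) = {x \<in> idx_mod L (B 0). x b0 \<in> J}"
    and ex: "\<And>i. i \<ge> 1 \<Longrightarrow> {x \<in> idx_mod L (B i). d i x = (\<lambda>_. 0)} = d (Suc i) ` idx_mod L (B (Suc i))"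
  shows "\<exists>r a D. graded_res L J r a D \<and>
    (\<forall>i. \<exists>e. bij_betw e {..<r i} (B i) \<and> (\<forall>k<r i. a i k = deg (e k)))"
proof -
  define r where "r i = card (B i)" for i
  obtain e where e: "\<And>i. bij_betw (e i) {..<r i} (B i)"
    unfolding r_def using ex_bij_betw_nat_finite[OF fin] by (metis atLeast0LessThan)
  define a where "a i k = deg (e i k)" for i k
  define D where "D i l k = d i (\<lambda>c. if c = e i k then 1 else 0) (e (i - 1) l)" for i l k
  define enc where "enc i x = (\<lambda>k. if k < r i then x (e i k) else 0)" for i and x :: "'b \<Rightarrow> 'k mpoly"
  have eB: "e i k \<in> B i" if "k < r i" for i k using e[of i] that by (auto simp: bij_betw_def)
  have enc_fm: "enc i ` idx_mod L (B i) = freemod L (r i)" for i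
  proof (intro equalityI subsetI)
    fix v assume "v \<in> enc i ` idx_mod L (B i)"
    then show "v \<in> freemod L (r i)" using eB by (auto simp: enc_def freemod_def idx_mod_def)
  next
    fix v :: "nat \<Rightarrow> 'k mpoly" assume v: "v \<in> freemod L (r i)"
    define x where "x b = (if b \<in> B i then v (inv_into {..<r i} (e i) b) else 0)" for b
    have "x \<in> idx_mod L (B i)" using v bij_betwE[OF bij_betw_inv_into[OF e[of i]]]
      by (auto simp: idx_mod_def x_def freemod_def)
    moreover have "enc i x = v" using v e[of i] eB
      by (auto simp: enc_def x_def fun_eq_iff freemod_def bij_betw_inv_into_left)
    ultimately show "v \<in> enc i ` idx_mod L (B i)" by blast
  qed
  have enc_0: "x = (\<lambda>_. 0)" if x: "x \<in> idx_mod L (B i)" and z: "enc i x = (\<lambda>_. 0)" for i x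
  proof
    fix b
    show "x b = 0"
    proof (cases "b \<in> B i")
      case True
      then obtain k where "k < r i" "b = e i k" using e[of i] by (auto simp: bij_betw_def)
      then show ?thesis using fun_cong[OF z, of k] by (simp add: enc_def)
    qed (use x in \<open>auto simp: idx_mod_def\<close>)
  qed
  have dmap_enc: "dmap r D i (enc i x) = enc (i - 1) (d i x)" if i: "i \<ge> 1" and x: "x \<in> idx_mod L (B i)" for i x
  proof
    fix l
    have "(\<Sum>k<r i. D i l k * enc i x k) = (\<Sum>k<r i. d i (\<lambda>c. if c = e i k then 1 else 0) (e (i - 1) l) * x (e i k))"
      by (simp add: enc_def D_def)
    also have "\<dots> = (\<Sum>b\<in>B i. d i (\<lambda>c. if c = b then 1 else 0) (e (i - 1) l) * x b)"
      by (rule sum.reindex_bij_betw[OF e])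
    also have "\<dots> = d i x (e (i - 1) l)"
      by (rule linear_expand[symmetric]) (use fin add scale i x in auto)
    finally show "dmap r D i (enc i x) l = enc (i - 1) (d i x) l"
      by (simp add: dmap_def) (simp add: enc_def)
  qed
  have r0: "r 0 = 1" by (simp add: r_def B0)
  have e0: "e 0 0 = b0" using eB[of 0 0] B0 by (simp add: r0)
  have "graded_res L J r a D"
    unfolding graded_res_def
  proof (intro conjI allI impI)
    show "r 0 = 1" "a 0 0 = 0" by (simp_all add: r0 a_def e0 B0)
    show "\<exists>n. \<forall>i>n. r i = 0" using bounded by (auto simp: r_def intro!: exI[of _ n])
  next
    fix i l k :: nat assume i: "1 \<le> i" and l: "l < r (i - 1)" and k: "k < r i"
    have "(\<lambda>c. if c = e i k then 1 else 0) \<in> idx_mod L (B i)" using eB[OF k] by (auto simp: idx_mod_def)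
    from maps[OF i this] show "D i l k \<in> polyring L" using eB[OF l] by (simp add: D_def idx_mod_def)
    show "homog (D i l k) (a i k - a (i - 1) l)"
      unfolding D_def a_def using hom[OF i eB[OF k] eB[OF l]] .
  next
    have "dmap r D 1 ` freemod L (r 1) = (\<lambda>x. enc 0 (d 1 x)) ` idx_mod L (B 1)"
      unfolding enc_fm[symmetric] image_image by (intro image_cong refl) (simp add: dmap_enc)
    also have "\<dots> = enc 0 ` {x \<in> idx_mod L (B 0). x b0 \<in> J}"
      unfolding ex0[symmetric] by (simp add: image_image)
    also have "\<dots> = {v \<in> enc 0 ` idx_mod L (B 0). v 0 \<in> J}"
      by (auto simp: enc_def r0 e0)
    finally show "dmap r D 1 ` freemod L (r 1) = {v \<in> freemod L 1. v 0 \<in> J}"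
      by (simp only: enc_fm r0)
  next
    fix i :: nat assume i: "1 \<le> i"
    have "{v \<in> freemod L (r i). dmap r D i v = (\<lambda>_. 0)} = enc i ` {x \<in> idx_mod L (B i). d i x = (\<lambda>_. 0)}"
      (is "?A = ?C")
    proof (intro equalityI subsetI)
      fix v assume v: "v \<in> ?A"
      then obtain x where x: "x \<in> idx_mod L (B i)" "v = enc i x" unfolding enc_fm[symmetric] by blast
      then have "enc (i - 1) (d i x) = (\<lambda>_. 0)" using v dmap_enc[OF i] by simp
      then have "d i x = (\<lambda>_. 0)" using enc_0 maps[OF i x(1)] by blast
      with x show "v \<in> ?C" by blast
    next
      fix v assume "v \<in> ?C"
      then obtain x where x: "x \<in> idx_mod L (B i)" "d i x = (\<lambda>_. 0)" "v = enc i x" by blast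
      have "dmap r D i v = enc (i - 1) (d i x)" using dmap_enc[OF i] x by simp
      then have "dmap r D i v = (\<lambda>_. 0)" by (simp add: x(2)) (simp add: enc_def)
      then show "v \<in> ?A" unfolding enc_fm[symmetric] using x by blast
    qed
    also have "\<dots> = (\<lambda>x. enc i (d (Suc i) x)) ` idx_mod L (B (Suc i))"
      unfolding ex[OF i] by (simp add: image_image)
    also have "\<dots> = dmap r D (Suc i) ` freemod L (r (Suc i))"
      unfolding enc_fm[symmetric] image_image by (intro image_cong refl) (simp add: dmap_enc)
    finally show "{v \<in> freemod L (r i). dmap r D i v = (\<lambda>_. 0)} = dmap r D (Suc i) ` freemod L (r (Suc i))" .
  qed
  with e show ?thesis by (intro exI[of _ r] exI[of _ a] exI[of _ D]) (auto simp: a_def)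
qed

text \<open>An invertible linear substitution is a graded automorphism of \<open>polyring L\<close>;
  applied to all matrix entries it preserves exactness and the degrees \<open>a\<close>. The
  intersection with \<open>polyring L\<close> is there because the two substitutions are inverse
  only on it.\<close>

lemma graded_res_subst:
  fixes J :: "'k::field mpoly set"
  assumes res: "graded_res L J r a D"
    and s: "\<And>x. x \<in> L \<Longrightarrow> s x \<in> polyring L \<and> homog (s x) 1"
    and t: "\<And>x. x \<in> L \<Longrightarrow> t x \<in> polyring L"
    and st: "\<And>x. x \<in> L \<Longrightarrow> subst s (t x) = Var x" "\<And>x. x \<in> L \<Longrightarrow> subst t (s x) = Var x"
  shows "graded_res L (subst s ` (J \<inter> polyring L)) r a (\<lambda>i l k. subst s (D i l k))"
proof -
  have sp: "p \<in> polyring L \<Longrightarrow> subst s p \<in> polyring L" for p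
    using s by (intro polyring_subst[of _ L]) auto
  have tp: "p \<in> polyring L \<Longrightarrow> subst t p \<in> polyring L" for p
    using t by (intro polyring_subst[of _ L]) auto
  have st': "p \<in> polyring L \<Longrightarrow> subst s (subst t p) = p" for p
    using subst_cong[of p L "\<lambda>a. subst s (t a)" Var] st by (simp add: subst_subst subst_id)
  have ts': "p \<in> polyring L \<Longrightarrow> subst t (subst s p) = p" for p
    using subst_cong[of p L "\<lambda>a. subst t (s a)" Var] st by (simp add: subst_subst subst_id)
  define S where "S v = (\<lambda>k. subst s (v k))" for v :: "nat \<Rightarrow> 'k mpoly"
  have S_fm: "S ` freemod L n = freemod L n" for n
  proof (intro equalityI subsetI)
    fix v assume "v \<in> S ` freemod L n" then show "v \<in> freemod L n" using sp by (auto simp: S_def freemod_def)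
  next
    fix v :: "nat \<Rightarrow> 'k mpoly" assume v: "v \<in> freemod L n"
    define w where "w = (\<lambda>k. subst t (v k))"
    have "w \<in> freemod L n" "S w = v" using v tp
      by (auto simp: w_def S_def freemod_def fun_eq_iff) (metis linorder_not_le st' subst_0)
    then show "v \<in> S ` freemod L n" by blast
  qed
  define D' where "D' i l k = subst s (D i l k)" for i l k
  have dS: "dmap r D' i (S v) = S (dmap r D i v)" for i v
    by (auto simp: dmap_def D'_def S_def fun_eq_iff subst_sum subst_times)
  have "graded_res L (subst s ` (J \<inter> polyring L)) r a D'"
    unfolding graded_res_def
  proof (intro conjI allI impI)
    show "r 0 = 1" "a 0 0 = 0" "\<exists>n. \<forall>i>n. r i = 0" using res by (auto simp: graded_res_def)
  next
    fix i l k :: nat assume "1 \<le> i" "l < r (i - 1)" "k < r i"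
    then have "D i l k \<in> polyring L" "homog (D i l k) (a i k - a (i - 1) l)"
      using res by (auto simp: graded_res_def)
    then show "D' i l k \<in> polyring L" "homog (D' i l k) (a i k - a (i - 1) l)"
      using sp s homog_subst[of "D i l k" L s] by (auto simp: D'_def)
  next
    have "dmap r D' 1 ` freemod L (r 1) = S ` dmap r D 1 ` freemod L (r 1)"
      by (subst S_fm[symmetric]) (simp add: image_image dS)
    also have "dmap r D 1 ` freemod L (r 1) = {v \<in> freemod L 1. v 0 \<in> J}"
      using res by (simp add: graded_res_def)
    also have "S ` \<dots> = {v \<in> freemod L 1. v 0 \<in> subst s ` (J \<inter> polyring L)}" (is "?A = ?B")
    proof (intro equalityI subsetI)
      fix v assume "v \<in> ?A"
      then obtain w where w: "w \<in> freemod L 1" "w 0 \<in> J" "v = S w" by blast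
      then have "w 0 \<in> polyring L" "v \<in> freemod L 1" using S_fm[of 1] by (auto simp: freemod_def)
      then show "v \<in> ?B" using w by (auto simp: S_def)
    next
      fix v assume v: "v \<in> ?B"
      then obtain w where w: "w \<in> freemod L 1" "v = S w" using S_fm[of 1] by auto
      from v obtain f where f: "f \<in> J" "f \<in> polyring L" "v 0 = subst s f" by auto
      have "w 0 \<in> polyring L" using w by (simp add: freemod_def)
      moreover have "subst s (w 0) = subst s f" using w f by (simp add: S_def)
      ultimately have "w 0 = f" using ts' f(2) by metis
      then show "v \<in> ?A" using w f by auto
    qed
    finally show "dmap r D' 1 ` freemod L (r 1) = {v \<in> freemod L 1. v 0 \<in> subst s ` (J \<inter> polyring L)}" .
  next
    fix i :: nat assume i: "1 \<le> i"
    have ker: "dmap r D i w = (\<lambda>_. 0)" if w: "w \<in> freemod L (r i)" "S (dmap r D i w) = (\<lambda>_. 0)" for w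
    proof -
      have "dmap r D i w \<in> freemod L (r (i - 1))" using dmap_freemod[OF res i w(1)] .
      then have "dmap r D i w k \<in> polyring L" for k
        by (cases "k < r (i - 1)") (auto simp: freemod_def)
      then have "dmap r D i w k = subst t (S (dmap r D i w) k)" for k by (simp add: S_def ts')
      then show ?thesis using w(2) by (simp add: fun_eq_iff)
    qed
    have "{v \<in> freemod L (r i). dmap r D' i v = (\<lambda>_. 0)} = S ` {v \<in> freemod L (r i). dmap r D i v = (\<lambda>_. 0)}"
      (is "?A = ?B")
    proof (intro equalityI subsetI)
      fix v assume v: "v \<in> ?A"
      then obtain w where w: "w \<in> freemod L (r i)" "v = S w" using S_fm by blast
      then show "v \<in> ?B" using v ker by (auto simp: dS)
    next
      fix v assume "v \<in> ?B"
      then obtain w where w: "w \<in> freemod L (r i)" "dmap r D i w = (\<lambda>_. 0)" "v = S w" by auto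
      then have "dmap r D' i v = (\<lambda>_. 0)" by (simp add: dS) (simp add: S_def)
      then show "v \<in> ?A" using w S_fm by blast
    qed
    also have "{v \<in> freemod L (r i). dmap r D i v = (\<lambda>_. 0)} = dmap r D (Suc i) ` freemod L (r (Suc i))"
      using res i by (simp add: graded_res_def)
    also have "S ` \<dots> = dmap r D' (Suc i) ` S ` freemod L (r (Suc i))" by (simp add: image_image dS)
    finally show "{v \<in> freemod L (r i). dmap r D' i v = (\<lambda>_. 0)} = dmap r D' (Suc i) ` freemod L (r (Suc i))"
      by (simp add: S_fm)
  qed
  moreover have "D' = (\<lambda>i l k. subst s (D i l k))" by (simp add: D'_def fun_eq_iff)
  ultimately show ?thesis by simp
qed

section \<open>Division by a variable minus a matrix\<close>

text \<open>A bound on the degree in y, used as induction measure for division; the zero polynomial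
  then needs no convention.\<close>

definition var_le :: "nat \<Rightarrow> pt \<Rightarrow> 'k::field mpoly \<Rightarrow> bool" where
  "var_le k y p \<longleftrightarrow> (\<forall>m\<in>keys p. lookup m y \<le> k)"

lemma var_le_0 [simp]: "var_le k y 0"
  by (simp add: var_le_def)

lemma var_le_add: "var_le k y p \<Longrightarrow> var_le k y q \<Longrightarrow> var_le k y (p + q)"
  using Poly_Mapping.keys_add[of p q] by (fastforce simp: var_le_def)

lemma var_le_sum: "(\<And>i. i \<in> I \<Longrightarrow> var_le k y (f i)) \<Longrightarrow> var_le k y (sum f I)"
  by (induction I rule: infinite_finite_induct) (auto intro: var_le_add)

lemma var_le_free: "p \<in> polyring W \<Longrightarrow> y \<notin> W \<Longrightarrow> var_le k y p"
  unfolding var_le_def polyring_def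
  by (metis (mono_tags, lifting) le0 mem_Collect_eq not_in_keys_iff_lookup_eq_zero subsetD)

lemma polyring_remove: "p \<in> polyring W \<Longrightarrow> var_le 0 y p \<Longrightarrow> p \<in> polyring (W - {y})"
proof -
  assume p: "p \<in> polyring W" and var_le: "var_le 0 y p"
  have "keys m \<subseteq> W - {y}" if m: "m \<in> keys p" for m
  proof -
    have "keys m \<subseteq> W" using p m by (simp add: polyring_def)
    moreover have "y \<notin> keys m" using var_le m by (simp add: var_le_def not_in_keys_iff_lookup_eq_zero)
    ultimately show ?thesis by blast
  qed
  then show ?thesis by (simp add: polyring_def)
qed

lemma var_le_free_times:
  assumes "p \<in> polyring W" "y \<notin> W" "var_le k y q" shows "var_le k y (p * q)"
  unfolding var_le_def
proof
  fix m assume "m \<in> keys (p * q)"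
  then obtain a b where "a \<in> keys p" "b \<in> keys q" "m = a + b" using keys_mult by blast
  moreover have "lookup a y = 0" if "a \<in> keys p" for a
    using var_le_free[OF assms(1,2), of 0] that by (auto simp: var_le_def)
  ultimately show "lookup m y \<le> k" using assms(3) by (simp add: var_le_def lookup_add)
qed

lemma var_le_Var_times: "var_le (Suc k) y (Var y * p) \<longleftrightarrow> var_le k y p"
  by (auto simp: var_le_def keys_Var_times lookup_add)

lemma var_le_Var_times_0: "var_le 0 y (Var y * p) \<Longrightarrow> p = 0"
  by (auto simp: var_le_def keys_Var_times lookup_add)

lemma var_le_bound:
  assumes "finite V" shows "\<exists>k. \<forall>v\<in>V. var_le k y (g v)"
proof -
  have "lookup m y \<le> (\<Sum>v\<in>V. \<Sum>m\<in>keys (g v). lookup m y)" if "v \<in> V" "m \<in> keys (g v)" for v m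
  proof -
    have "lookup m y \<le> (\<Sum>m\<in>keys (g v). lookup m y)" using that by (intro member_le_sum) auto
    also have "\<dots> \<le> (\<Sum>v\<in>V. \<Sum>m\<in>keys (g v). lookup m y)"
      using that assms by (intro member_le_sum[of v V "\<lambda>v. \<Sum>m\<in>keys (g v). lookup m y"]) auto
    finally show ?thesis .
  qed
  then show ?thesis unfolding var_le_def by blast
qed

lemma split_variable:
  fixes p :: "'k::field mpoly"
  assumes "p \<in> polyring W"
  shows "\<exists>p1\<in>polyring W. \<exists>p0\<in>polyring (W - {y}). p = Var y * p1 + p0 \<and> (\<forall>k. var_le (Suc k) y p \<longrightarrow> var_le k y p1)"
proof -
  \<comment> \<open>\<open>p1\<close> reads the coefficients of p along the shift by y, and
    \<open>p0\<close> keeps the monomials without y.\<close>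
  have inj: "inj (\<lambda>n :: mon. n + single y 1)" by (simp add: inj_def)
  define p1 where "p1 = Poly_Mapping.map_key (\<lambda>n. n + single y 1) p"
  define p0 where "p0 = Poly_Mapping.mapp (\<lambda>m c. if y \<in> keys m then 0 else c) p"
  have l1: "lookup p1 n = lookup p (n + single y 1)" for n
    unfolding p1_def by (simp only: map_key.rep_eq[OF inj] comp_def)
  have l0: "lookup p0 n = (if y \<in> keys n then 0 else lookup p n)" for n
    by (auto simp: p0_def lookup_mapp when_def in_keys_iff)
  have k1: "n + single y 1 \<in> keys p" if "n \<in> keys p1" for n using that by (simp add: in_keys_iff l1)
  have "p1 \<in> polyring W"
    using assms k1 by (fastforce simp: polyring_def keys_plus_nat)
  moreover have "p0 \<in> polyring (W - {y})"
    using assms unfolding polyring_def by (auto simp: l0 in_keys_iff[of _ p0] in_keys_iff[of _ p] split: if_splits)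
  moreover have "p = Var y * p1 + p0"
  proof (rule poly_mapping_eqI)
    fix m :: mon
    have "m - single y 1 + single y 1 = m" if "y \<in> keys m"
      using single_plus_minus[OF that] by (simp only: add.commute)
    then show "lookup p m = lookup (Var y * p1 + p0) m"
      by (auto simp: lookup_add lookup_Var_times l0 l1)
  qed
  moreover have "var_le (Suc k) y p \<Longrightarrow> var_le k y p1" for k
    using k1 by (fastforce simp: var_le_def lookup_add)
  ultimately show ?thesis by blast
qed

text \<open>The residue ring \<open>polyring L\<close> modulo \<open>J\<close> is free over
  \<open>polyring E\<close> with the homogeneous basis \<open>gen v\<close> of degrees
  \<open>dg v\<close>, and \<open>v0\<close> is the basis element 1. In the application
  \<open>E\<close> holds one variable per rank and \<open>J\<close> is the Hibi ideal after the
  change of coordinates.\<close>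

locale free_over =
  fixes L E :: "pt set" and J :: "'k::field mpoly set"
    and V :: "'v set" and gen :: "'v \<Rightarrow> 'k mpoly" and dg :: "'v \<Rightarrow> nat" and v0 :: 'v
  assumes fin_L: "finite L" and E_L: "E \<subseteq> L" and fin_V: "finite V" and v0: "v0 \<in> V" "gen v0 = 1" "dg v0 = 0"
    and gen_L: "\<And>v. v \<in> V \<Longrightarrow> gen v \<in> polyring L" and gen_hom: "\<And>v. v \<in> V \<Longrightarrow> homog (gen v) (int (dg v))"
    and J_add: "\<And>p q. p \<in> J \<Longrightarrow> q \<in> J \<Longrightarrow> p + q \<in> J"
    and J_times: "\<And>p q. p \<in> polyring L \<Longrightarrow> q \<in> J \<Longrightarrow> p * q \<in> J"
    and J_0: "0 \<in> J" and J_L: "J \<subseteq> polyring L"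
    and J_hom: "\<And>p e. p \<in> J \<Longrightarrow> hcomp e p \<in> J"
    and spanning: "\<And>f. f \<in> polyring L \<Longrightarrow>
      \<exists>p. (\<forall>v\<in>V. p v \<in> polyring E) \<and> f - (\<Sum>v\<in>V. p v * gen v) \<in> J"
    and independent: "\<And>p. (\<And>v. v \<in> V \<Longrightarrow> p v \<in> polyring E) \<Longrightarrow> (\<Sum>v\<in>V. p v * gen v) \<in> J \<Longrightarrow>
      \<forall>v\<in>V. p v = 0"
begin

section \<open>Vectors over the basis and their evaluation modulo the ideal\<close>

abbreviation Nm :: "pt set \<Rightarrow> ('v \<Rightarrow> 'k mpoly) set" where "Nm W \<equiv> idx_mod W V"

text \<open>Modulo \<open>J\<close> this is surjective, and on vectors over \<open>E\<close> it is
  bijective (\<open>ev_inj\<close>, \<open>ev_surj\<close>). Identities between matrices over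
  \<open>E\<close> are proved by evaluating both sides modulo \<open>J\<close>.\<close>

definition ev :: "('v \<Rightarrow> 'k mpoly) \<Rightarrow> 'k mpoly" where
  "ev g = (\<Sum>v\<in>V. g v * gen v)"

lemma J_uminus: "p \<in> J \<Longrightarrow> - p \<in> J"
  using J_times[OF polyring_uminus[OF polyring_1], of p] by simp

lemma J_diff: "p \<in> J \<Longrightarrow> q \<in> J \<Longrightarrow> p - q \<in> J"
  using J_add[of p "- q"] J_uminus by simp

lemma J_sum: "(\<And>i. i \<in> I \<Longrightarrow> f i \<in> J) \<Longrightarrow> sum f I \<in> J"
  by (induction I rule: infinite_finite_induct) (auto simp: J_0 J_add)

lemma Nm_mono: "W \<subseteq> W' \<Longrightarrow> g \<in> Nm W \<Longrightarrow> g \<in> Nm W'"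
  using polyring_mono[of W W'] by (auto simp: idx_mod_def)

lemma Nm_0: "0 \<in> Nm W"
  by (simp add: idx_mod_def)

lemma Nm_diff: "g \<in> Nm W \<Longrightarrow> h \<in> Nm W \<Longrightarrow> g - h \<in> Nm W"
  by (auto simp: idx_mod_def)

lemma Nm_add: "g \<in> Nm W \<Longrightarrow> h \<in> Nm W \<Longrightarrow> g + h \<in> Nm W"
  by (auto simp: idx_mod_def)

lemma Nm_scale: "s \<in> polyring W \<Longrightarrow> g \<in> Nm W \<Longrightarrow> (\<lambda>v. s * g v) \<in> Nm W"
  by (auto simp: idx_mod_def)

lemma ev_diff: "ev (g - h) = ev g - ev h"
  by (simp add: ev_def algebra_simps sum_subtractf)

lemma ev_add: "ev (g + h) = ev g + ev h"
  by (simp add: ev_def algebra_simps sum.distrib)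

lemma ev_sum: "ev (sum f I) = (\<Sum>i\<in>I. ev (f i))"
proof (induction I rule: infinite_finite_induct)
  case (insert x F)
  then show ?case by (simp only: sum.insert ev_add simp_thms)
qed (simp_all add: ev_def)

lemma ev_scale: "ev (\<lambda>v. s * g v) = s * ev g"
  by (simp add: ev_def sum_distrib_left mult.assoc)

lemma ev_L: "g \<in> Nm L \<Longrightarrow> ev g \<in> polyring L"
  using gen_L by (auto simp: ev_def idx_mod_def intro!: polyring_sum polyring_times)

lemma ev_inj: "g \<in> Nm E \<Longrightarrow> ev g \<in> J \<Longrightarrow> g = 0"
proof -
  assume g: "g \<in> Nm E" and "ev g \<in> J"
  then have "\<forall>v\<in>V. g v = 0" by (intro independent) (auto simp: idx_mod_def ev_def)
  then show "g = 0" using g by (auto simp: idx_mod_def fun_eq_iff)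
qed

lemma ev_surj: assumes "f \<in> polyring L" shows "\<exists>g\<in>Nm E. f - ev g \<in> J"
proof -
  obtain p where p: "\<forall>v\<in>V. p v \<in> polyring E" "f - (\<Sum>v\<in>V. p v * gen v) \<in> J" using spanning[OF assms] by blast
  then have "(\<lambda>v. if v \<in> V then p v else 0) \<in> Nm E" "f - ev (\<lambda>v. if v \<in> V then p v else 0) \<in> J"
    by (auto simp: idx_mod_def ev_def cong: sum.cong)
  then show ?thesis by blast
qed

text \<open>Column v of the matrix of multiplication by y on the residue ring, the matrix
  \<open>C_y\<close> of the overview.\<close>

definition cf :: "pt \<Rightarrow> 'v \<Rightarrow> 'v \<Rightarrow> 'k mpoly" where
  "cf y v = (SOME g. g \<in> Nm E \<and> Var y * gen v - ev g \<in> J)"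

lemma cf: assumes "y \<in> L" "v \<in> V" shows "cf y v \<in> Nm E" "Var y * gen v - ev (cf y v) \<in> J"
proof -
  have "\<exists>g. g \<in> Nm E \<and> Var y * gen v - ev g \<in> J"
    using ev_surj[of "Var y * gen v"] gen_L assms by blast
  from someI_ex[OF this] show "cf y v \<in> Nm E" "Var y * gen v - ev (cf y v) \<in> J"
    by (auto simp: cf_def)
qed

text \<open>The part of the column with the expected degrees also represents
  \<open>Var y * gen v\<close>, as \<open>J\<close> is homogeneous; by uniqueness over
  \<open>E\<close> it is the whole column.\<close>

lemma cf_hom:
  assumes "y \<in> L" "v \<in> V" shows "homog (cf y v w) (1 + int (dg v) - int (dg w))"
proof (cases "w \<in> V")
  case True
  define e where "e = 1 + int (dg v)"
  define g where "g = (\<lambda>w. if w \<in> V then hcomp (e - int (dg w)) (cf y v w) else 0)"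
  have g: "g \<in> Nm E" using cf(1)[OF assms] by (auto simp: g_def idx_mod_def)
  have "hcomp e (ev (cf y v)) = ev g"
    unfolding ev_def hcomp_sum using gen_hom
    by (intro sum.cong refl) (simp add: mult.commute[of _ "gen _"] hcomp_times[of "gen _" "int (dg _)"] g_def)
  moreover have "hcomp e (Var y * gen v) = Var y * gen v"
    using homog_times[OF homog_Var gen_hom[OF assms(2)]] by (simp add: e_def hcomp_homog[of _ "1 + int (dg v)"])
  ultimately have "Var y * gen v - ev g \<in> J"
    using J_hom[OF cf(2)[OF assms], of e] by (simp add: hcomp_diff)
  then have "ev (cf y v - g) \<in> J" using J_diff[OF _ cf(2)[OF assms]] by (fastforce simp: ev_diff)
  then have "cf y v - g = 0" using g cf(1)[OF assms] by (intro ev_inj Nm_diff)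
  then have "cf y v w = g w" by (simp add: fun_eq_iff)
  then have "cf y v w = hcomp (e - int (dg w)) (cf y v w)" using True by (simp add: g_def)
  then show ?thesis unfolding homog_iff_hcomp e_def by (rule sym)
next
  case False
  then show ?thesis using cf(1)[OF assms] by (simp add: idx_mod_def)
qed

section \<open>The operators y - C_y: commutation and division with remainder\<close>

definition cmat :: "pt \<Rightarrow> ('v \<Rightarrow> 'k mpoly) \<Rightarrow> 'v \<Rightarrow> 'k mpoly" where
  "cmat y g = (\<lambda>w. \<Sum>v\<in>V. cf y v w * g v)"

definition del :: "pt \<Rightarrow> ('v \<Rightarrow> 'k mpoly) \<Rightarrow> 'v \<Rightarrow> 'k mpoly" where
  "del y g = (\<lambda>w. Var y * g w - cmat y g w)"

lemma cmat_diff: "cmat y (g - h) = cmat y g - cmat y h"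
  by (simp add: cmat_def fun_eq_iff algebra_simps sum_subtractf)

lemma cmat_add: "cmat y (g + h) = cmat y g + cmat y h"
  by (simp add: cmat_def fun_eq_iff algebra_simps sum.distrib)

lemma cmat_scale: "cmat y (\<lambda>v. s * g v) = (\<lambda>v. s * cmat y g v)"
  by (simp add: cmat_def fun_eq_iff sum_distrib_left mult.left_commute)

lemma del_diff: "del y (g - h) = del y g - del y h"
  by (simp add: del_def fun_eq_iff cmat_diff algebra_simps)

lemma del_add: "del y (g + h) = del y g + del y h"
  by (simp add: del_def fun_eq_iff cmat_add algebra_simps)

lemma del_scale: "del y (\<lambda>v. s * g v) = (\<lambda>v. s * del y g v)"
  by (simp add: del_def fun_eq_iff cmat_scale algebra_simps)

lemma cmat_Nm:
  assumes y: "y \<in> L" and W: "E \<subseteq> W" and g: "g \<in> Nm W" shows "cmat y g \<in> Nm W"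
proof -
  have "cf y v w * g v \<in> polyring W" if "v \<in> V" "w \<in> V" for v w
  proof (rule polyring_times)
    show "cf y v w \<in> polyring W"
      using cf(1)[OF y that(1)] that by (intro polyring_mono[OF W]) (simp add: idx_mod_def)
    show "g v \<in> polyring W" using g that by (simp add: idx_mod_def)
  qed
  moreover have "cf y v w = 0" if "v \<in> V" "w \<notin> V" for v w
    using cf(1)[OF y that(1)] that by (simp add: idx_mod_def)
  ultimately show ?thesis by (auto simp: idx_mod_def cmat_def)
qed

lemma del_Nm:
  assumes y: "y \<in> W" and W: "E \<subseteq> W" "W \<subseteq> L" and g: "g \<in> Nm W" shows "del y g \<in> Nm W"
proof -
  have "cmat y g \<in> Nm W" using y W g by (intro cmat_Nm) auto
  moreover have "(\<lambda>w. Var y * g w) \<in> Nm W" using y g by (intro Nm_scale polyring_Var)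
  ultimately show ?thesis using Nm_diff[of "\<lambda>w. Var y * g w" W "cmat y g"] by (simp add: del_def fun_diff_def)
qed

lemma ev_del: assumes "y \<in> L" "g \<in> Nm L" shows "ev (del y g) \<in> J"
proof -
  have "ev (cmat y g) = (\<Sum>v\<in>V. g v * ev (cf y v))"
    unfolding ev_def cmat_def by (simp add: sum_distrib_left sum_distrib_right mult_ac) (rule sum.swap)
  then have "ev (del y g) = (\<Sum>v\<in>V. g v * (Var y * gen v - ev (cf y v)))"
    using ev_diff[of "\<lambda>w. Var y * g w" "cmat y g"] ev_scale[of "Var y" g]
    by (simp add: del_def fun_diff_def algebra_simps sum_subtractf)
      (simp add: ev_def sum_distrib_left mult_ac)
  also have "\<dots> \<in> J" using cf(2)[OF assms(1)] assms(2) by (intro J_sum J_times) (auto simp: idx_mod_def)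
  finally show ?thesis .
qed

text \<open>Both composites express the product of y, z and \<open>gen u\<close> in the basis, and
  such an expression over \<open>E\<close> is unique.\<close>

lemma cmat_comm:
  assumes y: "y \<in> L" "z \<in> L" and g: "g \<in> Nm L"
  shows "cmat y (cmat z g) = cmat z (cmat y g)"
proof -
  have cc: "cmat y (cmat z g) w = (\<Sum>u\<in>V. cmat y (cf z u) w * g u)" for y z w
    by (simp add: cmat_def sum_distrib_left sum_distrib_right mult.assoc) (rule sum.swap)
  have key: "ev (cmat y (cf z u)) - Var y * Var z * gen u \<in> J" if "u \<in> V" "y \<in> L" "z \<in> L" for u y z
  proof -
    have "cf z u \<in> Nm L" using cf(1)[of z u] that Nm_mono[OF E_L] by blast
    from J_uminus[OF ev_del[OF that(2) this]]
    have "ev (cmat y (cf z u)) - Var y * ev (cf z u) \<in> J"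
      using ev_diff[of "\<lambda>w. Var y * cf z u w" "cmat y (cf z u)"] ev_scale[of "Var y" "cf z u"]
      by (simp add: del_def fun_diff_def)
    moreover have "Var y * (Var z * gen u - ev (cf z u)) \<in> J"
      using cf(2)[of z u] that by (intro J_times) auto
    ultimately show ?thesis using J_diff by (fastforce simp: algebra_simps)
  qed
  have "cmat y (cf z u) = cmat z (cf y u)" if u: "u \<in> V" for u
  proof -
    have "cmat y (cf z u) - cmat z (cf y u) \<in> Nm E"
      using cf(1) u y by (intro Nm_diff cmat_Nm) auto
    moreover have "ev (cmat y (cf z u) - cmat z (cf y u)) \<in> J"
      using J_diff[OF key[OF u y] key[OF u y(2,1)]] by (simp add: ev_diff mult.commute[of "Var y" "Var z"])
    ultimately have "cmat y (cf z u) - cmat z (cf y u) = 0" by (rule ev_inj)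
    then show ?thesis by simp
  qed
  then show ?thesis by (auto simp: cc fun_eq_iff)
qed

lemma del_comm:
  assumes "y \<in> L" "z \<in> L" "g \<in> Nm L" shows "del y (del z g) = del z (del y g)"
proof -
  have d: "cmat y (del z g) = (\<lambda>w. Var z * cmat y g w - cmat y (cmat z g) w)" for y z
    using cmat_diff[of y "\<lambda>w. Var z * g w" "cmat z g"] cmat_scale[of y "Var z" g]
    by (simp add: del_def fun_diff_def)
  show ?thesis
    using cmat_comm[OF assms] by (simp add: del_def[of _ "del _ _"] d fun_eq_iff) (simp add: del_def algebra_simps)
qed

text \<open>The entries of \<open>C_y\<close> lie over \<open>E\<close> and do not involve y, so
  trading y times a vector for its image under \<open>C_y\<close> lowers the degree in y. The
  variable set \<open>W\<close> is arbitrary so that one can divide by several variables in turn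
  without bringing back the earlier ones.\<close>

lemma divide_exists:
  assumes y: "y \<in> W" "y \<notin> E" and W: "E \<subseteq> W" "W \<subseteq> L" and g: "g \<in> Nm W"
  shows "\<exists>q\<in>Nm W. \<exists>\<rho>\<in>Nm (W - {y}). g = del y q + \<rho>"
proof -
  have *: "\<exists>q\<in>Nm W. \<exists>\<rho>\<in>Nm (W - {y}). g = del y q + \<rho>" if "g \<in> Nm W" "\<forall>v\<in>V. var_le k y (g v)" for k g
    using that
  proof (induction k arbitrary: g)
    case 0
    have "g \<in> Nm (W - {y})" using 0 polyring_remove[of _ W y] by (auto simp: idx_mod_def)
    moreover have "g = del y 0 + g" by (simp add: del_def cmat_def fun_eq_iff)
    ultimately show ?case using Nm_0 by blast
  next
    case (Suc k)
    have "\<exists>p1 p0. p1 \<in> polyring W \<and> p0 \<in> polyring (W - {y}) \<and> g v = Var y * p1 + p0 \<and> var_le k y p1" if "v \<in> V" for v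
    proof -
      have "g v \<in> polyring W" using Suc.prems(1) that by (simp add: idx_mod_def)
      from split_variable[OF this, of y] show ?thesis using Suc.prems(2) that by blast
    qed
    then obtain p1 p0 where p: "\<And>v. v \<in> V \<Longrightarrow> p1 v \<in> polyring W \<and> p0 v \<in> polyring (W - {y}) \<and>
        g v = Var y * p1 v + p0 v \<and> var_le k y (p1 v)" by metis
    define g1 where "g1 = (\<lambda>v. if v \<in> V then p1 v else 0)"
    define g0 where "g0 = (\<lambda>v. if v \<in> V then p0 v else 0)"
    have g1: "g1 \<in> Nm W" and g0: "g0 \<in> Nm (W - {y})" using p by (auto simp: g1_def g0_def idx_mod_def)
    have gg: "g = del y g1 + (cmat y g1 + g0)"
      using p Suc.prems(1) by (auto simp: fun_eq_iff del_def g1_def g0_def idx_mod_def)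
    have n: "cmat y g1 + g0 \<in> Nm W"
      using g1 g0 y W Nm_mono[of "W - {y}" W g0] by (intro Nm_add cmat_Nm) auto
    have "var_le k y ((cmat y g1 + g0) w)" if w: "w \<in> V" for w
    proof -
      have "var_le k y (cf y v w * g1 v)" if v: "v \<in> V" for v
      proof (rule var_le_free_times[of _ E])
        show "cf y v w \<in> polyring E" using cf(1)[of y v] y W v w by (auto simp: idx_mod_def)
        show "var_le k y (g1 v)" using p v by (simp add: g1_def)
      qed (use y in auto)
      then have "var_le k y (cmat y g1 w)" unfolding cmat_def by (intro var_le_sum)
      moreover have "var_le k y (g0 w)" using g0 w by (intro var_le_free[of _ "W - {y}"]) (auto simp: idx_mod_def)
      ultimately show ?thesis by (simp add: var_le_add)
    qed
    then obtain q \<rho> where "q \<in> Nm W" "\<rho> \<in> Nm (W - {y})" "cmat y g1 + g0 = del y q + \<rho>"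
      using Suc.IH[OF n] by blast
    then have "g1 + q \<in> Nm W" "g = del y (g1 + q) + \<rho>" "\<rho> \<in> Nm (W - {y})"
      using g1 gg by (simp_all only: Nm_add del_add add.assoc)
    then show ?case by blast
  qed
  with *[OF g] var_le_bound[OF fin_V, of y g] show ?thesis by blast
qed

text \<open>Neither the remainder nor the term with \<open>C_y\<close> can have a larger degree in y
  than q, hence \<open>Var y * q\<close> cannot either. Any bound on the degree of q can thus be
  lowered until q vanishes.\<close>

lemma divide_unique:
  assumes y: "y \<in> L" "y \<notin> E" and q: "q \<in> Nm L" and d: "del y q \<in> Nm (L - {y})"
  shows "q = 0"
proof -
  have step: "var_le k y (Var y * q w)" if b: "\<forall>v\<in>V. var_le k y (q v)" and w: "w \<in> V" for k w
  proof -
    have "var_le k y (cf y v w * q v)" if v: "v \<in> V" for v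
      using cf(1)[of y v] y v w b by (intro var_le_free_times[of _ E]) (auto simp: idx_mod_def)
    then have "var_le k y (cmat y q w)" unfolding cmat_def by (intro var_le_sum)
    moreover have "var_le k y (del y q w)" using d w by (intro var_le_free[of _ "L - {y}"]) (auto simp: idx_mod_def)
    ultimately have "var_le k y (cmat y q w + del y q w)" by (rule var_le_add)
    then show ?thesis by (simp add: del_def)
  qed
  have *: "(\<forall>v\<in>V. var_le k y (q v)) \<Longrightarrow> \<forall>v\<in>V. q v = 0" for k
  proof (induction k)
    case 0
    then show ?case using step[of 0] var_le_Var_times_0 by blast
  next
    case (Suc k)
    then show ?case using step[of "Suc k"] var_le_Var_times by blast
  qed
  with var_le_bound[OF fin_V, of y q] have "\<forall>v\<in>V. q v = 0" by blast
  with q show ?thesis by (auto simp: idx_mod_def fun_eq_iff)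
qed

definition quo :: "pt \<Rightarrow> ('v \<Rightarrow> 'k mpoly) \<Rightarrow> 'v \<Rightarrow> 'k mpoly" where
  "quo y g = (SOME q. q \<in> Nm L \<and> g - del y q \<in> Nm (L - {y}))"

lemma quo:
  assumes "y \<in> L - E" "g \<in> Nm L" shows "quo y g \<in> Nm L" "g - del y (quo y g) \<in> Nm (L - {y})"
proof -
  have "\<exists>q. q \<in> Nm L \<and> g - del y q \<in> Nm (L - {y})"
    using divide_exists[of y L g] assms E_L by force
  from someI_ex[OF this] show "quo y g \<in> Nm L" "g - del y (quo y g) \<in> Nm (L - {y})"
    by (auto simp: quo_def)
qed

lemma quo_unique:
  assumes y: "y \<in> L - E" and g: "g \<in> Nm L" and q: "q \<in> Nm L" "g - del y q \<in> Nm (L - {y})"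
  shows "quo y g = q"
proof -
  have "quo y g - q = 0"
  proof (rule divide_unique)
    show "quo y g - q \<in> Nm L" using quo[OF y g] q by (intro Nm_diff)
    have "(g - del y q) - (g - del y (quo y g)) \<in> Nm (L - {y})"
      by (rule Nm_diff[OF q(2) quo(2)[OF y g]])
    moreover have "(g - del y q) - (g - del y (quo y g)) = del y (quo y g - q)" by (simp add: del_diff)
    ultimately show "del y (quo y g - q) \<in> Nm (L - {y})" by simp
  qed (use y in auto)
  then show ?thesis by simp
qed

sublocale koszul_ops "L - E" "Nm L" del quo
proof
  show "finite (L - E)" using fin_L by simp
  show "0 \<in> Nm L" by (rule Nm_0)
  show "g - h \<in> Nm L" if "g \<in> Nm L" "h \<in> Nm L" for g h using that by (rule Nm_diff)
  fix y assume y: "y \<in> L - E"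
  fix g h assume g: "g \<in> Nm L"
  show dN: "del y g \<in> Nm L" using y g E_L by (intro del_Nm) auto
  show "quo y g \<in> Nm L" using quo[OF y g] by simp
  show "quo y (del y g) = g" using y g Nm_0 by (intro quo_unique dN) auto
  { fix z assume z: "z \<in> L - E"
    show "del y (del z g) = del z (del y g)" using y z g by (intro del_comm) auto
    assume yz: "y \<noteq> z"
    show "quo y (del z g) = del z (quo y g)"
    proof (rule quo_unique[OF y])
      show "del z g \<in> Nm L" "del z (quo y g) \<in> Nm L"
        using y z g quo[OF y g] E_L by (auto intro!: del_Nm)
      \<comment> \<open>The operator of z keeps the remainder free of y, since its matrix lies over
        \<open>E\<close> and z differs from y.\<close>
      have "del z (g - del y (quo y g)) \<in> Nm (L - {y})"
        using y z yz E_L quo[OF y g] by (intro del_Nm) auto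
      then show "del z g - del y (del z (quo y g)) \<in> Nm (L - {y})"
        using del_comm[of y z "quo y g"] y z quo[OF y g] by (simp add: del_diff)
    qed }
  assume h: "h \<in> Nm L"
  show "del y (g - h) = del y g - del y h" by (rule del_diff)
  show "quo y (g - h) = quo y g - quo y h"
  proof (rule quo_unique[OF y])
    have "(g - del y (quo y g)) - (h - del y (quo y h)) \<in> Nm (L - {y})"
      by (rule Nm_diff[OF quo(2)[OF y g] quo(2)[OF y h]])
    then show "g - h - del y (quo y g - quo y h) \<in> Nm (L - {y})" by (simp add: del_diff algebra_simps)
  qed (use g h quo[OF y g] quo[OF y h] in \<open>auto intro!: Nm_diff\<close>)
qed

lemma ev_kos: assumes "z \<in> Ch p" shows "ev (kos z T) \<in> J"
proof -
  have "ev (sgop b (del t g)) \<in> J" if "t \<in> L" "g \<in> Nm L" for b t g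
  proof -
    have "ev (- del t g) = - ev (del t g)" using ev_diff[of 0 "del t g"] by (simp add: ev_def)
    then show ?thesis using ev_del[OF that] J_uminus by (simp add: sgop_def)
  qed
  then show ?thesis unfolding kos_def ev_sum using Ch_N[OF assms] by (intro J_sum) auto
qed

text \<open>Dividing by all variables outside \<open>E\<close> in turn leaves a remainder over
  \<open>E\<close>. It evaluates into \<open>J\<close>, so it is 0, and the quotients are the values
  of the required 1-chain on singletons.\<close>

lemma kos_exact_0:
  assumes g: "g \<in> Nm L" and J: "ev g \<in> J"
  shows "\<exists>z\<in>Ch 1. kos z {} = g"
proof -
  have "\<exists>h \<rho>. (\<forall>y. h y \<in> Nm L) \<and> \<rho> \<in> Nm (L - X) \<and> g = (\<Sum>y\<in>X. del y (h y)) + \<rho>"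
    if "finite X" "X \<subseteq> L - E" for X
    using that
  proof (induction X)
    case empty
    show ?case using g by (intro exI[of _ "\<lambda>_. 0 :: 'v \<Rightarrow> 'k mpoly"]) (simp add: idx_mod_def)
  next
    case (insert y X)
    then obtain h \<rho> where h: "\<forall>y. h y \<in> Nm L" "\<rho> \<in> Nm (L - X)" "g = (\<Sum>y\<in>X. del y (h y)) + \<rho>"
      using insert.IH insert.prems by blast
    obtain q \<rho>' where q: "q \<in> Nm (L - X)" "\<rho>' \<in> Nm (L - X - {y})" "\<rho> = del y q + \<rho>'"
      using divide_exists[of y "L - X" \<rho>] insert h E_L by blast
    have "(\<Sum>z\<in>X. del z ((h(y := q)) z)) = (\<Sum>y\<in>X. del y (h y))"
      using insert by (intro sum.cong) auto
    then have "g = (\<Sum>z\<in>insert y X. del z ((h(y := q)) z)) + \<rho>'"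
      using insert h(3) q(3) by (simp add: add.assoc add.left_commute)
    moreover have "L - X - {y} = L - insert y X" by auto
    moreover have "\<forall>z. (h(y := q)) z \<in> Nm L" using h(1) q(1) Nm_mono[of "L - X" L q] by simp
    ultimately show ?case using q(2) by metis
  qed
  from this[of "L - E"] obtain h \<rho> where h: "\<forall>y. h y \<in> Nm L" "\<rho> \<in> Nm (L - (L - E))"
    "g = (\<Sum>y\<in>L - E. del y (h y)) + \<rho>" using fin_L by auto
  have "\<rho> = 0"
  proof (rule ev_inj)
    show "\<rho> \<in> Nm E" using h(2) E_L by (simp add: double_diff)
    have "(\<Sum>y\<in>L - E. ev (del y (h y))) \<in> J" using h(1) by (intro J_sum ev_del) auto
    moreover have "ev g = (\<Sum>y\<in>L - E. ev (del y (h y))) + ev \<rho>" by (simp only: h(3) ev_add ev_sum)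
    ultimately show "ev \<rho> \<in> J" using J J_diff by fastforce
  qed
  define z where "z T = (if \<exists>y\<in>L - E. T = {y} then h (the_elem T) else 0)" for T
  have "z \<in> Ch 1" using h(1) by (auto simp: Ch_def z_def Nm_0)
  moreover have "kos z {} = (\<Sum>y\<in>L - E. del y (h y))"
    unfolding kos_def by (intro sum.cong) (auto simp: z_def par_def)
  ultimately show ?thesis using h(3) \<open>\<rho> = 0\<close> by auto
qed

end

section \<open>The resolution attached to a free basis\<close>

lemma sum_fun_apply: "(\<Sum>i\<in>I. f i) w = (\<Sum>i\<in>I. f i w :: 'b::comm_monoid_add)"
  by (induction I rule: infinite_finite_induct) auto

lemma sgop_apply: "sgop b g w = sgop b (g w)"
  by (simp add: sgop_def)

lemma sgop_mult: "sgop b (s * g) = s * sgop b (g :: 'a::ring)"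
  by (simp add: sgop_def)

lemma sgop_add: "sgop b (g + h) = sgop b g + sgop b h"
  by (simp add: sgop_def)

lemma homog_sgop: "homog g e \<Longrightarrow> homog (sgop b g) e"
  by (simp add: sgop_def homog_uminus)

context free_over
begin

lemma kos_apply: "kos z T w = (\<Sum>t\<in>L - E - T. sgop (par t T) (del t (z (insert t T)) w))"
  by (simp add: kos_def sum_fun_apply sgop_apply)

lemma kos_add: "kos (z + z') = kos z + kos z'"
  by (simp add: fun_eq_iff kos_apply del_add sgop_add sum.distrib)

lemma kos_scale: "kos (\<lambda>T w. s * z T w) = (\<lambda>T w. s * kos z T w)"
  by (simp add: fun_eq_iff kos_apply del_scale sgop_mult sum_distrib_left)

lemma kos_const_0: "kos (\<lambda>T w. 0) = (\<lambda>T w. 0)"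
  using kos_scale[of 0 "\<lambda>_ _. 0"] by simp

lemma kos_0: "kos 0 = 0"
proof -
  have "(0 :: pt set \<Rightarrow> 'v \<Rightarrow> 'k mpoly) = (\<lambda>T w. 0)" by (intro ext) simp
  then show ?thesis using kos_const_0 by simp
qed

lemma kos_sum:
  "kos (\<lambda>T w. \<Sum>v\<in>A. y v * Z v T w) = (\<lambda>T w. \<Sum>v\<in>A. y v * kos (Z v) T w)"
proof (induction A rule: infinite_finite_induct)
  case (insert v A)
  have "(\<lambda>T w. \<Sum>v\<in>insert v A. y v * Z v T w) = (\<lambda>T w. y v * Z v T w) + (\<lambda>T w. \<Sum>v\<in>A. y v * Z v T w)"
    using insert by (simp add: fun_eq_iff)
  then show ?case using insert by (simp only: kos_add) (simp add: kos_scale fun_eq_iff)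
qed (simp_all add: kos_const_0)

lemma Ch_add: "z \<in> Ch p \<Longrightarrow> w \<in> Ch p \<Longrightarrow> z + w \<in> Ch p"
proof -
  assume z: "z \<in> Ch p" and w: "w \<in> Ch p"
  have "T \<subseteq> L - E \<and> card T = p" if "(z + w) T \<noteq> 0" for T
  proof -
    have "z T \<noteq> 0 \<or> w T \<noteq> 0" using that by auto
    then show ?thesis using z w unfolding Ch_def by blast
  qed
  then show ?thesis using z w by (simp add: Ch_def Nm_add)
qed

lemma Ch_iff: "z \<in> Ch p \<longleftrightarrow> (\<forall>T w. z T w \<in> polyring L) \<and>
    (\<forall>T w. z T w \<noteq> 0 \<longrightarrow> T \<subseteq> L - E \<and> card T = p \<and> w \<in> V)"
proof
  assume z: "z \<in> Ch p"
  have N: "z T \<in> Nm L" for T using z by (rule Ch_N)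
  have "z T w \<in> polyring L" for T w
    using N[of T] by (cases "w \<in> V") (auto simp: idx_mod_def)
  moreover have "T \<subseteq> L - E \<and> card T = p \<and> w \<in> V" if nz: "z T w \<noteq> 0" for T w
  proof -
    have "z T \<noteq> 0" using nz by auto
    moreover have "w \<in> V" using N[of T] nz by (auto simp: idx_mod_def)
    ultimately show ?thesis using z by (simp add: Ch_def)
  qed
  ultimately show "(\<forall>T w. z T w \<in> polyring L) \<and>
    (\<forall>T w. z T w \<noteq> 0 \<longrightarrow> T \<subseteq> L - E \<and> card T = p \<and> w \<in> V)" by blast
next
  assume z: "(\<forall>T w. z T w \<in> polyring L) \<and>
    (\<forall>T w. z T w \<noteq> 0 \<longrightarrow> T \<subseteq> L - E \<and> card T = p \<and> w \<in> V)"
  have "z T \<in> Nm L" for T using z by (auto simp: idx_mod_def)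
  moreover have "T \<subseteq> L - E \<and> card T = p" if nz: "z T \<noteq> 0" for T
  proof -
    obtain w where "z T w \<noteq> 0" using nz by (auto simp: fun_eq_iff)
    then show ?thesis using z by blast
  qed
  ultimately show "z \<in> Ch p" by (simp add: Ch_def)
qed

lemma Ch_sum:
  assumes "\<And>v. v \<in> A \<Longrightarrow> y v \<in> polyring L" "\<And>v. v \<in> A \<Longrightarrow> Z v \<in> Ch p"
  shows "(\<lambda>T w. \<Sum>v\<in>A. y v * Z v T w) \<in> Ch p"
proof -
  have "\<exists>v\<in>A. Z v T w \<noteq> 0" if "(\<Sum>v\<in>A. y v * Z v T w) \<noteq> 0" for T w
    using that by (metis (no_types, lifting) mult_zero_right sum.neutral)
  then have "T \<subseteq> L - E \<and> card T = p \<and> w \<in> V" if "(\<Sum>v\<in>A. y v * Z v T w) \<noteq> 0" for T w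
    using assms(2) that unfolding Ch_iff by blast
  moreover have "(\<Sum>v\<in>A. y v * Z v T w) \<in> polyring L" for T w
    using assms unfolding Ch_iff by (intro polyring_sum polyring_times) blast+
  ultimately show ?thesis unfolding Ch_iff by blast
qed

section \<open>The grading of the Koszul complex\<close>

lemma del_homog:
  assumes "t \<in> L" "\<And>v. v \<in> V \<Longrightarrow> homog (g v) (e - int (dg v))" "w \<in> V"
  shows "homog (del t g w) (e + 1 - int (dg w))"
proof -
  have "homog (Var t * g w) (e + 1 - int (dg w))"
    using homog_times[OF homog_Var assms(2)[OF assms(3)], of t] by (simp add: algebra_simps)
  moreover have "homog (cf t v w * g v) (e + 1 - int (dg w))" if "v \<in> V" for v
    using homog_times[OF cf_hom[OF assms(1) that, of w] assms(2)[OF that]] by (simp add: algebra_simps)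
  ultimately show ?thesis unfolding del_def cmat_def by (intro homog_diff homog_sum)
qed

text \<open>The basis vector at \<open>(T, w)\<close> has degree \<open>card T + dg w\<close>, which
  is subtracted from the degree e of the chain.\<close>

definition homog_ch :: "int \<Rightarrow> (pt set \<Rightarrow> 'v \<Rightarrow> 'k mpoly) \<Rightarrow> bool" where
  "homog_ch e z \<longleftrightarrow> (\<forall>T w. T \<subseteq> L - E \<longrightarrow> w \<in> V \<longrightarrow> homog (z T w) (e - int (card T) - int (dg w)))"

lemma finite_subset_L: "T \<subseteq> L - E \<Longrightarrow> finite T"
  using fin_L finite_subset by blast

lemma homog_ch_kos: assumes "homog_ch e z" shows "homog_ch e (kos z)"
  unfolding homog_ch_def
proof (intro allI impI)
  fix T w assume T: "T \<subseteq> L - E" and w: "w \<in> V"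
  have "homog (del t (z (insert t T)) w) (e - int (card T) - int (dg w))" if t: "t \<in> L - E - T" for t
  proof -
    have "insert t T \<subseteq> L - E" using T t by blast
    then have "homog (z (insert t T) v) (e - int (card (insert t T)) - int (dg v))" if "v \<in> V" for v
      using assms that by (simp add: homog_ch_def)
    then have "homog (del t (z (insert t T)) w) (e - int (card (insert t T)) + 1 - int (dg w))"
      using t w by (intro del_homog) auto
    then show ?thesis using t finite_subset_L[OF T] by simp
  qed
  then show "homog (kos z T w) (e - int (card T) - int (dg w))"
    unfolding kos_apply by (intro homog_sum homog_sgop)
qed

definition hcomp_ch :: "int \<Rightarrow> (pt set \<Rightarrow> 'v \<Rightarrow> 'k mpoly) \<Rightarrow> pt set \<Rightarrow> 'v \<Rightarrow> 'k mpoly" where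
  "hcomp_ch e z = (\<lambda>T w. hcomp (e - int (card T) - int (dg w)) (z T w))"

lemma homog_ch_hcomp_ch: "homog_ch e (hcomp_ch e z)"
  by (simp add: homog_ch_def hcomp_ch_def)

lemma hcomp_ch_Ch: "z \<in> Ch p \<Longrightarrow> hcomp_ch e z \<in> Ch p"
  unfolding Ch_iff hcomp_ch_def by (metis hcomp_0 polyring_hcomp)

lemma hcomp_del:
  assumes "t \<in> L"
  shows "del t (\<lambda>v. hcomp (e - int (dg v)) (g v)) w = hcomp (e + 1 - int (dg w)) (del t g w)"
proof -
  have "Var t * hcomp (e - int (dg w)) (g w) = hcomp (e + 1 - int (dg w)) (Var t * g w)"
    using hcomp_times[OF homog_Var, of "e + 1 - int (dg w)" t "g w"] by (simp add: algebra_simps)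
  moreover have "cf t v w * hcomp (e - int (dg v)) (g v) = hcomp (e + 1 - int (dg w)) (cf t v w * g v)"
    if "v \<in> V" for v
    using hcomp_times[OF cf_hom[OF assms that, of w], of "e + 1 - int (dg w)" "g v"] by (simp add: algebra_simps)
  ultimately show ?thesis by (simp add: del_def cmat_def hcomp_diff hcomp_sum)
qed

lemma hcomp_sgop: "hcomp e (sgop b g) = sgop b (hcomp e g)"
  using hcomp_diff[of e 0 g] by (simp add: sgop_def)

lemma kos_hcomp_ch: assumes "T \<subseteq> L - E" shows "kos (hcomp_ch e z) T w = hcomp_ch e (kos z) T w"
proof -
  have "del t (hcomp_ch e z (insert t T)) w = hcomp (e - int (card T) - int (dg w)) (del t (z (insert t T)) w)"
    if "t \<in> L - E - T" for t
    using hcomp_del[of t "e - int (card (insert t T))" "z (insert t T)" w] that finite_subset_L[OF assms]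
    by (simp add: hcomp_ch_def algebra_simps)
  then show ?thesis by (simp add: kos_apply hcomp_ch_def hcomp_sum hcomp_sgop)
qed

text \<open>The vector e_v - \<open>gen v\<close> * e_v0. Because \<open>gen v0 = 1\<close>, these
  vectors for the v other than \<open>v0\<close> form a basis of the kernel of \<open>ev\<close> on
  \<open>Nm L\<close>.\<close>

definition rel :: "'v \<Rightarrow> 'v \<Rightarrow> 'k mpoly" where
  "rel v = (\<lambda>w. (if w = v then 1 else 0) - (if w = v0 then gen v else 0))"

lemma ev_rel: assumes "v \<in> V" shows "ev (rel v) = 0"
proof -
  have "ev (rel v) = (\<Sum>w\<in>V. if w = v then gen w else 0) - (\<Sum>w\<in>V. if w = v0 then gen v * gen w else 0)"
    unfolding ev_def rel_def sum_subtractf[symmetric] by (intro sum.cong) (auto simp: algebra_simps)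
  also have "\<dots> = 0" using assms v0 fin_V by simp
  finally show ?thesis .
qed

text \<open>\<open>ev\<close> kills the vector \<open>rel v\<close>, so \<open>kos_exact_0\<close>
  makes it a boundary. It is homogeneous of degree \<open>dg v\<close>, so the component of that
  degree of a preimage is again a preimage.\<close>

lemma section_exists:
  assumes v: "v \<in> V - {v0}"
  shows "\<exists>z\<in>Ch 1. kos z {} = rel v \<and> homog_ch (int (dg v)) z"
proof -
  have "rel v \<in> Nm L" using v v0 gen_L by (auto simp: idx_mod_def rel_def)
  then obtain z where z: "z \<in> Ch 1" "kos z {} = rel v"
    using kos_exact_0[of "rel v"] ev_rel v J_0 by auto
  have "kos (hcomp_ch (int (dg v)) z) {} w = rel v w" for w
  proof -
    have "homog (rel v w) (int (dg v) - int (dg w))"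
      using v v0 gen_hom[of v] by (auto simp: rel_def homog_uminus)
    then show ?thesis using kos_hcomp_ch[of "{}" "int (dg v)" z w]
      by (simp add: z hcomp_ch_def[of _ "kos z"] homog_iff_hcomp)
  qed
  then show ?thesis using hcomp_ch_Ch[OF z(1)] homog_ch_hcomp_ch by (intro bexI[of _ "hcomp_ch (int (dg v)) z"]) auto
qed

definition lift_rel :: "'v \<Rightarrow> pt set \<Rightarrow> 'v \<Rightarrow> 'k mpoly" where
  "lift_rel v = (SOME z. z \<in> Ch 1 \<and> kos z {} = rel v \<and> homog_ch (int (dg v)) z)"

lemma lift_rel: assumes "v \<in> V - {v0}" shows "lift_rel v \<in> Ch 1" "kos (lift_rel v) {} = rel v" "homog_ch (int (dg v)) (lift_rel v)"
proof -
  have "\<exists>z. z \<in> Ch 1 \<and> kos z {} = rel v \<and> homog_ch (int (dg v)) z" using section_exists[OF assms] by blast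
  from someI_ex[OF this] show "lift_rel v \<in> Ch 1" "kos (lift_rel v) {} = rel v" "homog_ch (int (dg v)) (lift_rel v)"
    by (auto simp: lift_rel_def)
qed

definition lift_sum :: "('v \<Rightarrow> 'k mpoly) \<Rightarrow> pt set \<Rightarrow> 'v \<Rightarrow> 'k mpoly" where
  "lift_sum y = (\<lambda>T w. \<Sum>v\<in>V - {v0}. y v * lift_rel v T w)"

lemma lift_sum_Ch: "(\<And>v. v \<in> V - {v0} \<Longrightarrow> y v \<in> polyring L) \<Longrightarrow> lift_sum y \<in> Ch 1"
  unfolding lift_sum_def using lift_rel(1) by (intro Ch_sum) auto

lemma kos_lift_sum: "kos (lift_sum y) {} w = (\<Sum>v\<in>V - {v0}. y v * rel v w)"
  using lift_rel(2) by (simp add: lift_sum_def kos_sum)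

lemma kos_lift_sum_other: assumes "w \<in> V" "w \<noteq> v0" shows "kos (lift_sum y) {} w = y w"
proof -
  have "kos (lift_sum y) {} w = (\<Sum>v\<in>V - {v0}. if w = v then y v else 0)"
    unfolding kos_lift_sum using assms by (intro sum.cong) (auto simp: rel_def)
  then show ?thesis using assms fin_V by simp
qed

lemma kos_lift_sum_v0: "kos (lift_sum y) {} v0 = - (\<Sum>v\<in>V - {v0}. y v * gen v)"
  unfolding kos_lift_sum sum_negf[symmetric] by (intro sum.cong) (auto simp: rel_def)

lemma ev_kos_lift_sum: "ev (kos (lift_sum y) {}) = 0"
proof -
  have "ev (kos (lift_sum y) {}) = (\<Sum>w\<in>V. \<Sum>v\<in>V - {v0}. y v * (rel v w * gen w))"
    by (simp add: ev_def kos_lift_sum sum_distrib_right mult.assoc)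
  also have "\<dots> = (\<Sum>v\<in>V - {v0}. y v * ev (rel v))"
    by (subst sum.swap) (simp add: ev_def sum_distrib_left)
  finally show ?thesis by (simp add: ev_rel)
qed

definition main :: "nat \<Rightarrow> (pt set \<times> 'v) set" where
  "main i = {(T, v). T \<subseteq> L - E \<and> card T = i \<and> v \<in> V}"

text \<open>The Koszul complex resolves the module presented by all of \<open>V\<close>. To start the resolution
  with one generator, the generators \<open>v \<noteq> v0\<close> of position 0 are moved to position 2 as \<open>({}, v)\<close>
  and mapped to chains \<open>lift_rel v\<close> that lift the relations \<open>e_v = gen v * e_v0\<close>.\<close>
definition B :: "nat \<Rightarrow> (pt set \<times> 'v) set" where
  "B i = (if i = 0 then {({}, v0)} else main i \<union> (if i = 2 then {{}} \<times> (V - {v0}) else {}))"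

definition kpart :: "nat \<Rightarrow> (pt set \<times> 'v \<Rightarrow> 'k mpoly) \<Rightarrow> pt set \<Rightarrow> 'v \<Rightarrow> 'k mpoly" where
  "kpart i x = (\<lambda>T v. if (T, v) \<in> main i then x (T, v) else 0)"

text \<open>Following the first Koszul map by \<open>ev\<close> lands in K[L] but creates new
  cycles: the 1-chains whose Koszul boundary is a combination of the \<open>rel v\<close>. The
  \<open>lift_sum\<close> term in position 2 turns them into boundaries.\<close>

definition rdiff :: "nat \<Rightarrow> (pt set \<times> 'v \<Rightarrow> 'k mpoly) \<Rightarrow> pt set \<times> 'v \<Rightarrow> 'k mpoly" where
  "rdiff i x = (if i = 1 then (\<lambda>b. if b = ({}, v0) then ev (kos (kpart 1 x) {}) else 0)
     else if i = 2 then (\<lambda>(T, w). kos (kpart 2 x) T w + lift_sum (\<lambda>v. x ({}, v)) T w)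
     else (\<lambda>(T, w). kos (kpart i x) T w))"

definition deg :: "pt set \<times> 'v \<Rightarrow> int" where
  "deg = (\<lambda>(T, v). int (card T) + int (dg v))"

section \<open>The modified complex and its exactness\<close>

lemma main_finite: "finite (main i)"
proof -
  have "main i \<subseteq> Pow (L - E) \<times> V" by (auto simp: main_def)
  then show ?thesis using fin_L fin_V by (meson finite_Diff finite_Pow_iff finite_SigmaI finite_subset)
qed

lemma main_B: "i \<ge> 1 \<Longrightarrow> main i \<subseteq> B i"
  by (auto simp: B_def)

lemma kpart_Ch: "i \<ge> 1 \<Longrightarrow> x \<in> idx_mod L (B i) \<Longrightarrow> kpart i x \<in> Ch i"
proof -
  assume i: "i \<ge> 1" and x: "x \<in> idx_mod L (B i)"
  have "x (T, v) \<in> polyring L" if "(T, v) \<in> main i" for T v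
    using x main_B[OF i] that by (auto simp: idx_mod_def)
  then show ?thesis unfolding Ch_iff by (auto simp: kpart_def) (auto simp: main_def)
qed

lemma unc_idx_mod: "z \<in> Ch i \<Longrightarrow> case_prod z \<in> idx_mod L (main i)"
proof -
  assume "z \<in> Ch i"
  then have "\<forall>T w. z T w \<in> polyring L" "\<forall>T w. z T w \<noteq> 0 \<longrightarrow> (T, w) \<in> main i"
    unfolding Ch_iff by (auto simp: main_def)
  then show ?thesis unfolding idx_mod_def by (auto split: prod.splits)
qed

lemma kpart_unc: "z \<in> Ch i \<Longrightarrow> kpart i (case_prod z) = z"
  unfolding Ch_iff by (fastforce simp: kpart_def main_def fun_eq_iff)

lemma unc_kpart: "x \<in> idx_mod L (main i) \<Longrightarrow> case_prod (kpart i x) = x"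
  by (auto simp: kpart_def idx_mod_def fun_eq_iff)

lemma idx_mod_mono: "A \<subseteq> A' \<Longrightarrow> x \<in> idx_mod L A \<Longrightarrow> x \<in> idx_mod L A'"
proof -
  assume A: "A \<subseteq> A'" and x: "x \<in> idx_mod L A"
  have "x b \<in> polyring L" for b using x by (cases "b \<in> A") (auto simp: idx_mod_def)
  moreover have "x b = 0" if "b \<notin> A'" for b using x A that by (auto simp: idx_mod_def)
  ultimately show ?thesis by (simp add: idx_mod_def)
qed

lemma kpart_add: "kpart i (\<lambda>b. x b + y b) = kpart i x + kpart i y"
  by (auto simp: kpart_def fun_eq_iff)

lemma kpart_scale: "kpart i (\<lambda>b. s * x b) = (\<lambda>T w. s * kpart i x T w)"
  by (auto simp: kpart_def fun_eq_iff)

lemma rdiff_1: "rdiff 1 x ({}, v0) = ev (kos (kpart 1 x) {})" "rdiff (Suc 0) x ({}, v0) = ev (kos (kpart 1 x) {})" "b \<noteq> ({}, v0) \<Longrightarrow> rdiff 1 x b = 0"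
  by (auto simp: rdiff_def)

lemma rdiff_2: "rdiff 2 x = case_prod (kos (kpart 2 x) + lift_sum (\<lambda>v. x ({}, v)))"
  by (auto simp: rdiff_def fun_eq_iff)

lemma rdiff_3: "i \<ge> 3 \<Longrightarrow> rdiff i x = case_prod (kos (kpart i x))"
  by (auto simp: rdiff_def fun_eq_iff)

lemma B_extra: "x \<in> idx_mod L (B 2) \<Longrightarrow> x ({}, v) \<in> polyring L"
  by (cases "({}, v) \<in> B 2") (auto simp: idx_mod_def)

lemma rdiff_2_Ch: "x \<in> idx_mod L (B 2) \<Longrightarrow> kos (kpart 2 x) + lift_sum (\<lambda>v. x ({}, v)) \<in> Ch 1"
  using kos_Ch[of "kpart 2 x" 1] kpart_Ch[of 2 x] B_extra[of x] by (intro Ch_add lift_sum_Ch) (auto simp: numeral_2_eq_2)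

lemma rdiff_maps:
  assumes i: "i \<ge> 1" and x: "x \<in> idx_mod L (B i)" shows "rdiff i x \<in> idx_mod L (B (i - 1))"
proof -
  consider "i = 1" | "i = 2" | "i \<ge> 3" using i by linarith
  then show ?thesis
  proof cases
    case 1
    have "kos (kpart 1 x) {} \<in> Nm L" using kos_Ch[of "kpart 1 x" 0] kpart_Ch[of 1 x] x 1 by (auto intro: Ch_N)
    then show ?thesis using 1 ev_L by (auto simp: rdiff_def idx_mod_def B_def)
  next
    case 2
    then have "rdiff i x \<in> idx_mod L (main 1)" unfolding 2 rdiff_2 using x 2 by (intro unc_idx_mod rdiff_2_Ch) auto
    then show ?thesis using idx_mod_mono[OF main_B[of 1]] 2 by simp
  next
    case 3
    then have "kos (kpart i x) \<in> Ch (i - 1)" using kos_Ch[of "kpart i x" "i - 1"] kpart_Ch[OF i x] by simp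
    then have "rdiff i x \<in> idx_mod L (main (i - 1))" unfolding rdiff_3[OF 3] by (rule unc_idx_mod)
    moreover have "1 \<le> i - 1" using 3 by simp
    ultimately show ?thesis using idx_mod_mono[OF main_B] by blast
  qed
qed

lemma rdiff_add: "rdiff i (\<lambda>b. x b + y b) = (\<lambda>c. rdiff i x c + rdiff i y c)"
proof -
  have "ev (\<lambda>a. g a + h a) = ev g + ev h" for g h using ev_add[of g h] by (simp add: plus_fun_def)
  then show ?thesis
    by (auto simp: rdiff_def kpart_add kos_add fun_eq_iff lift_sum_def algebra_simps sum.distrib ev_add)
qed

lemma rdiff_scale: "rdiff i (\<lambda>b. s * x b) = (\<lambda>c. s * rdiff i x c)"
  by (auto simp: rdiff_def kpart_scale kos_scale fun_eq_iff lift_sum_def algebra_simps sum_distrib_left ev_scale)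

lemma rdiff_homog:
  assumes i: "i \<ge> 1" and b: "b \<in> B i" and b': "b' \<in> B (i - 1)"
  shows "homog (rdiff i (\<lambda>c. if c = b then 1 else 0) b') (deg b - deg b')"
proof -
  define u where "u = (\<lambda>c. if c = b then 1 else 0 :: 'k mpoly)"
  have "homog_ch (deg b) (kpart i u)" by (auto simp: homog_ch_def kpart_def u_def deg_def)
  then have k: "homog_ch (deg b) (kos (kpart i u))" by (rule homog_ch_kos)
  obtain T w where Tw: "b' = (T, w)" by fastforce
  have T: "T \<subseteq> L - E" "w \<in> V" using b' v0 by (auto simp: Tw B_def main_def split: if_splits)
  have hk: "homog (kos (kpart i u) T w) (deg b - deg b')"
    using k T by (auto simp: homog_ch_def Tw deg_def diff_diff_eq)
  consider "i = 1" | "i = 2" | "i \<ge> 3" using i by linarith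
  then have "homog (rdiff i u b') (deg b - deg b')"
  proof cases
    case 1
    have b'0: "b' = ({}, v0)" using b' 1 by (simp add: B_def)
    have "homog (kos (kpart 1 u) {} v * gen v) (deg b)" if v: "v \<in> V" for v
    proof -
      have "homog (kos (kpart 1 u) {} v) (deg b - int (dg v))" using k v 1 by (force simp: homog_ch_def)
      from homog_times[OF this gen_hom[OF v]] show ?thesis by simp
    qed
    then have "homog (ev (kos (kpart 1 u) {})) (deg b)" unfolding ev_def by (rule homog_sum)
    then show ?thesis using v0 by (simp add: 1 b'0 rdiff_def deg_def)
  next
    case 2
    have "homog (u ({}, v) * lift_rel v T w) (deg b - deg b')" if v: "v \<in> V - {v0}" for v
    proof (cases "b = ({}, v)")
      case True
      then show ?thesis using lift_rel(3)[OF v] T by (auto simp: u_def homog_ch_def Tw deg_def diff_diff_eq)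
    qed (simp add: u_def)
    then have "homog (lift_sum (\<lambda>v. u ({}, v)) T w) (deg b - deg b')" unfolding lift_sum_def by (rule homog_sum)
    then show ?thesis using hk by (simp add: rdiff_def Tw 2 homog_add)
  next
    case 3
    then show ?thesis using hk by (simp add: rdiff_3 Tw)
  qed
  then show ?thesis by (simp add: u_def)
qed

lemma rdiff_exact_0: "rdiff 1 ` idx_mod L (B 1) = {x \<in> idx_mod L (B 0). x ({}, v0) \<in> J}"
proof (intro equalityI subsetI)
  fix x assume "x \<in> rdiff 1 ` idx_mod L (B 1)"
  then obtain y where y: "y \<in> idx_mod L (B 1)" "x = rdiff 1 y" by blast
  then show "x \<in> {x \<in> idx_mod L (B 0). x ({}, v0) \<in> J}"
    using rdiff_maps[of 1 y] ev_kos[OF kpart_Ch[of 1 y]] by (simp add: rdiff_1)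
next
  fix x assume x: "x \<in> {x \<in> idx_mod L (B 0). x ({}, v0) \<in> J}"
  define g where "g = (\<lambda>w. if w = v0 then x ({}, v0) else 0)"
  have evg: "ev g = x ({}, v0)" using v0 fin_V by (simp add: ev_def g_def if_distrib[of "\<lambda>x. x * _"] cong: if_cong)
  have "g \<in> Nm L" using x v0 J_L by (auto simp: g_def idx_mod_def)
  then obtain z where z: "z \<in> Ch 1" "kos z {} = g" using kos_exact_0[of g] evg x by auto
  have "case_prod z \<in> idx_mod L (B 1)" using idx_mod_mono[OF main_B unc_idx_mod[OF z(1)]] by simp
  moreover have "rdiff 1 (case_prod z) b = x b" for b
  proof (cases "b = ({}, v0)")
    case True
    then show ?thesis using z kpart_unc[OF z(1)] evg by (simp only: rdiff_1(1))
  next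
    case False
    then have "b \<notin> B 0" by (simp add: B_def)
    moreover have "x \<in> idx_mod L (B 0)" using x by simp
    ultimately have "x b = 0" unfolding idx_mod_def by blast
    then show ?thesis using rdiff_1(3)[OF False] by simp
  qed
  ultimately show "x \<in> rdiff 1 ` idx_mod L (B 1)" by (metis ext image_eqI)
qed

lemma Ch_0_eqI: "z \<in> Ch 0 \<Longrightarrow> z {} = 0 \<Longrightarrow> z = 0"
proof
  fix T assume z: "z \<in> Ch 0" "z {} = 0"
  show "z T = 0 T"
  proof (rule ccontr)
    assume "z T \<noteq> 0 T"
    then have "z T \<noteq> 0" by simp
    then have "T \<subseteq> L - E" "card T = 0" using z unfolding Ch_def by blast+
    then have "T = {}" using finite_subset_L by simp
    then show False using z \<open>z T \<noteq> 0\<close> by simp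
  qed
qed

text \<open>If the Koszul boundary g of z lies in the kernel of \<open>ev\<close>, then g is the
  combination of the \<open>rel v\<close> with coefficients \<open>g v\<close>. Hence
  \<open>z - lift_sum g\<close> is a Koszul cycle, and \<open>kos_exact\<close> applies to
  it.\<close>

lemma rdiff_exact_1: "{x \<in> idx_mod L (B 1). rdiff 1 x = (\<lambda>_. 0)} = rdiff 2 ` idx_mod L (B 2)"
proof (intro equalityI subsetI)
  fix x assume "x \<in> rdiff 2 ` idx_mod L (B 2)"
  then obtain y where y: "y \<in> idx_mod L (B 2)" "x = rdiff 2 y" by blast
  have x: "x \<in> idx_mod L (B 1)" using rdiff_maps[of 2 y] y by simp
  have "kpart 1 x = kos (kpart 2 y) + lift_sum (\<lambda>v. y ({}, v))"
    unfolding y(2) rdiff_2 using rdiff_2_Ch[OF y(1)] by (rule kpart_unc)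
  then have "kos (kpart 1 x) = kos (lift_sum (\<lambda>v. y ({}, v)))"
    using kos_kos[OF kpart_Ch[of 2 y]] y by (simp add: kos_add)
  then have "rdiff 1 x ({}, v0) = 0" by (simp only: rdiff_1 ev_kos_lift_sum)
  then have "rdiff 1 x b = 0" for b using rdiff_1(3)[of b x] by (cases "b = ({}, v0)") simp_all
  then have "rdiff 1 x = (\<lambda>_. 0)" by (rule ext)
  with x show "x \<in> {x \<in> idx_mod L (B 1). rdiff 1 x = (\<lambda>_. 0)}" by simp
next
  fix x assume "x \<in> {x \<in> idx_mod L (B 1). rdiff 1 x = (\<lambda>_. 0)}"
  then have x: "x \<in> idx_mod L (B 1)" and d: "rdiff 1 x = (\<lambda>_. 0)" by auto
  define z where "z = kpart 1 x"
  define g where "g = kos z {}"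
  have z: "z \<in> Ch 1" using kpart_Ch x by (simp add: z_def)
  have g: "g \<in> Nm L" using kos_Ch[of z 0] z by (auto simp: g_def intro: Ch_N)
  have evg: "ev g = 0" using rdiff_1(1)[of x] d by (simp add: g_def z_def)
  have gL: "g v \<in> polyring L" for v using g polyring_0 unfolding idx_mod_def by (cases "v \<in> V") auto
  have s: "lift_sum g \<in> Ch 1" using gL by (intro lift_sum_Ch)
  have zs: "z - lift_sum g \<in> Ch 1" using z s by (rule Ch_diff)
  have "kos (lift_sum g) {} w = g w" for w
  proof -
    consider "w \<notin> V" | "w \<in> V" "w \<noteq> v0" | "w = v0" by blast
    then show ?thesis
    proof cases
      case 1
      then have "rel v w = 0" if "v \<in> V" for v using v0 that by (auto simp: rel_def)
      then have "kos (lift_sum g) {} w = 0" by (simp add: kos_lift_sum)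
      then show ?thesis using g 1 by (simp add: idx_mod_def)
    next
      case 2
      then show ?thesis by (rule kos_lift_sum_other)
    next
      case 3
      have "ev g = g v0 * gen v0 + (\<Sum>v\<in>V - {v0}. g v * gen v)"
        unfolding ev_def using fin_V v0 by (intro sum.remove)
      then show ?thesis using evg v0 3 by (simp add: kos_lift_sum_v0 eq_neg_iff_add_eq_0[symmetric])
    qed
  qed
  then have "kos (z - lift_sum g) {} = 0" using kos_diff[OF z s] by (simp add: g_def fun_eq_iff)
  then have "kos (z - lift_sum g) = 0" using kos_Ch[of "z - lift_sum g" 0] zs by (intro Ch_0_eqI) auto
  then obtain w where w: "w \<in> Ch 2" "kos w = z - lift_sum g"
    using kos_exact[of "z - lift_sum g" 0] zs by (auto simp: numeral_2_eq_2)
  define y where "y = (\<lambda>(T, v). if T = {} then (if v \<in> V - {v0} then g v else 0) else w T v)"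
  have w0: "w {} v = 0" for v using w(1) unfolding Ch_iff by force
  have w_main: "w T v = 0" if "(T, v) \<notin> main 2" for T v
    using w(1) that unfolding Ch_iff main_def mem_Collect_eq case_prod_conv by blast
  have wL: "w T v \<in> polyring L" for T v using w(1) unfolding Ch_iff by blast
  have y: "y \<in> idx_mod L (B 2)"
  proof -
    have "y b = 0" if "b \<notin> B 2" for b
    proof -
      obtain T v where b: "b = (T, v)" by fastforce
      have "(T, v) \<notin> main 2" "\<not> (T = {} \<and> v \<in> V - {v0})" using that by (auto simp: b B_def)
      then show ?thesis using w_main by (auto simp: y_def b)
    qed
    moreover have "y b \<in> polyring L" for b using gL wL by (simp add: y_def split: prod.split)
    ultimately show ?thesis by (simp add: idx_mod_def)
  qed
  have "kpart 2 y = w"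
  proof (intro ext)
    fix T v
    show "kpart 2 y T v = w T v"
    proof (cases "(T, v) \<in> main 2")
      case True
      then have "T \<noteq> {}" by (auto simp: main_def)
      then show ?thesis using True by (simp add: kpart_def y_def)
    next
      case False
      then show ?thesis by (simp add: w_main kpart_def)
    qed
  qed
  moreover have "lift_sum (\<lambda>v. y ({}, v)) = lift_sum g"
    by (auto simp: lift_sum_def y_def fun_eq_iff intro!: sum.cong)
  ultimately have "rdiff 2 y = case_prod z" unfolding rdiff_2 w(2)[symmetric] by (simp add: w(2))
  also have "\<dots> = x" unfolding z_def using x by (intro unc_kpart) (simp add: B_def)
  finally show "x \<in> rdiff 2 ` idx_mod L (B 2)" using y by blast
qed

text \<open>Applying \<open>kos\<close> to a vanishing image leaves a vanishing combination of the
  \<open>rel v\<close>. Its coordinates at the v other than \<open>v0\<close> are the coefficients,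
  so the extra generators do not occur in a cycle.\<close>

lemma rdiff_exact_2: "{x \<in> idx_mod L (B 2). rdiff 2 x = (\<lambda>_. 0)} = rdiff 3 ` idx_mod L (B 3)"
proof (intro equalityI subsetI)
  fix x assume "x \<in> rdiff 3 ` idx_mod L (B 3)"
  then obtain y where y: "y \<in> idx_mod L (B 3)" "x = rdiff 3 y" by blast
  have x: "x \<in> idx_mod L (B 2)" using rdiff_maps[of 3 y] y by simp
  have c3: "kpart 3 y \<in> Ch 3" using kpart_Ch y by simp
  then have k: "kos (kpart 3 y) \<in> Ch 2" using kos_Ch[of "kpart 3 y" 2] by (simp add: numeral_3_eq_3 numeral_2_eq_2)
  have xk: "x = case_prod (kos (kpart 3 y))" using y by (simp add: rdiff_3)
  have "kpart 2 x = kos (kpart 3 y)" unfolding xk using k by (rule kpart_unc)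
  then have "kos (kpart 2 x) = 0" using kos_kos[OF c3] by simp
  moreover have "x ({}, v) = 0" for v using k unfolding Ch_iff xk by force
  ultimately have "rdiff 2 x = (\<lambda>_. 0)" by (simp add: rdiff_2 lift_sum_def fun_eq_iff)
  with x show "x \<in> {x \<in> idx_mod L (B 2). rdiff 2 x = (\<lambda>_. 0)}" by simp
next
  fix x assume "x \<in> {x \<in> idx_mod L (B 2). rdiff 2 x = (\<lambda>_. 0)}"
  then have x: "x \<in> idx_mod L (B 2)" and d: "rdiff 2 x = (\<lambda>_. 0)" by auto
  define y where "y v = x ({}, v)" for v
  have c: "kpart 2 x \<in> Ch 2" using kpart_Ch x by simp
  have z: "kos (kpart 2 x) + lift_sum y = 0" using d unfolding y_def by (auto simp: rdiff_2 fun_eq_iff)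
  then have "kos (kos (kpart 2 x) + lift_sum y) {} w = 0" for w using kos_0 by simp
  then have k0: "kos (lift_sum y) {} w = 0" for w using kos_kos[OF c] by (simp add: kos_add)
  have y0: "y v = 0" for v
  proof (cases "v \<in> V - {v0}")
    case True
    then show ?thesis using k0[of v] kos_lift_sum_other[of v y] by simp
  next
    case False
    then have "({}, v) \<notin> B 2" by (auto simp: B_def main_def)
    then show ?thesis using x by (simp add: y_def idx_mod_def)
  qed
  then have "lift_sum y = 0" by (simp add: lift_sum_def fun_eq_iff)
  then have "kos (kpart 2 x) = 0" using z by simp
  then obtain w where w: "w \<in> Ch 3" "kos w = kpart 2 x"
    using kos_exact[of "kpart 2 x" 1] c by (auto simp: numeral_2_eq_2 numeral_3_eq_3)
  have "x \<in> idx_mod L (main 2)" using x y0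
    by (auto simp: idx_mod_def B_def y_def)
  then have "case_prod (kpart 2 x) = x" by (rule unc_kpart)
  then have "rdiff 3 (case_prod w) = x" using w kpart_unc[OF w(1)] by (simp add: rdiff_3)
  moreover have "case_prod w \<in> idx_mod L (B 3)" using unc_idx_mod[OF w(1)] by (simp add: B_def)
  ultimately show "x \<in> rdiff 3 ` idx_mod L (B 3)" by blast
qed

lemma rdiff_exact_ge_3:
  assumes i: "i \<ge> 3"
  shows "{x \<in> idx_mod L (B i). rdiff i x = (\<lambda>_. 0)} = rdiff (Suc i) ` idx_mod L (B (Suc i))"
proof (intro equalityI subsetI)
  fix x assume "x \<in> rdiff (Suc i) ` idx_mod L (B (Suc i))"
  then obtain y where y: "y \<in> idx_mod L (B (Suc i))" "x = rdiff (Suc i) y" by blast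
  have x: "x \<in> idx_mod L (B i)" using rdiff_maps[of "Suc i" y] y by simp
  have c: "kpart (Suc i) y \<in> Ch (Suc i)" using kpart_Ch y by simp
  have "kpart i x = kos (kpart (Suc i) y)" using y i kos_Ch[OF c] by (simp add: rdiff_3 kpart_unc)
  then have "kos (kpart i x) = 0" using kos_kos[OF c] by simp
  then have "rdiff i x = (\<lambda>_. 0)" using i by (auto simp: rdiff_3)
  with x show "x \<in> {x \<in> idx_mod L (B i). rdiff i x = (\<lambda>_. 0)}" by simp
next
  fix x assume "x \<in> {x \<in> idx_mod L (B i). rdiff i x = (\<lambda>_. 0)}"
  then have x: "x \<in> idx_mod L (B i)" and d: "rdiff i x = (\<lambda>_. 0)" by auto
  have c: "kpart i x \<in> Ch i" using kpart_Ch x i by simp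
  have "kos (kpart i x) = 0" using d i by (auto simp: rdiff_3 fun_eq_iff)
  then obtain w where w: "w \<in> Ch (Suc i)" "kos w = kpart i x"
    using kos_exact[of "kpart i x" "i - 1"] c i by auto
  have "x \<in> idx_mod L (main i)" using x i by (simp add: B_def)
  then have "case_prod (kpart i x) = x" by (rule unc_kpart)
  then have "rdiff (Suc i) (case_prod w) = x" using w kpart_unc[OF w(1)] i by (simp add: rdiff_3)
  moreover have "case_prod w \<in> idx_mod L (B (Suc i))" using unc_idx_mod[OF w(1)] i by (simp add: B_def)
  ultimately show "x \<in> rdiff (Suc i) ` idx_mod L (B (Suc i))" by blast
qed

theorem resolution_exists:
  "\<exists>r a D. graded_res L J r a D \<and>
    (\<forall>i. \<exists>e. bij_betw e {..<r i} (B i) \<and> (\<forall>k<r i. a i k = deg (e k)))"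
\<comment> \<open>The summand 2 is for the extra generators, which sit in position 2 however small
  \<open>L - E\<close> is.\<close>
proof (rule graded_res_from_maps[where d = rdiff and ?b0.0 = "({}, v0)" and n = "card (L - E) + 2"])
  show "finite (B i)" for i using main_finite fin_V by (simp add: B_def)
  show "B 0 = {({}, v0)}" "deg ({}, v0) = 0" using v0 by (simp_all add: B_def deg_def)
  show "B i = {}" if "card (L - E) + 2 < i" for i
  proof -
    have "card T \<noteq> i" if "T \<subseteq> L - E" for T
      using card_mono[OF _ that] fin_L \<open>card (L - E) + 2 < i\<close> by auto
    then have "main i = {}" by (auto simp: main_def)
    then show ?thesis using that by (simp add: B_def)
  qed
  show "{x \<in> idx_mod L (B i). rdiff i x = (\<lambda>_. 0)} = rdiff (Suc i) ` idx_mod L (B (Suc i))" if i: "1 \<le> i" for i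
  proof -
    consider "i = 1" | "i = 2" | "i \<ge> 3" using i by linarith
    then show ?thesis
    proof cases
      case 1
      have "Suc 1 = 2" by simp
      then show ?thesis unfolding 1 by (simp only: rdiff_exact_1)
    next
      case 2
      have "Suc 2 = 3" by simp
      then show ?thesis unfolding 2 by (simp only: rdiff_exact_2)
    qed (rule rdiff_exact_ge_3)
  qed
qed (rule rdiff_add rdiff_scale rdiff_homog rdiff_maps rdiff_exact_0; assumption)+

lemma resolution_with_degrees:
  obtains r a D where "graded_res L J r a D"
    and "\<And>i k. k < r i \<Longrightarrow> \<exists>b\<in>B i. a i k = deg b" and "\<And>i b. b \<in> B i \<Longrightarrow> \<exists>k<r i. a i k = deg b"
proof -
  obtain r a D where res: "graded_res L J r a D"
    and e: "\<And>i. \<exists>e. bij_betw e {..<r i} (B i) \<and> (\<forall>k<r i. a i k = deg (e k))"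
    using resolution_exists by blast
  show ?thesis
  proof (rule that[OF res])
    fix i
    obtain f where f: "f ` {..<r i} = B i" "\<forall>k<r i. a i k = deg (f k)"
      using e[of i] by (auto simp: bij_betw_def)
    show "\<exists>b\<in>B i. a i k = deg b" if "k < r i" for k
      using f(2) that by (intro bexI[of _ "f k"]) (auto simp flip: f(1))
    fix b assume "b \<in> B i"
    then have "b \<in> f ` {..<r i}" by (simp add: f(1))
    then obtain k where "k < r i" "b = f k" by auto
    then show "\<exists>k<r i. a i k = deg b" using f(2) by auto
  qed
qed

text \<open>A Koszul generator has \<open>card T = i\<close>, which gives the bound directly; an
  extra generator sits in position 2 with degree only \<open>dg v\<close>.\<close>

lemma deg_le:
  assumes "\<And>v. v \<in> V \<Longrightarrow> dg v \<le> m" "b \<in> B i" shows "deg b \<le> int i + int m"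
  using assms v0 by (fastforce simp: B_def main_def deg_def split: if_splits)

lemma resolution_regularity_le:
  assumes m: "\<And>v. v \<in> V \<Longrightarrow> dg v \<le> m"
  obtains r a D where "graded_res L J r a D" "\<And>i k. k < r i \<Longrightarrow> a i k \<le> int i + int m"
  using resolution_with_degrees deg_le[OF m] by metis

text \<open>The generator is \<open>(L - E, u)\<close>, in the last Koszul position. Only extra
  generators can come in the next position, namely for \<open>c = 0\<close>, and their degree is at
  most m.\<close>

lemma resolution_top_generator:
  assumes m: "\<And>v. v \<in> V \<Longrightarrow> dg v \<le> m" and u: "u \<in> V" "dg u = m" and m1: "m \<ge> 1" and c: "card (L - E) = Suc c"
  obtains r a D k where "graded_res L J r a D" "\<And>i k. k < r i \<Longrightarrow> a i k \<le> int i + int m"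
    "k < r (Suc c)" "a (Suc c) k = int (Suc c + m)"
    "\<And>k. k < r (Suc (Suc c)) \<Longrightarrow> a (Suc (Suc c)) k \<noteq> int (Suc c + m)"
proof -
  obtain r a D where res: "graded_res L J r a D"
    and a1: "\<And>i k. k < r i \<Longrightarrow> \<exists>b\<in>B i. a i k = deg b" and a2: "\<And>i b. b \<in> B i \<Longrightarrow> \<exists>k<r i. a i k = deg b"
    using resolution_with_degrees by metis
  have le: "a i k \<le> int i + int m" if "k < r i" for i k using a1[OF that] deg_le[OF m] by auto
  have "(L - E, u) \<in> B (Suc c)" using u c by (auto simp: B_def main_def)
  from a2[OF this] obtain k where k: "k < r (Suc c)" "a (Suc c) k = int (Suc c + m)"
    using u c by (auto simp: deg_def)
  have "a (Suc (Suc c)) k \<noteq> int (Suc c + m)" if "k < r (Suc (Suc c))" for k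
  proof -
    from a1[OF that] obtain b where b: "b \<in> B (Suc (Suc c))" "a (Suc (Suc c)) k = deg b" by blast
    have "card T \<noteq> Suc (Suc c)" if "T \<subseteq> L - E" for T using card_mono[OF _ that] fin_L c by fastforce
    then have "main (Suc (Suc c)) = {}" by (auto simp: main_def)
    then have "b \<in> {{}} \<times> (V - {v0})" using b by (auto simp: B_def split: if_splits)
    then obtain v where "b = ({}, v)" "v \<in> V" by blast
    then show ?thesis using b m[of v] by (simp add: deg_def)
  qed
  with res le k show ?thesis using that by blast
qed

end

section \<open>The join-meet ideal\<close>

lemma ideal_gen_add_term:
  assumes "p \<in> ideal_gen S G" "c \<in> S" "g \<in> G" shows "p + c * g \<in> ideal_gen S G"
proof -
  obtain n :: nat and cs gs where "\<forall>j<n. cs j \<in> S \<and> gs j \<in> G" "p = (\<Sum>j<n. cs j * gs j)"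
    using assms(1) unfolding ideal_gen_def by blast
  then show ?thesis unfolding ideal_gen_def using assms(2,3)
    by (intro CollectI exI[of _ "Suc n"] exI[of _ "cs(n := c)"] exI[of _ "gs(n := g)"])
      (auto simp: less_Suc_eq intro!: sum.cong)
qed

lemma ideal_gen_0: "0 \<in> ideal_gen S G"
  by (auto simp: ideal_gen_def intro!: exI[of _ 0])

lemma ideal_gen_induct [consumes 1, case_names zero add]:
  assumes "p \<in> ideal_gen S G" "P 0"
    and "\<And>p c g. p \<in> ideal_gen S G \<Longrightarrow> P p \<Longrightarrow> c \<in> S \<Longrightarrow> g \<in> G \<Longrightarrow> P (p + c * g)"
  shows "P p"
proof -
  obtain n :: nat and cs gs where p: "\<forall>j<n. cs j \<in> S \<and> gs j \<in> G" "p = (\<Sum>j<n. cs j * gs j)"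
    using assms(1) unfolding ideal_gen_def by blast
  have "P (\<Sum>j<k. cs j * gs j) \<and> (\<Sum>j<k. cs j * gs j) \<in> ideal_gen S G" if "k \<le> n" for k
    using that
  proof (induction k)
    case (Suc k)
    then show ?case using p(1) assms(3) ideal_gen_add_term[of _ S G "cs k" "gs k"] by auto
  qed (auto simp: assms(2) ideal_gen_0)
  with p show ?thesis by auto
qed

lemma ideal_gen_add: "q \<in> ideal_gen S G \<Longrightarrow> p \<in> ideal_gen S G \<Longrightarrow> p + q \<in> ideal_gen S G"
  by (induction q rule: ideal_gen_induct) (auto simp: add.assoc[symmetric] intro: ideal_gen_add_term)

text \<open>In a planar lattice this is the rank: a covering step raises it by exactly 1
  (\<open>covers_rk\<close>).\<close>

definition rk :: "pt \<Rightarrow> nat" where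
  "rk a = fst a + snd a"

section \<open>Order, rank and chains in the plane\<close>

lemma le2_refl [simp]: "le2 a a"
  by (simp add: le2_def)

lemma le2_trans: "le2 a b \<Longrightarrow> le2 b c \<Longrightarrow> le2 a c"
  by (auto simp: le2_def)

lemma le2_antisym: "le2 a b \<Longrightarrow> le2 b a \<Longrightarrow> a = b"
  by (auto simp: le2_def prod_eq_iff)

lemma le2_rk_eq: "le2 a b \<Longrightarrow> rk b \<le> rk a \<Longrightarrow> a = b"
  by (auto simp: le2_def rk_def prod_eq_iff)

lemma le2_rk_le: "le2 a b \<Longrightarrow> rk a \<le> rk b"
  by (auto simp: le2_def rk_def)

definition comparable :: "pt \<Rightarrow> pt \<Rightarrow> bool" where
  "comparable a b \<longleftrightarrow> le2 a b \<or> le2 b a"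

definition chain2 :: "pt set \<Rightarrow> bool" where
  "chain2 U \<longleftrightarrow> (\<forall>a\<in>U. \<forall>b\<in>U. comparable a b)"

lemma comparable_rk: "comparable a b \<Longrightarrow> rk a \<le> rk b \<Longrightarrow> le2 a b"
  using le2_rk_eq[of b a] by (auto simp: comparable_def)

lemma comparable_sym: "comparable a b \<longleftrightarrow> comparable b a"
  by (auto simp: comparable_def)

lemma chain2_max:
  assumes "chain2 U" "finite U" "U \<noteq> {}" shows "\<exists>x\<in>U. \<forall>a\<in>U. le2 a x"
proof -
  have "Max (rk ` U) \<in> rk ` U" using assms by (intro Max_in) auto
  then obtain x where x: "x \<in> U" "Max (rk ` U) = rk x" by auto
  have "rk a \<le> rk x" if "a \<in> U" for a using that assms(2) by (simp flip: x(2))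
  then show ?thesis using x(1) assms(1) comparable_rk unfolding chain2_def by blast
qed

lemma chain2_min:
  assumes "chain2 U" "finite U" "U \<noteq> {}" shows "\<exists>x\<in>U. \<forall>a\<in>U. le2 x a"
proof -
  have "Min (rk ` U) \<in> rk ` U" using assms by (intro Min_in) auto
  then obtain x where x: "x \<in> U" "Min (rk ` U) = rk x" by auto
  have "rk x \<le> rk a" if "a \<in> U" for a using that assms(2) by (simp flip: x(2))
  then show ?thesis using x(1) assms(1) comparable_rk unfolding chain2_def by blast
qed

text \<open>The monomials with equal \<open>marg\<close> are those with the same image under
  \<open>x_(i,j) \<mapsto> s_i t_j\<close>; recording all weighted sums avoids a second polynomial ring.\<close>
definition marg :: "mon \<Rightarrow> ((nat \<Rightarrow> nat) \<Rightarrow> nat) \<times> ((nat \<Rightarrow> nat) \<Rightarrow> nat)" where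
  "marg m = (\<lambda>g. wsum (\<lambda>a. g (fst a)) m, \<lambda>g. wsum (\<lambda>a. g (snd a)) m)"

lemma marg_eq_iff: "marg m = marg n \<longleftrightarrow>
   (\<forall>g. wsum (\<lambda>a. g (fst a)) m = wsum (\<lambda>a. g (fst a)) n) \<and>
   (\<forall>g. wsum (\<lambda>a. g (snd a)) m = wsum (\<lambda>a. g (snd a)) n)"
  by (auto simp: marg_def fun_eq_iff)

lemma marg_cancel: "marg (p + m) = marg (p + n) \<longleftrightarrow> marg m = marg n"
  by (simp add: marg_eq_iff wsum_add)

lemma marg_mdeg: "marg m = marg n \<Longrightarrow> mdeg m = mdeg n"
  unfolding marg_eq_iff mdeg_wsum by (drule conjunct1, drule spec[of _ "\<lambda>_. 1"])

lemma wsum_pos_iff: "wsum w m > 0 \<longleftrightarrow> (\<exists>a\<in>keys m. w a > 0)"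
  by (auto simp: wsum_def sum_pos2 in_keys_iff intro: ccontr)

text \<open>Replacing an incomparable pair by its join and meet keeps the sum of the ranks but moves
  them apart, so a sum of squares increases strictly.\<close>

definition spread :: "mon \<Rightarrow> nat" where
  "spread m = wsum (\<lambda>a. (rk a)\<^sup>2) m"

text \<open>The largest point of a chain carries the largest first and the largest second
  coordinate, and \<open>marg\<close> knows which coordinates occur. So the largest points agree;
  cancel them and use induction on the degree.\<close>

lemma chain_marg_unique:
  "chain2 (keys c) \<Longrightarrow> chain2 (keys c') \<Longrightarrow> marg c = marg c' \<Longrightarrow> c = c'"
proof (induction "mdeg c" arbitrary: c c')
  case 0
  then show ?case using marg_mdeg by (metis mdeg_eq_0_iff)
next
  case (Suc n)
  have ne: "keys c \<noteq> {}" "keys c' \<noteq> {}"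
    using Suc(2) marg_mdeg[OF Suc.prems(3)] by (metis keys_eq_empty mdeg_0 nat.simps(3))+
  obtain x where x: "x \<in> keys c" "\<And>a. a \<in> keys c \<Longrightarrow> le2 a x" using chain2_max[OF Suc.prems(1)] ne by auto
  obtain x' where x': "x' \<in> keys c'" "\<And>a. a \<in> keys c' \<Longrightarrow> le2 a x'" using chain2_max[OF Suc.prems(2)] ne by auto
  have fs: "\<exists>a\<in>keys d'. fst a = fst y" "\<exists>a\<in>keys d'. snd a = snd y"
    if "marg d = marg d'" "y \<in> keys d" for d d' y
  proof -
    \<comment> \<open>Indicator weights detect whether a given coordinate value occurs in the
      support.\<close>
    let ?g = "\<lambda>k i. if i = k then 1 else 0 :: nat"
    have "wsum (\<lambda>a. ?g (fst y) (fst a)) d > 0" "wsum (\<lambda>a. ?g (snd y) (snd a)) d > 0"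
      using that(2) unfolding wsum_pos_iff by (auto intro!: bexI[of _ y])
    moreover have e: "wsum (\<lambda>a. g (fst a)) d = wsum (\<lambda>a. g (fst a)) d'"
      "wsum (\<lambda>a. g (snd a)) d = wsum (\<lambda>a. g (snd a)) d'" for g
      using that(1) unfolding marg_eq_iff by blast+
    ultimately have "wsum (\<lambda>a. ?g (fst y) (fst a)) d' > 0" "wsum (\<lambda>a. ?g (snd y) (snd a)) d' > 0"
      unfolding e[of "?g (fst y)"] e[of "?g (snd y)"] by simp_all
    then show "\<exists>a\<in>keys d'. fst a = fst y" "\<exists>a\<in>keys d'. snd a = snd y"
      unfolding wsum_pos_iff by (auto split: if_splits)
  qed
  have "le2 x x'" using fs[OF Suc.prems(3) x(1)] x'(2) by (fastforce simp: le2_def)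
  moreover have "le2 x' x" using fs[OF Suc.prems(3)[symmetric] x'(1)] x(2) by (fastforce simp: le2_def)
  ultimately have xx: "x' = x" by (rule le2_antisym[symmetric])
  define d d' where "d = c - single x 1" and "d' = c' - single x 1"
  have cd: "c = single x 1 + d" "c' = single x 1 + d'"
    using single_plus_minus[OF x(1)] single_plus_minus[OF x'(1)] by (simp_all add: d_def d'_def xx)
  have "d = d'"
  proof (rule Suc.hyps(1))
    show "n = mdeg d" using Suc(2) by (simp add: cd mdeg_add)
    show "chain2 (keys d)" "chain2 (keys d')" using Suc.prems(1,2) by (auto simp: cd keys_plus_nat chain2_def)
    show "marg d = marg d'" using Suc.prems(3) by (simp add: cd marg_cancel)
  qed
  then show ?case by (simp add: cd)
qed

text \<open>A coefficient of the image of p under the monomial map behind \<open>marg\<close>. As a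
  linear functional that vanishes on the Hibi ideal it detects independence modulo the
  ideal.\<close>

definition mcoeff :: "((nat \<Rightarrow> nat) \<Rightarrow> nat) \<times> ((nat \<Rightarrow> nat) \<Rightarrow> nat) \<Rightarrow> 'k::field mpoly \<Rightarrow> 'k" where
  "mcoeff h p = (\<Sum>m\<in>keys p. if marg m = h then lookup p m else 0)"

lemma mcoeff_superset: "finite A \<Longrightarrow> keys p \<subseteq> A \<Longrightarrow> mcoeff h p = (\<Sum>m\<in>A. if marg m = h then lookup p m else 0)"
  unfolding mcoeff_def by (intro sum.mono_neutral_left) (auto simp: in_keys_iff)

lemma mcoeff_add: "mcoeff h (p + q) = mcoeff h p + mcoeff h q"
  using Poly_Mapping.keys_add[of p q]
  by (simp add: mcoeff_superset[of "keys p \<union> keys q"] lookup_add sum.distrib[symmetric] if_distrib cong: if_cong)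

lemma mcoeff_0 [simp]: "mcoeff h 0 = 0"
  by (simp add: mcoeff_def)

lemma mcoeff_uminus: "mcoeff h (- p) = - mcoeff h p"
  using mcoeff_add[of h p "- p"] by (simp add: eq_neg_iff_add_eq_0 add.commute)

lemma mcoeff_diff: "mcoeff h (p - q) = mcoeff h p - mcoeff h q"
  using mcoeff_add[of h p "- q"] by (simp add: mcoeff_uminus)

lemma mcoeff_sum: "mcoeff h (sum f I) = (\<Sum>i\<in>I. mcoeff h (f i))"
  by (induction I rule: infinite_finite_induct) (auto simp: mcoeff_add)

lemma mcoeff_single: "mcoeff h (single m c) = (if marg m = h then c else 0)"
  by (simp add: mcoeff_superset[of "{m}"])

text \<open>An incomparable pair and its join and meet have the same coordinates in another pairing,
  so the two monomials of a generator fall into the same fibre and cancel.\<close>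

lemma mcoeff_times_hibi_gen:
  assumes "g \<in> hibi_gens L" shows "mcoeff h (c * g) = 0"
proof (induction c rule: poly_mapping_add_induct)
  case (single m c)
  obtain a b where g: "g = Var a * Var b - Var (join2 a b) * Var (meet2 a b)" "\<not> le2 a b" "\<not> le2 b a"
    using assms by (auto simp: hibi_gens_def)
  have "marg (m + (single a 1 + single b 1)) = marg (m + (single (join2 a b) 1 + single (meet2 a b) 1))"
    unfolding marg_cancel using g(2,3) by (auto simp: marg_eq_iff wsum_add join2_def meet2_def max_def min_def le2_def)
  moreover have "single m c * g = single (m + (single a 1 + single b 1)) c
      - single (m + (single (join2 a b) 1 + single (meet2 a b) 1)) c"
    by (simp add: g Var_def mult_single algebra_simps)
  ultimately show ?case by (simp add: mcoeff_diff mcoeff_single)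
qed (auto simp: mcoeff_add distrib_right)

lemma mcoeff_hibi_ideal: "p \<in> hibi_ideal L \<Longrightarrow> mcoeff h p = 0"
  unfolding hibi_ideal_def by (induction p rule: ideal_gen_induct) (auto simp: mcoeff_add mcoeff_times_hibi_gen)

locale sublat =
  fixes L :: "pt set"
  assumes fin: "finite L" and sub: "is_sublattice2 L"
begin

section \<open>The Hibi ideal as a homogeneous ideal, and straightening\<close>

abbreviation J :: "'k::field mpoly set" where "J \<equiv> hibi_ideal L"

lemma join_L: "a \<in> L \<Longrightarrow> b \<in> L \<Longrightarrow> join2 a b \<in> L" and meet_L: "a \<in> L \<Longrightarrow> b \<in> L \<Longrightarrow> meet2 a b \<in> L"
  using sub by (auto simp: is_sublattice2_def)

lemma hibi_gens_L: "g \<in> hibi_gens L \<Longrightarrow> g \<in> polyring L" and hibi_gens_homog: "g \<in> hibi_gens L \<Longrightarrow> homog g 2"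
proof -
  assume "g \<in> hibi_gens L"
  then obtain a b where g: "g = Var a * Var b - Var (join2 a b) * Var (meet2 a b)" "a \<in> L" "b \<in> L"
    by (auto simp: hibi_gens_def)
  show "g \<in> polyring L" unfolding g(1) using g(2,3) join_L meet_L
    by (intro polyring_diff polyring_times polyring_Var) auto
  have "homog (Var x * Var y :: 'a mpoly) 2" for x y using homog_times[OF homog_Var homog_Var] by simp
  then show "homog g 2" unfolding g(1) by (intro homog_diff)
qed

lemma J_0: "0 \<in> J"
  unfolding hibi_ideal_def by (rule ideal_gen_0)

lemma J_add: "p \<in> J \<Longrightarrow> q \<in> J \<Longrightarrow> p + q \<in> J"
  unfolding hibi_ideal_def using ideal_gen_add by blast

lemma J_L: "p \<in> J \<Longrightarrow> p \<in> polyring L"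
  unfolding hibi_ideal_def
  by (induction p rule: ideal_gen_induct) (auto simp del: split_paired_All intro!: polyring_add polyring_times dest: hibi_gens_L)

lemma J_gen: "c \<in> polyring L \<Longrightarrow> g \<in> hibi_gens L \<Longrightarrow> c * g \<in> J"
  unfolding hibi_ideal_def using ideal_gen_add_term[OF ideal_gen_0] by fastforce

lemma J_times:
  assumes c: "c \<in> polyring L" and p: "p \<in> J" shows "c * p \<in> J"
  using p unfolding hibi_ideal_def
proof (induction p rule: ideal_gen_induct)
  case (add p c' g)
  have "c * (p + c' * g) = c * p + (c * c') * g" by (simp add: algebra_simps)
  then show ?case using add ideal_gen_add_term[OF add.IH, of "c * c'" g] c by auto
qed (auto simp: ideal_gen_0)

lemma J_uminus: "p \<in> J \<Longrightarrow> - p \<in> J"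
  using J_times[OF polyring_uminus[OF polyring_1], of p] by simp

lemma J_diff: "p \<in> J \<Longrightarrow> q \<in> J \<Longrightarrow> p - q \<in> J"
  using J_add[of p "- q"] J_uminus by fastforce

lemma J_hcomp:
  assumes p: "p \<in> J" shows "hcomp e p \<in> J"
  using p unfolding hibi_ideal_def
proof (induction p rule: ideal_gen_induct)
  case (add p c g)
  have "hcomp e (g * c) = g * hcomp (e - 2) c" using hibi_gens_homog add by (intro hcomp_times) auto
  then have "hcomp e (p + c * g) = hcomp e p + hcomp (e - 2) c * g" by (simp add: hcomp_add mult.commute)
  then show ?case using ideal_gen_add_term[OF add.IH, of "hcomp (e - 2) c" g] add by auto
qed (auto simp: ideal_gen_0)

lemma spread_le: "keys m \<subseteq> L \<Longrightarrow> spread m \<le> mdeg m * (\<Sum>a\<in>L. (rk a)\<^sup>2)"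
  unfolding spread_def mdeg_def wsum_def sum_distrib_right using fin
  by (intro sum_mono mult_left_mono member_le_sum[of _ L "\<lambda>a. (rk a)\<^sup>2"]) auto

text \<open>Every exchange of an incomparable pair for its join and meet stays in the residue class,
  keeps \<open>marg\<close> and raises \<open>spread\<close>, which is bounded in each degree by
  \<open>spread_le\<close>. The last alternative of the conclusion is what makes the basis change
  triangular.\<close>

lemma straighten:
  assumes "keys m \<subseteq> L"
  shows "\<exists>c. chain2 (keys c) \<and> keys c \<subseteq> L \<and> marg c = marg m \<and>
    single m 1 - single c 1 \<in> (J :: 'k::field mpoly set) \<and> (c = m \<or> spread m < spread c)"
  using assms
proof (induction "mdeg m * (\<Sum>a\<in>L. (rk a)\<^sup>2) - spread m" arbitrary: m rule: less_induct)
  case less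
  show ?case
  proof (cases "chain2 (keys m)")
    case True
    then show ?thesis using less.prems J_0 by (intro exI[of _ m]) auto
  next
    case False
    then obtain a b where ab: "a \<in> keys m" "b \<in> keys m" "\<not> le2 a b" "\<not> le2 b a"
      by (auto simp: chain2_def comparable_def)
    define m1 where "m1 = m - single a 1"
    have "b \<in> keys m1" using ab by (auto simp: m1_def in_keys_iff lookup_minus lookup_single when_def)
    define m2 where "m2 = m1 - single b 1"
    have "m = single a 1 + m1" "m1 = single b 1 + m2"
      using single_plus_minus[OF ab(1)] single_plus_minus[OF \<open>b \<in> keys m1\<close>]
      by (simp_all add: m1_def m2_def)
    then have m: "m = m2 + (single a 1 + single b 1)" by (simp add: add_ac)
    define n where "n = m2 + (single (join2 a b) 1 + single (meet2 a b) 1)"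
    have nL: "keys n \<subseteq> L" using less.prems ab join_L meet_L by (auto simp: m n_def keys_plus_nat)
    have "marg n = marg m" unfolding m n_def marg_cancel using ab
      by (auto simp: marg_eq_iff wsum_add join2_def meet2_def max_def min_def le2_def)
    then have md: "mdeg n = mdeg m" by (rule marg_mdeg)
    have "spread m < spread n"
    proof -
      obtain i j k l where a: "a = (i, j)" and b: "b = (k, l)" by fastforce
      have key: "(i + j)\<^sup>2 + (k + l)\<^sup>2 < (k + j)\<^sup>2 + (i + l)\<^sup>2" if "i < k" "l < j" for i j k l :: nat
      proof -
        from less_imp_Suc_add[OF that(1)] less_imp_Suc_add[OF that(2)]
        obtain u v where "k = Suc (i + u)" "j = Suc (l + v)" by blast
        then show ?thesis by (simp add: power2_eq_square algebra_simps)
      qed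
      consider "i < k" "l < j" | "k < i" "j < l" using ab a b by (fastforce simp: le2_def)
      then have "(i + j)\<^sup>2 + (k + l)\<^sup>2 < (max i k + max j l)\<^sup>2 + (min i k + min j l)\<^sup>2"
      proof cases
        case 1
        then show ?thesis using key[of i k l j] by simp
      next
        case 2
        then show ?thesis using key[of k i j l] by (simp add: add_ac)
      qed
      then show ?thesis by (simp add: spread_def m n_def wsum_add join2_def meet2_def a b rk_def)
    qed
    moreover have "spread n \<le> mdeg n * (\<Sum>a\<in>L. (rk a)\<^sup>2)" using nL by (rule spread_le)
    ultimately have "mdeg n * (\<Sum>a\<in>L. (rk a)\<^sup>2) - spread n < mdeg m * (\<Sum>a\<in>L. (rk a)\<^sup>2) - spread m"
      using md by simp
    from less.hyps[OF this nL] obtain c where c: "chain2 (keys c)" "keys c \<subseteq> L" "marg c = marg n"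
      "single n 1 - single c 1 \<in> (J :: 'k mpoly set)" "c = n \<or> spread n < spread c" by blast
    have "single m 1 - single n 1 = single m2 1 * (Var a * Var b - Var (join2 a b) * Var (meet2 a b) :: 'k mpoly)"
      by (simp add: m n_def Var_def mult_single algebra_simps)
    also have "\<dots> \<in> J"
    proof (rule J_gen)
      show "single m2 1 \<in> polyring L" using less.prems by (intro polyring_single) (auto simp: m keys_plus_nat)
      show "Var a * Var b - Var (join2 a b) * Var (meet2 a b) \<in> hibi_gens L"
        using ab less.prems unfolding hibi_gens_def by blast
    qed
    finally have "single m 1 - single n 1 + (single n 1 - single c 1) \<in> (J :: 'k mpoly set)"
      using J_add c(4) by blast
    then have "single m 1 - single c 1 \<in> (J :: 'k mpoly set)" by simp
    moreover have "spread m < spread c" using c(5) \<open>spread m < spread n\<close> by auto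
    ultimately show ?thesis using c \<open>marg n = marg m\<close> by (intro exI[of _ c]) auto
  qed
qed

end

section \<open>Rightmost maximal chains and their corners\<close>

lemma comparable_rk': "comparable a b \<Longrightarrow> rk b \<le> rk a \<Longrightarrow> le2 b a"
  using comparable_rk[of b a] by (simp add: comparable_sym)

locale planar =
  fixes L :: "pt set"
  assumes planar: "planar_distributive_lattice L"
begin

sublocale sublat L
  using planar by unfold_locales (auto simp: planar_distributive_lattice_def)

lemma bot_L: "(0, 0) \<in> L"
  using planar by (simp add: planar_distributive_lattice_def)

lemma between:
  assumes x: "x \<in> L" and y: "y \<in> L" "le2 x y" and r: "rk x \<le> r" "r \<le> rk y"
  shows "\<exists>z\<in>L. le2 x z \<and> le2 z y \<and> rk z = r"
proof -
  obtain xs where xs: "xs \<noteq> []" "hd xs = x" "last xs = y" "set xs \<subseteq> L"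
    "\<And>k. Suc k < length xs \<Longrightarrow> lt2 (xs ! k) (xs ! Suc k) \<and> rk (xs ! Suc k) = rk (xs ! k) + 1"
    using planar x y unfolding planar_distributive_lattice_def rk_def by blast
  have rank: "rk (xs ! k) = rk x + k" if "k < length xs" for k
    using that by (induction k) (use xs in \<open>auto simp: hd_conv_nth\<close>)
  have mono: "le2 (xs ! k) (xs ! l)" if "k \<le> l" "l < length xs" for k l
    using that by (induction l rule: dec_induct) (use xs(5) in \<open>auto simp: lt2_def intro: le2_trans\<close>)
  have len: "rk y = rk x + (length xs - 1)" using rank[of "length xs - 1"] xs(1,3) by (simp add: last_conv_nth)
  define k where "k = r - rk x"
  have k: "k < length xs" "k \<le> length xs - 1" using len r xs(1) length_greater_0_conv[of xs]
    unfolding k_def by linarith+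
  have "xs ! k \<in> L" using k xs(4) by auto
  moreover have "le2 x (xs ! k)" using mono[of 0 k] k xs(1,2) by (simp add: hd_conv_nth)
  moreover have "le2 (xs ! k) y" using mono[of k "length xs - 1"] k xs(1,3) by (simp add: last_conv_nth)
  moreover have "rk (xs ! k) = r" using rank[OF k(1)] r by (simp add: k_def)
  ultimately show ?thesis by blast
qed

lemma horizontal: "(i, j) \<in> L \<Longrightarrow> (k, j) \<in> L \<Longrightarrow> i \<le> i' \<Longrightarrow> i' \<le> k \<Longrightarrow> (i', j) \<in> L"
  using between[of "(i, j)" "(k, j)" "i' + j"] by (fastforce simp: le2_def rk_def)

lemma vertical: "(i, j) \<in> L \<Longrightarrow> (i, l) \<in> L \<Longrightarrow> j \<le> j' \<Longrightarrow> j' \<le> l \<Longrightarrow> (i, j') \<in> L"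
  using between[of "(i, j)" "(i, l)" "i + j'"] by (fastforce simp: le2_def rk_def)

definition tp :: pt where
  "tp = (SOME t. t \<in> L \<and> (\<forall>a\<in>L. le2 a t))"

definition d :: nat where "d = rk tp"

lemma tp: "tp \<in> L" "a \<in> L \<Longrightarrow> le2 a tp"
proof -
  have "Max (rk ` L) \<in> rk ` L" using fin bot_L by (intro Max_in) auto
  then obtain x where x: "x \<in> L" "Max (rk ` L) = rk x" by auto
  have "le2 a x" if a: "a \<in> L" for a
  proof -
    have "rk (join2 x a) \<le> rk x" using join_L[OF x(1) a] fin by (simp flip: x(2))
    moreover have "le2 x (join2 x a)" "le2 a (join2 x a)" by (auto simp: le2_def join2_def)
    ultimately show ?thesis using le2_rk_eq by metis
  qed
  then have "\<exists>t. t \<in> L \<and> (\<forall>a\<in>L. le2 a t)" using x(1) by blast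
  from someI_ex[OF this] show "tp \<in> L" "a \<in> L \<Longrightarrow> le2 a tp" by (auto simp: tp_def)
qed

lemma rk_le_d: "a \<in> L \<Longrightarrow> rk a \<le> d"
  using tp le2_rk_le by (auto simp: d_def)

definition cand :: "pt set \<Rightarrow> nat \<Rightarrow> pt set" where
  "cand U r = {a \<in> L. rk a = r \<and> (\<forall>u\<in>U. comparable a u)}"

text \<open>The point of rank r on the rightmost maximal path through U. It is chosen rank by rank;
  that consecutive choices fit together is proved in \<open>R_step\<close>.\<close>

definition R :: "pt set \<Rightarrow> nat \<Rightarrow> pt" where
  "R U r = (SOME a. a \<in> cand U r \<and> (\<forall>b\<in>cand U r. fst b \<le> fst a))"

lemma cand_nonempty:
  assumes U: "chain2 U" "U \<subseteq> L" and r: "r \<le> d" shows "cand U r \<noteq> {}"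
proof -
  \<comment> \<open>With bottom and top included there is always an element of U' on either side of
    rank r to interpolate between.\<close>
  define U' where "U' = U \<union> {(0, 0), tp}"
  have U': "chain2 U'" "finite U'" "U' \<subseteq> L"
    using U fin finite_subset bot_L tp unfolding U'_def chain2_def
    by (auto simp: comparable_def) (auto simp: le2_def)
  define lo up where "lo = {u \<in> U'. rk u \<le> r}" and "up = {u \<in> U'. r \<le> rk u}"
  have "(0, 0) \<in> lo" "tp \<in> up" using r by (auto simp: lo_def up_def U'_def rk_def d_def)
  then have "lo \<noteq> {}" "up \<noteq> {}" by blast+
  moreover have "chain2 lo" "finite lo" "chain2 up" "finite up"
    using U' by (auto simp: lo_def up_def chain2_def)
  ultimately obtain x y where x: "x \<in> lo" "\<And>a. a \<in> lo \<Longrightarrow> le2 a x" and y: "y \<in> up" "\<And>a. a \<in> up \<Longrightarrow> le2 y a"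
    using chain2_max[of lo] chain2_min[of up] by blast
  have "comparable x y" "rk x \<le> rk y" "rk x \<le> r" "r \<le> rk y" "x \<in> L" "y \<in> L"
    using U' x(1) y(1) by (auto simp: lo_def up_def chain2_def)
  then obtain z where z: "z \<in> L" "le2 x z" "le2 z y" "rk z = r"
    using between[of x y r] comparable_rk by blast
  have "comparable z u" if u: "u \<in> U" for u
  proof (cases "rk u \<le> r")
    case True
    then have "le2 u x" using x(2) u by (simp add: lo_def U'_def)
    then show ?thesis using z(2,3) le2_trans unfolding comparable_def by blast
  next
    case False
    then have "le2 y u" using y(2) u by (simp add: up_def U'_def)
    then show ?thesis using z(2,3) le2_trans unfolding comparable_def by blast
  qed
  with z have "z \<in> cand U r" by (simp add: cand_def)
  then show ?thesis by blast
qed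

lemma R_spec:
  assumes U: "chain2 U" "U \<subseteq> L" and r: "r \<le> d"
  shows "R U r \<in> cand U r" "b \<in> cand U r \<Longrightarrow> fst b \<le> fst (R U r)"
proof -
  have "finite (cand U r)" using fin by (simp add: cand_def)
  then have "Max (fst ` cand U r) \<in> fst ` cand U r" using cand_nonempty[OF assms] by (intro Max_in) auto
  then obtain a where a: "a \<in> cand U r" "Max (fst ` cand U r) = fst a" by auto
  have "\<exists>a. a \<in> cand U r \<and> (\<forall>b\<in>cand U r. fst b \<le> fst a)"
    using a(1) \<open>finite (cand U r)\<close> by (intro exI[of _ a]) (simp flip: a(2))
  from someI_ex[OF this] show "R U r \<in> cand U r" "b \<in> cand U r \<Longrightarrow> fst b \<le> fst (R U r)"
    by (auto simp: R_def)
qed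

lemma R_L: "chain2 U \<Longrightarrow> U \<subseteq> L \<Longrightarrow> r \<le> d \<Longrightarrow> R U r \<in> L"
  and rk_R: "chain2 U \<Longrightarrow> U \<subseteq> L \<Longrightarrow> r \<le> d \<Longrightarrow> rk (R U r) = r"
  and R_comparable: "chain2 U \<Longrightarrow> U \<subseteq> L \<Longrightarrow> r \<le> d \<Longrightarrow> u \<in> U \<Longrightarrow> comparable (R U r) u"
  using R_spec(1)[of U r] by (auto simp: cand_def)

lemma rk_fst_eq: "rk a = rk b \<Longrightarrow> fst a = fst b \<Longrightarrow> a = b"
  by (simp add: rk_def prod_eq_iff)

lemma R_in: assumes "chain2 U" "U \<subseteq> L" "u \<in> U" shows "R U (rk u) = u"
proof -
  have "comparable (R U (rk u)) u" "rk (R U (rk u)) = rk u"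
    using R_comparable[OF assms(1,2) _ assms(3)] rk_R[OF assms(1,2)] rk_le_d assms(2,3) by blast+
  then show ?thesis using comparable_rk le2_rk_eq by simp
qed

context
  fixes U :: "pt set" assumes U: "chain2 U" "U \<subseteq> L"
begin

text \<open>If consecutive rightmost points were incomparable, two candidates would be missed.
  Either their meet and a horizontal segment give one of rank r farther right, or their join and a
  vertical segment give one of rank r + 1 farther right.\<close>

lemma R_step:
  assumes r: "Suc r \<le> d" shows "le2 (R U r) (R U (Suc r))"
proof (rule ccontr)
  assume nle: "\<not> le2 (R U r) (R U (Suc r))"
  obtain i j where a: "R U r = (i, j)" by fastforce
  obtain i' j' where a': "R U (Suc r) = (i', j')" by fastforce
  have ij: "i + j = r" "i' + j' = Suc r" using rk_R[OF U, of r] rk_R[OF U, of "Suc r"] r by (auto simp: a a' rk_def)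
  have aL: "(i, j) \<in> L" "(i', j') \<in> L" using R_L[OF U, of r] R_L[OF U, of "Suc r"] r by (auto simp: a a')
  have c: "comparable (i, j) u" "comparable (i', j') u" if "u \<in> U" for u
    using R_comparable[OF U, of r u] R_comparable[OF U, of "Suc r" u] r that by (auto simp: a a')
  have low: "le2 u (i, j) \<and> le2 u (i', j')" if "u \<in> U" "rk u \<le> r" for u
    using comparable_rk'[OF c(1)] comparable_rk'[OF c(2)] that ij by (auto simp: rk_def)
  have high: "le2 (i, j) u \<and> le2 (i', j') u" if "u \<in> U" "\<not> rk u \<le> r" for u
    using comparable_rk[OF c(1)] comparable_rk[OF c(2)] that ij by (auto simp: rk_def)
  consider "j' < j" | "i' < i" using nle a a' by (fastforce simp: le2_def)
  then show False
  proof cases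
    case 1
    then have i': "i + 2 \<le> i'" using ij by simp
    have "(i, j') \<in> L" using meet_L[OF aL] 1 i' by (simp add: meet2_def)
    then have bL: "(i' - 1, j') \<in> L" using horizontal[of i j' i' "i' - 1"] aL i' by simp
    have "comparable (i' - 1, j') u" if u: "u \<in> U" for u
      using low[OF u] high[OF u] i' by (cases "rk u \<le> r") (auto simp: comparable_def le2_def)
    then have "(i' - 1, j') \<in> cand U r" using bL ij i' by (auto simp: cand_def rk_def)
    then have "i' - 1 \<le> i" using R_spec(2)[OF U, of r] r by (fastforce simp: a)
    then show False using i' by simp
  next
    case 2
    then have j': "j + 2 \<le> j'" using ij by simp
    have "(i, j') \<in> L" using join_L[OF aL] 2 j' by (simp add: join2_def max_def)
    then have bL: "(i, Suc j) \<in> L" using vertical[of i j j' "Suc j"] aL j' by simp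
    have "comparable (i, Suc j) u" if u: "u \<in> U" for u
      using low[OF u] high[OF u] j' by (cases "rk u \<le> r") (auto simp: comparable_def le2_def)
    then have "(i, Suc j) \<in> cand U (Suc r)" using bL ij by (auto simp: cand_def rk_def)
    then have "i \<le> i'" using R_spec(2)[OF U, of "Suc r"] r by (fastforce simp: a')
    then show False using 2 by simp
  qed
qed

lemma R_mono: "r \<le> s \<Longrightarrow> s \<le> d \<Longrightarrow> le2 (R U r) (R U s)"
  by (induction s rule: dec_induct) (auto intro: le2_trans R_step)

lemma R_0: "R U 0 = (0, 0)"
  using rk_R[OF U, of 0] by (simp add: rk_def prod_eq_iff)

lemma R_d: "R U d = tp"
proof -
  have "le2 (R U d) tp" using R_L[OF U] tp by simp
  moreover have "rk tp \<le> rk (R U d)" using rk_R[OF U, of d] by (simp add: d_def)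
  ultimately show ?thesis by (rule le2_rk_eq)
qed

end

text \<open>\<open>corner_pts\<close> consists of the upper left corners of the squares of \<open>L\<close>; the squares with corners
  \<open>b\<close> and \<open>b'\<close> are stacked iff both coordinates of \<open>b'\<close> are larger, which is the condition in \<open>corner_sets\<close>.\<close>
definition corner_pts :: "pt set" where
  "corner_pts = {b \<in> L. snd b \<ge> 1 \<and> (fst b, snd b - 1) \<in> L \<and> (fst b + 1, snd b) \<in> L \<and> (fst b + 1, snd b - 1) \<in> L}"

definition corner_sets :: "pt set set" where
  "corner_sets = {v. v \<subseteq> corner_pts \<and> (\<forall>b\<in>v. \<forall>b'\<in>v. b = b' \<or> (fst b < fst b' \<and> snd b < snd b') \<or> (fst b' < fst b \<and> snd b' < snd b))}"

text \<open>At such a point the path turns from going up to going right, and the fourth point of the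
  square below and to the right lies in L, so the turn could be flipped.\<close>

definition corners :: "pt set \<Rightarrow> pt set" where
  "corners U = {b \<in> corner_pts. R U (rk b) = b \<and> R U (rk b - 1) = (fst b, snd b - 1) \<and> R U (rk b + 1) = (fst b + 1, snd b)}"

section \<open>Corner sets and the rightmost paths through them\<close>

lemma corner_pts_L: "b \<in> corner_pts \<Longrightarrow> b \<in> L"
  by (simp add: corner_pts_def)

lemma corner_pts_rk: assumes "b \<in> corner_pts" shows "rk b \<ge> 1" "rk b + 1 \<le> d"
  using assms rk_le_d[of "(fst b + 1, snd b)"] by (auto simp: corner_pts_def rk_def)

lemma corner_sets_chain: "v \<in> corner_sets \<Longrightarrow> chain2 v" "v \<in> corner_sets \<Longrightarrow> v \<subseteq> L"
  unfolding corner_sets_def chain2_def comparable_def le2_def using corner_pts_L by fastforce+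

lemma finite_corner_sets: "finite corner_sets"
proof -
  have "corner_sets \<subseteq> Pow L" using corner_sets_chain(2) by blast
  then show ?thesis using fin by (meson finite_Pow_iff finite_subset)
qed

lemma corner_sets_finite: "v \<in> corner_sets \<Longrightarrow> finite v"
  using corner_sets_chain(2) fin finite_subset by blast

lemma empty_corner_sets: "{} \<in> corner_sets"
  by (simp add: corner_sets_def)

text \<open>If a corner were not forced by U, the flipped point would be a candidate of the same
  rank farther right.\<close>

lemma corners_subset:
  assumes U: "chain2 U" "U \<subseteq> L" shows "corners U \<subseteq> U"
proof
  fix b assume b: "b \<in> corners U"
  show "b \<in> U"
  proof (rule ccontr)
    assume nb: "b \<notin> U"
    have bB: "b \<in> corner_pts" and R: "R U (rk b) = b" "R U (rk b - 1) = (fst b, snd b - 1)" "R U (rk b + 1) = (fst b + 1, snd b)"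
      using b by (auto simp: corners_def)
    note rkb = corner_pts_rk[OF bB]
    define f where "f = (fst b + 1, snd b - 1)"
    have f: "f \<in> L" "rk f = rk b" "le2 f (fst b + 1, snd b)" "le2 (fst b, snd b - 1) f"
      using bB by (auto simp: corner_pts_def f_def rk_def le2_def)
    have "comparable f u" if u: "u \<in> U" for u
    proof -
      have c: "comparable b u" "comparable (fst b, snd b - 1) u" "comparable (fst b + 1, snd b) u"
        using R_comparable[OF U, of "rk b" u] R_comparable[OF U, of "rk b - 1" u]
          R_comparable[OF U, of "rk b + 1" u] rkb u R by auto
      consider "rk u < rk b" | "rk u = rk b" | "rk u > rk b" by linarith
      then show ?thesis
      proof cases
        case 1
        moreover have "rk (fst b, snd b - 1) = rk b - 1" using bB by (simp add: rk_def corner_pts_def)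
        ultimately have "le2 u (fst b, snd b - 1)" using comparable_rk'[OF c(2)] by simp
        then show ?thesis using f(3,4) le2_trans unfolding comparable_def by blast
      next
        case 2
        then have "b = u" using c(1) comparable_rk le2_rk_eq by simp
        then show ?thesis using nb u by simp
      next
        case 3
        then have "le2 (fst b + 1, snd b) u" using comparable_rk[OF c(3)] by (auto simp: rk_def)
        then show ?thesis using f(3,4) le2_trans unfolding comparable_def by blast
      qed
    qed
    then have "f \<in> cand U (rk b)" using f by (auto simp: cand_def)
    then have "fst f \<le> fst b" using R_spec(2)[OF U, of "rk b" f] rkb R by simp
    then show False by (simp add: f_def)
  qed
qed

text \<open>The path leaves a corner to the right and enters the next one from below, so both
  coordinates grow from one corner to the next.\<close>

lemma corners_corner_sets:
  assumes U: "chain2 U" "U \<subseteq> L" shows "corners U \<in> corner_sets"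
proof -
  have *: "fst b < fst b' \<and> snd b < snd b'" if b: "b \<in> corners U" "b' \<in> corners U" "rk b < rk b'" for b b'
  proof -
    have R: "R U (rk b) = b" "R U (rk b + 1) = (fst b + 1, snd b)"
      "R U (rk b') = b'" "R U (rk b' - 1) = (fst b', snd b' - 1)" "snd b' \<ge> 1" "rk b' \<le> d"
      using b corner_pts_rk[of b'] by (auto simp: corners_def corner_pts_def)
    \<comment> \<open>For adjacent ranks the single step from b to b' would be horizontal and
      vertical at once.\<close>
    have "rk b' \<noteq> rk b + 1"
    proof
      assume e: "rk b' = rk b + 1"
      then have "b' = (fst b + 1, snd b)" "(fst b', snd b' - 1) = b" using R by auto
      then show False by (metis Suc_eq_plus1 fst_conv n_not_Suc_n)
    qed
    then have "rk b + 1 \<le> rk b' - 1" using b(3) by simp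
    then have "le2 (R U (rk b + 1)) (R U (rk b' - 1))" using R(6) by (intro R_mono[OF U]) auto
    then show ?thesis using R(5) by (simp only: R(2,4)) (auto simp: le2_def)
  qed
  have "b = b' \<or> (fst b < fst b' \<and> snd b < snd b') \<or> (fst b' < fst b \<and> snd b' < snd b)"
    if b: "b \<in> corners U" "b' \<in> corners U" for b b'
  proof -
    consider "rk b < rk b'" | "rk b' < rk b" | "rk b = rk b'" by linarith
    then show ?thesis
    proof cases
      case 3
      then show ?thesis using b by (metis (mono_tags, lifting) corners_def mem_Collect_eq)
    qed (use * b in blast)+
  qed
  then show ?thesis unfolding corner_sets_def corners_def by blast
qed

text \<open>The points below and to the right of b are comparable with all of v, and no path through
  b can be farther right at their ranks. The rightmost path therefore contains them and turns at
  b.\<close>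

lemma corners_of_corner_sets:
  assumes v: "v \<in> corner_sets" shows "corners v = v"
proof
  note V = corner_sets_chain[OF v]
  show "corners v \<subseteq> v" using corners_subset V by blast
  show "v \<subseteq> corners v"
  proof
    fix b assume b: "b \<in> v"
    have bB: "b \<in> corner_pts" using v b by (auto simp: corner_sets_def)
    note rkb = corner_pts_rk[OF bB]
    have Rb: "R v (rk b) = b" using R_in V b by blast
    have str: "b' = b \<or> (fst b < fst b' \<and> snd b < snd b') \<or> (fst b' < fst b \<and> snd b' < snd b)" if "b' \<in> v" for b'
      using v b that unfolding corner_sets_def by blast
    have c1: "(fst b, snd b - 1) \<in> cand v (rk b - 1)"
    proof -
      have "comparable (fst b, snd b - 1) u" if "u \<in> v" for u
        using str[OF that] by (auto simp: comparable_def le2_def)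
      then show ?thesis using bB by (auto simp: cand_def corner_pts_def rk_def)
    qed
    have c2: "(fst b + 1, snd b) \<in> cand v (rk b + 1)"
    proof -
      have "comparable (fst b + 1, snd b) u" if "u \<in> v" for u
        using str[OF that] by (auto simp: comparable_def le2_def)
      then show ?thesis using bB by (auto simp: cand_def corner_pts_def rk_def)
    qed
    have "R v (rk b - 1) = (fst b, snd b - 1)"
    proof (rule rk_fst_eq)
      show "rk (R v (rk b - 1)) = rk (fst b, snd b - 1)" using rk_R[OF V, of "rk b - 1"] rkb bB
        by (auto simp: corner_pts_def rk_def)
      have "fst b \<le> fst (R v (rk b - 1))" using R_spec(2)[OF V _ c1] rkb by simp
      moreover have "le2 (R v (rk b - 1)) b" using R_mono[OF V, of "rk b - 1" "rk b"] rkb Rb by simp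
      ultimately show "fst (R v (rk b - 1)) = fst (fst b, snd b - 1)" by (simp add: le2_def)
    qed
    moreover have "R v (rk b + 1) = (fst b + 1, snd b)"
    proof (rule rk_fst_eq)
      show rr: "rk (R v (rk b + 1)) = rk (fst b + 1, snd b)" using rk_R[OF V, of "rk b + 1"] rkb
        by (auto simp: rk_def)
      have "fst b + 1 \<le> fst (R v (rk b + 1))" using R_spec(2)[OF V _ c2] rkb by simp
      moreover have "le2 b (R v (rk b + 1))" using R_mono[OF V, of "rk b" "rk b + 1"] rkb Rb by simp
      ultimately show "fst (R v (rk b + 1)) = fst (fst b + 1, snd b)" using rr by (auto simp: le2_def rk_def)
    qed
    ultimately show "b \<in> corners v" using bB Rb by (simp add: corners_def)
  qed
qed

text \<open>The corners determine the path. They impose fewer conditions than U, so their path can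
  only deviate to the right. At the first deviation the path of U goes up in a column i; it leaves
  this column later, at a corner b, because both paths end at the top. But b also lies on the other
  path, which has left column i before.\<close>

lemma R_corners:
  assumes U: "chain2 U" "U \<subseteq> L" and r: "r \<le> d" shows "R (corners U) r = R U r"
proof -
  define v where "v = corners U"
  have V: "chain2 v" "v \<subseteq> L" using corner_sets_chain corners_corner_sets[OF U] by (auto simp: v_def)
  have vU: "v \<subseteq> U" using corners_subset[OF U] by (simp add: v_def)
  have le: "fst (R U s) \<le> fst (R v s)" if s: "s \<le> d" for s
  proof -
    have "R U s \<in> cand v s" using R_spec(1)[OF U s] vU by (auto simp: cand_def)
    then show ?thesis using R_spec(2)[OF V s] by blast
  qed
  have "\<not> (\<exists>s\<le>d. fst (R U s) < fst (R v s))"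
  proof
    assume ex: "\<exists>s\<le>d. fst (R U s) < fst (R v s)"
    define s where "s = (LEAST s. s \<le> d \<and> fst (R U s) < fst (R v s))"
    have s: "s \<le> d" "fst (R U s) < fst (R v s)" using LeastI_ex[OF ex] by (auto simp: s_def)
    have smin: "fst (R U t) = fst (R v t)" if "t < s" for t
      using not_less_Least[of t "\<lambda>s. s \<le> d \<and> fst (R U s) < fst (R v s)"] that s(1) le[of t] by (auto simp: s_def)
    have s0: "s \<noteq> 0"
    proof
      assume "s = 0"
      then show False using s(2) R_0[OF U] R_0[OF V] by simp
    qed
    define i where "i = fst (R U (s - 1))"
    have Rv1: "fst (R v (s - 1)) = i" using smin[of "s - 1"] s0 by (simp add: i_def)
    have stepx: "fst (R W (Suc t)) \<le> Suc (fst (R W t))" if W: "chain2 W" "W \<subseteq> L" and t: "Suc t \<le> d" for W t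
      using R_step[OF W t] rk_R[OF W t] rk_R[OF W, of t] t by (auto simp: le2_def rk_def)
    have monox: "fst (R W t) \<le> fst (R W t')" if "chain2 W" "W \<subseteq> L" "t \<le> t'" "t' \<le> d" for W t t'
      using R_mono[OF that] by (simp add: le2_def)
    have vs: "fst (R v s) = Suc i" "fst (R U s) = i"
    proof -
      have "fst (R v s) \<le> Suc i" using stepx[OF V, of "s - 1"] s s0 Rv1 by simp
      moreover have "i \<le> fst (R U s)" using monox[OF U, of "s - 1" s] s by (simp add: i_def)
      ultimately show "fst (R v s) = Suc i" "fst (R U s) = i" using s(2) by auto
    qed
    have "fst (R U d) > i"
      using monox[OF V, of s d] s(1) vs(1) R_d[OF U] R_d[OF V] by simp
    then have ext: "\<exists>t. s \<le> t \<and> t \<le> d \<and> i < fst (R U t)" using s(1) by blast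
    \<comment> \<open>The first rank at which the path of U has left column i; the corner b is the
      point just before.\<close>
    define t where "t = (LEAST t. s \<le> t \<and> t \<le> d \<and> i < fst (R U t))"
    have t: "s \<le> t" "t \<le> d" "i < fst (R U t)" using LeastI_ex[OF ext] by (auto simp: t_def)
    have st: "s < t" using t vs(2) by (cases "s = t") auto
    have tmin: "fst (R U q) = i" if q: "s - 1 \<le> q" "q < t" for q
    proof (cases "q = s - 1")
      case False
      then have "s \<le> q" using q by simp
      then have "fst (R U q) \<le> i"
        using not_less_Least[of q "\<lambda>t. s \<le> t \<and> t \<le> d \<and> i < fst (R U t)"] q t by (auto simp: t_def)
      moreover have "i \<le> fst (R U q)" using monox[OF U, of s q] \<open>s \<le> q\<close> q t vs by simp
      ultimately show ?thesis by simp
    qed (simp add: i_def)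
    define b where "b = R U (t - 1)"
    have fb: "fst b = i" using tmin[of "t - 1"] st by (simp add: b_def)
    have rb: "rk b = t - 1" using rk_R[OF U, of "t - 1"] t by (simp add: b_def)
    have b1: "R U (rk b - 1) = (fst b, snd b - 1)"
    proof -
      have "fst (R U (t - 2)) = i" using tmin[of "t - 2"] st by simp
      moreover have "rk (R U (t - 2)) = t - 2" using rk_R[OF U, of "t - 2"] t by simp
      moreover have "rk b - 1 = t - 2" using rb by simp
      ultimately show ?thesis using rb fb st by (simp add: rk_def prod_eq_iff)
    qed
    have sb: "snd b \<ge> 1"
    proof -
      have "le2 (R U (s - 1)) (R U (t - 2))" using st t by (intro R_mono[OF U]) auto
      moreover have "rk (R U (t - 2)) = t - 2" "fst (R U (t - 2)) = i"
        using rk_R[OF U, of "t - 2"] tmin[of "t - 2"] st t by auto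
      ultimately have "i \<le> t - 2" by (simp add: rk_def)
      then show ?thesis using rb fb st s0 by (simp add: rk_def)
    qed
    have b2: "R U (rk b + 1) = (fst b + 1, snd b)"
    proof -
      have "fst (R U t) \<le> Suc i" using stepx[OF U, of "t - 1"] st t fb by (simp add: b_def)
      then have "fst (R U t) = Suc i" using t by simp
      moreover have "rk (R U t) = t" using rk_R[OF U, of t] t by simp
      ultimately show ?thesis using rb fb st by (simp add: rk_def prod_eq_iff)
    qed
    have Ls: "b \<in> L" "(fst b, snd b - 1) \<in> L" "(fst b + 1, snd b) \<in> L"
      using R_L[OF U, of "t - 1"] R_L[OF U, of "rk b - 1"] R_L[OF U, of "rk b + 1"] b1 b2 rb st t
      by (auto simp: b_def)
    have "(fst b + 1, snd b - 1) \<in> L"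
    \<comment> \<open>Column i + 1 contains a lower point of the deviating path and the point to the
      right of b, hence everything in between; this supplies the square.\<close>
    proof (rule vertical)
      show "(fst b + 1, snd (R v s)) \<in> L" using R_L[OF V s(1)] vs fb by (metis Suc_eq_plus1 prod.collapse)
      show "(fst b + 1, snd b) \<in> L" by (rule Ls)
      show "snd (R v s) \<le> snd b - 1"
      proof -
        have "snd (R v s) = s - Suc i" using rk_R[OF V s(1)] vs by (simp add: rk_def)
        moreover have "snd b = t - 1 - i" using rb fb by (simp add: rk_def)
        ultimately show ?thesis using st by simp
      qed
    qed simp
    moreover have "R U (rk b) = b" by (simp only: rb) (simp add: b_def)
    ultimately have "b \<in> corners U" using Ls sb b1 b2 by (simp add: corners_def corner_pts_def)
    then have "R v (rk b) = b" using R_in[OF V, of b] by (simp add: v_def)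
    then have "fst (R v (t - 1)) = i" using rb fb by simp
    moreover have "fst (R v s) \<le> fst (R v (t - 1))" using monox[OF V, of s "t - 1"] st t by simp
    ultimately show False using vs by simp
  qed
  then have "fst (R v r) = fst (R U r)" using le[OF r] r by (meson le_antisym not_le)
  then show ?thesis using rk_fst_eq rk_R[OF U r] rk_R[OF V r] by (metis v_def)
qed

text \<open>Enlarging v by points of its own path keeps every point of that path a candidate, so
  neither the path nor its corners change.\<close>

lemma R_between:
  assumes v: "v \<in> corner_sets" and U: "chain2 U" "U \<subseteq> L" "v \<subseteq> U" and on: "\<And>u. u \<in> U \<Longrightarrow> R v (rk u) = u"
  shows "r \<le> d \<Longrightarrow> R U r = R v r" "corners U = v"
proof -
  note V = corner_sets_chain[OF v]
  have eq: "R U r = R v r" if r: "r \<le> d" for r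
  proof (rule rk_fst_eq)
    show "rk (R U r) = rk (R v r)" using rk_R[OF U(1,2) r] rk_R[OF V r] by simp
    have "R U r \<in> cand v r" using R_spec(1)[OF U(1,2) r] U(3) by (auto simp: cand_def)
    then have 1: "fst (R U r) \<le> fst (R v r)" using R_spec(2)[OF V r] by blast
    have "comparable (R v r) u" if u: "u \<in> U" for u
    proof -
      have "rk u \<le> d" using u U rk_le_d by blast
      then have "comparable (R v r) (R v (rk u))"
        using R_mono[OF V, of r "rk u"] R_mono[OF V, of "rk u" r] r by (cases "r \<le> rk u") (auto simp: comparable_def)
      then show ?thesis using on[OF u] by simp
    qed
    then have "R v r \<in> cand U r" using R_spec(1)[OF V r] by (auto simp: cand_def)
    then show "fst (R U r) = fst (R v r)" using 1 R_spec(2)[OF U(1,2) r] by (intro le_antisym) blast+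
  qed
  then show "r \<le> d \<Longrightarrow> R U r = R v r" by blast
  have "b \<in> corners U \<longleftrightarrow> b \<in> corners v" for b
  proof (cases "b \<in> corner_pts")
    case True
    then show ?thesis using eq[of "rk b"] eq[of "rk b - 1"] eq[of "rk b + 1"] corner_pts_rk[OF True]
      by (simp add: corners_def)
  qed (simp add: corners_def)
  then have "corners U = corners v" by blast
  then show "corners U = v" using corners_of_corner_sets[OF v] by simp
qed

end

section \<open>A free basis over the rank sums\<close>

lemma mon_induct [case_names zero add]:
  fixes \<alpha> :: "'a \<Rightarrow>\<^sub>0 nat"
  assumes "P 0" "\<And>e \<alpha>. P \<alpha> \<Longrightarrow> P (single e 1 + \<alpha>)"
  shows "P \<alpha>"
proof (induction "wsum (\<lambda>_. 1) \<alpha>" arbitrary: \<alpha>)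
  case 0
  then have "\<alpha> = 0" unfolding wsum_def by (metis finite_keys in_keys_iff keys_eq_empty mult_1_right sum_eq_0_iff all_not_in_conv)
  then show ?case using assms(1) by simp
next
  case (Suc n)
  then have "\<alpha> \<noteq> 0" by auto
  then obtain e where e: "e \<in> keys \<alpha>" by fastforce
  have "wsum (\<lambda>_. 1) \<alpha> = 1 + wsum (\<lambda>_. 1) (\<alpha> - single e 1)"
    by (subst single_plus_minus[OF e, symmetric]) (simp only: wsum_add wsum_single mult_1_right)
  then have "P (\<alpha> - single e 1)" using Suc by (intro Suc.hyps(1)) simp
  from assms(2)[OF this, of e] show ?case using single_plus_minus[OF e] by simp
qed

text \<open>Only the ranks of the factors of \<alpha> matter, so \<alpha> serves as a multiset of
  ranks that is laid out along the path p.\<close>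

definition push :: "(nat \<Rightarrow> pt) \<Rightarrow> mon \<Rightarrow> mon" where
  "push p \<alpha> = (\<Sum>e\<in>keys \<alpha>. single (p (rk e)) (lookup \<alpha> e))"

lemma lookup_push: "lookup (push p \<alpha>) x = wsum (\<lambda>e. if p (rk e) = x then 1 else 0) \<alpha>"
  unfolding push_def lookup_sum wsum_def by (intro sum.cong refl) (auto simp: lookup_single when_def)

lemma wsum_push: "wsum w (push p \<alpha>) = wsum (\<lambda>e. w (p (rk e))) \<alpha>"
  by (simp add: push_def wsum_sum) (simp add: wsum_def)

lemma push_add: "push p (\<alpha> + \<beta>) = push p \<alpha> + push p \<beta>"
  by (rule poly_mapping_eqI) (simp add: lookup_push lookup_add wsum_add)

lemma push_0 [simp]: "push p 0 = 0"
  by (simp add: push_def)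

lemma push_single [simp]: "push p (single e 1) = single (p (rk e)) 1"
  by (simp add: push_def)

lemma keys_push: "keys (push p \<alpha>) \<subseteq> (\<lambda>e. p (rk e)) ` keys \<alpha>"
proof
  fix x assume "x \<in> keys (push p \<alpha>)"
  then have "wsum (\<lambda>e. if p (rk e) = x then 1 else 0) \<alpha> > 0" by (simp add: lookup_push in_keys_iff)
  then show "x \<in> (\<lambda>e. p (rk e)) ` keys \<alpha>" unfolding wsum_pos_iff by (auto split: if_splits)
qed

lemma push_id: "(\<And>a. a \<in> keys n \<Longrightarrow> p (rk a) = a) \<Longrightarrow> push p n = n"
  using sum_single_keys[of n] by (simp add: push_def)

text \<open>Equality of the multisets of ranks, expressed through all weights as for
  \<open>marg\<close>.\<close>

definition same_ranks :: "mon \<Rightarrow> mon \<Rightarrow> bool" where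
  "same_ranks m n \<longleftrightarrow> (\<forall>g. wsum (\<lambda>a. g (rk a)) m = wsum (\<lambda>a. g (rk a)) n)"

lemma same_ranksD: "same_ranks m n \<Longrightarrow> wsum (\<lambda>a. g (rk a)) m = wsum (\<lambda>a. g (rk a)) n"
  by (simp add: same_ranks_def)

lemma same_ranks_push: "same_ranks m n \<Longrightarrow> push p m = push p n"
  by (rule poly_mapping_eqI) (simp add: lookup_push same_ranksD[of m n "\<lambda>r. if p r = _ then 1 else 0"])

lemma same_ranks_spread: "same_ranks m n \<Longrightarrow> spread m = spread n"
  unfolding spread_def by (rule same_ranksD)

lemma same_ranks_mdeg: "same_ranks m n \<Longrightarrow> mdeg m = mdeg n"
  unfolding mdeg_wsum by (rule same_ranksD)

definition corner_mon :: "pt set \<Rightarrow> mon" where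
  "corner_mon v = (\<Sum>b\<in>v. single b 1)"

lemma lookup_corner_mon: "finite v \<Longrightarrow> lookup (corner_mon v) b = (if b \<in> v then 1 else 0)"
  by (simp add: corner_mon_def lookup_sum lookup_single when_def)

lemma keys_corner_mon: "finite v \<Longrightarrow> keys (corner_mon v) = v"
  by (rule set_eqI) (simp add: in_keys_iff lookup_corner_mon)

lemma mdeg_corner_mon: "finite v \<Longrightarrow> mdeg (corner_mon v) = card v"
  by (simp add: mdeg_def keys_corner_mon lookup_corner_mon)

lemma mcoeff_const_times: "mcoeff h (single 0 k * q) = k * mcoeff h q"
proof (induction q rule: poly_mapping_add_induct)
  case (single m c)
  then show ?case by (simp add: mult_single mcoeff_single)
qed (auto simp: mcoeff_add distrib_left)

lemma hcomp_subst:
  assumes p: "p \<in> polyring A" and f: "\<And>a. a \<in> A \<Longrightarrow> homog (f a) 1"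
  shows "hcomp e (subst f p) = subst f (hcomp e p)"
proof -
  have h: "homog (single 0 (lookup p m) * mon_eval f m) (int (mdeg m))" if "m \<in> keys p" for m
  proof -
    have "homog (mon_eval f m) (int (mdeg m))"
      using p f that by (intro homog_mon_eval) (auto simp: polyring_def)
    then show ?thesis using homog_times[OF homog_single[of 0 0 "lookup p m"]] by fastforce
  qed
  have "hcomp e (subst f p) = (\<Sum>m\<in>keys p. hcomp e (single 0 (lookup p m) * mon_eval f m))"
    by (simp add: subst_def hcomp_sum)
  also have "\<dots> = (\<Sum>m\<in>keys p. single 0 (lookup (hcomp e p) m) * mon_eval f m)"
    by (intro sum.cong refl) (auto simp: hcomp_homog[OF h] lookup_hcomp)
  also have "\<dots> = subst f (hcomp e p)"
    by (rule subst_superset[symmetric]) (auto simp: keys_hcomp)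
  finally show ?thesis .
qed

context planar
begin

text \<open>One variable of each rank has to give way to the rank sum; the rightmost path through
  the empty chain picks it.\<close>

definition base_pt :: "nat \<Rightarrow> pt" where "base_pt r = R {} r"

definition E :: "pt set" where "E = base_pt ` {..d}"

lemma empty_chain: "chain2 {}"
  by (simp add: chain2_def)

lemma base_pt: "r \<le> d \<Longrightarrow> base_pt r \<in> L" "r \<le> d \<Longrightarrow> rk (base_pt r) = r"
  using R_L[OF empty_chain] rk_R[OF empty_chain] by (auto simp: base_pt_def)

lemma E_L: "E \<subseteq> L"
  using base_pt by (auto simp: E_def)

lemma E_unique: "a \<in> E \<Longrightarrow> base_pt (rk a) = a"
  using base_pt(2) by (auto simp: E_def)

lemma base_pt_E: "r \<le> d \<Longrightarrow> base_pt r \<in> E"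
  by (auto simp: E_def)

definition \<theta> :: "nat \<Rightarrow> 'k::field mpoly" where
  "\<theta> r = (\<Sum>a\<in>{a\<in>L. rk a = r}. Var a)"

text \<open>Together with its inverse \<open>from_rank\<close> this is the linear change of
  coordinates of the overview. It carries \<open>polyring E\<close> to the ring generated by the
  rank sums.\<close>

definition to_rank :: "pt \<Rightarrow> 'k::field mpoly" where
  "to_rank x = (if x \<in> E then \<theta> (rk x) else Var x)"

definition from_rank :: "pt \<Rightarrow> 'k::field mpoly" where
  "from_rank x = (if x \<in> E then Var x - (\<Sum>a\<in>{a\<in>L. rk a = rk x} - {x}. Var a) else Var x)"

lemma theta_L: "\<theta> r \<in> polyring L"
  unfolding \<theta>_def by (intro polyring_sum polyring_Var) auto

lemma to_rank_L: "x \<in> L \<Longrightarrow> to_rank x \<in> polyring L" and to_rank_homog: "homog (to_rank x) 1"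
  by (auto simp: to_rank_def theta_L) (auto simp: \<theta>_def intro!: homog_sum)

lemma from_rank_L: "x \<in> L \<Longrightarrow> from_rank x \<in> polyring L" and from_rank_homog: "homog (from_rank x) 1"
  by (auto simp: from_rank_def intro!: polyring_diff polyring_sum polyring_Var homog_diff homog_sum)

lemma not_E: "a \<in> {a\<in>L. rk a = rk x} - {x} \<Longrightarrow> x \<in> E \<Longrightarrow> a \<notin> E"
  using E_unique[of a] E_unique[of x] by auto

lemma to_rank_from_rank: assumes "x \<in> L" shows "subst to_rank (from_rank x :: 'k::field mpoly) = Var x"
proof (cases "x \<in> E")
  case True
  have "{a\<in>L. rk a = rk x} = insert x ({a\<in>L. rk a = rk x} - {x})" using assms by auto
  then have "(\<theta> (rk x) :: 'k mpoly) = Var x + (\<Sum>a\<in>{a\<in>L. rk a = rk x} - {x}. Var a)"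
    unfolding \<theta>_def using fin by (subst sum.remove[of _ x]) (use assms in auto)
  moreover have "(\<Sum>a\<in>{a\<in>L. rk a = rk x} - {x}. to_rank a :: 'k mpoly) = (\<Sum>a\<in>{a\<in>L. rk a = rk x} - {x}. Var a)"
    using not_E[OF _ True] by (intro sum.cong refl) (simp add: to_rank_def)
  ultimately show ?thesis using True by (simp add: from_rank_def subst_diff subst_sum to_rank_def[of x])
qed (simp add: from_rank_def to_rank_def)

lemma from_rank_to_rank: assumes "x \<in> L" shows "subst from_rank (to_rank x :: 'k::field mpoly) = Var x"
proof (cases "x \<in> E")
  case True
  have "(\<Sum>a\<in>{a\<in>L. rk a = rk x}. from_rank a :: 'k mpoly) = from_rank x + (\<Sum>a\<in>{a\<in>L. rk a = rk x} - {x}. from_rank a)"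
    using fin assms by (intro sum.remove) auto
  also have "(\<Sum>a\<in>{a\<in>L. rk a = rk x} - {x}. from_rank a) = (\<Sum>a\<in>{a\<in>L. rk a = rk x} - {x}. Var a)"
    using not_E[OF _ True] by (intro sum.cong refl) (simp add: from_rank_def)
  finally show ?thesis using True by (simp add: to_rank_def \<theta>_def subst_sum from_rank_def[of x])
qed (simp add: from_rank_def to_rank_def)

lemma to_rank_polyring: "p \<in> polyring L \<Longrightarrow> subst to_rank p \<in> polyring L"
  by (rule polyring_subst[of _ L]) (auto simp: to_rank_L)

lemma from_rank_polyring: "p \<in> polyring L \<Longrightarrow> subst from_rank p \<in> polyring L"
  by (rule polyring_subst[of _ L]) (auto simp: from_rank_L)

lemma subst_to_rank_from_rank: "p \<in> polyring L \<Longrightarrow> subst to_rank (subst from_rank p) = p"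
  using subst_cong[of p L "\<lambda>a. subst to_rank (from_rank a)" Var, OF _ to_rank_from_rank] by (simp add: subst_subst subst_id)

lemma subst_from_rank_to_rank: "p \<in> polyring L \<Longrightarrow> subst from_rank (subst to_rank p) = p"
  using subst_cong[of p L "\<lambda>a. subst from_rank (to_rank a)" Var, OF _ from_rank_to_rank] by (simp add: subst_subst subst_id)

text \<open>Expanding a product of rank sums picks for every factor some point of the same
  rank.\<close>

lemma keys_theta_power:
  assumes "keys \<alpha> \<subseteq> E" "n \<in> keys (mon_eval to_rank \<alpha> :: 'k::field mpoly)"
  shows "keys n \<subseteq> L \<and> same_ranks n \<alpha>"
  using assms
proof (induction \<alpha> arbitrary: n rule: mon_induct)
  case zero
  then show ?case by (simp add: same_ranks_def)
next
  case (add e \<alpha>)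
  have eE: "e \<in> E" and aE: "keys \<alpha> \<subseteq> E" using add.prems(1) by (auto simp: keys_plus_nat)
  have "mon_eval to_rank (single e 1 + \<alpha>) = (\<Sum>a\<in>{a\<in>L. rk a = rk e}. Var a * (mon_eval to_rank \<alpha> :: 'k mpoly))"
    using eE by (simp only: mon_eval_add mon_eval_single) (simp add: to_rank_def \<theta>_def sum_distrib_right)
  then have "n \<in> keys (\<Sum>a\<in>{a\<in>L. rk a = rk e}. Var a * (mon_eval to_rank \<alpha> :: 'k mpoly))"
    using add.prems(2) by simp
  then have "(\<Sum>a\<in>{a\<in>L. rk a = rk e}. lookup (Var a * (mon_eval to_rank \<alpha> :: 'k mpoly)) n) \<noteq> 0"
    by (simp add: in_keys_iff lookup_sum)
  then obtain a where a: "a \<in> L" "rk a = rk e" "n \<in> keys (Var a * (mon_eval to_rank \<alpha> :: 'k mpoly))"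
    by (elim sum.not_neutral_contains_not_neutral) (auto simp: in_keys_iff)
  then obtain n' where n': "n' \<in> keys (mon_eval to_rank \<alpha> :: 'k mpoly)" "n = single a 1 + n'"
    by (auto simp: keys_Var_times)
  then show ?case using add.IH[OF aE n'(1)] a by (auto simp: keys_plus_nat same_ranks_def wsum_add)
qed

text \<open>The path has one point in each rank, so only one choice in the expansion yields this
  monomial. The coefficient is 1 and not a multinomial number, which matters in positive
  characteristic.\<close>

lemma lookup_theta_power:
  assumes p: "\<And>r. r \<le> d \<Longrightarrow> p r \<in> L \<and> rk (p r) = r" and "keys \<alpha> \<subseteq> E"
  shows "lookup (mon_eval to_rank \<alpha> :: 'k::field mpoly) (push p \<alpha>) = 1"
  using assms(2)
proof (induction \<alpha> rule: mon_induct)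
  case zero
  then show ?case by simp
next
  case (add e \<alpha>)
  let ?q = "mon_eval to_rank \<alpha> :: 'k mpoly"
  let ?m = "single (p (rk e)) 1 + push p \<alpha>"
  have eE: "e \<in> E" and aE: "keys \<alpha> \<subseteq> E" using add.prems(1) by (auto simp: keys_plus_nat)
  have rd: "rk e \<le> d" using eE base_pt(2) by (auto simp: E_def)
  have rkk: "rk x \<le> d" if "x \<in> keys \<alpha>" for x using that aE E_L rk_le_d by blast
  have "mon_eval to_rank (single e 1 + \<alpha>) = (\<Sum>a\<in>{a\<in>L. rk a = rk e}. Var a * ?q)"
    using eE by (simp only: mon_eval_add mon_eval_single) (simp add: to_rank_def \<theta>_def sum_distrib_right)
  then have "lookup (mon_eval to_rank (single e 1 + \<alpha>) :: 'k mpoly) ?m =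
      (\<Sum>a\<in>{a\<in>L. rk a = rk e}. lookup (Var a * ?q) ?m)" by (simp add: lookup_sum)
  also have "\<dots> = (\<Sum>a\<in>{a\<in>L. rk a = rk e}. if a = p (rk e) then 1 else 0)"
  proof (intro sum.cong refl)
    fix a assume a: "a \<in> {a\<in>L. rk a = rk e}"
    have "a \<in> keys ?m \<longleftrightarrow> a = p (rk e)"
    proof
      assume "a \<in> keys ?m"
      then have "a = p (rk e) \<or> (\<exists>x\<in>keys \<alpha>. a = p (rk x))" using keys_push[of p \<alpha>] by (auto simp: keys_plus_nat)
      then obtain x where "x \<in> insert e (keys \<alpha>)" "a = p (rk x)" by blast
      moreover have "rk x \<le> d" using rkk[of x] rd calculation(1) by blast
      then have "rk (p (rk x)) = rk x" using p[of "rk x"] by simp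
      ultimately show "a = p (rk e)" using a by simp
    qed (simp add: keys_plus_nat)
    moreover have "?m - single (p (rk e)) 1 = push p \<alpha>" by simp
    ultimately show "lookup (Var a * ?q) ?m = (if a = p (rk e) then 1 else 0)"
      using add.IH[OF aE] by (cases "a = p (rk e)") (simp_all only: lookup_Var_times if_True if_False)
  qed
  also have "\<dots> = 1" using p[OF rd] fin by simp
  finally show ?case by (simp only: push_add push_single)
qed

text \<open>\<open>lead_mon \<alpha> v\<close> is the leading standard monomial of \<open>theta_mon \<alpha> v\<close> when a smaller \<open>spread\<close> comes first and
  ties are broken by a larger sum of first coordinates: straightening strictly increases \<open>spread\<close>, and
  among the chains through \<open>v\<close> with given ranks the one on the rightmost path has the largest sum.\<close>
definition lead_mon :: "mon \<Rightarrow> pt set \<Rightarrow> mon" where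
  "lead_mon \<alpha> v = push (R v) \<alpha> + corner_mon v"

definition theta_mon :: "mon \<Rightarrow> pt set \<Rightarrow> 'k::field mpoly" where
  "theta_mon \<alpha> v = mon_eval to_rank \<alpha> * single (corner_mon v) 1"

section \<open>Leading monomials and triangularity\<close>

lemma R_path: "v \<in> corner_sets \<Longrightarrow> r \<le> d \<Longrightarrow> R v r \<in> L \<and> rk (R v r) = r"
  using R_L[OF corner_sets_chain] rk_R[OF corner_sets_chain] by blast

lemma same_ranks_lead_mon:
  assumes v: "v \<in> corner_sets" and \<alpha>: "keys \<alpha> \<subseteq> E" and n: "same_ranks n \<alpha>"
  shows "same_ranks (n + corner_mon v) (lead_mon \<alpha> v)"
proof -
  have "wsum (\<lambda>a. g (rk (R v (rk a)))) \<alpha> = wsum (\<lambda>a. g (rk a)) \<alpha>" for g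
  proof (rule wsum_cong)
    fix a assume "a \<in> keys \<alpha>"
    then have "rk a \<le> d" using \<alpha> E_L rk_le_d by blast
    then show "g (rk (R v (rk a))) = g (rk a)" using R_path[OF v, of "rk a"] by simp
  qed
  then show ?thesis using n by (simp add: same_ranks_def lead_mon_def wsum_add wsum_push)
qed

lemma keys_lead_mon:
  assumes v: "v \<in> corner_sets" and \<alpha>: "keys \<alpha> \<subseteq> E"
  shows "keys (lead_mon \<alpha> v) \<subseteq> L" "chain2 (keys (lead_mon \<alpha> v))" "corners (keys (lead_mon \<alpha> v)) = v"
    "a \<in> keys (lead_mon \<alpha> v) \<Longrightarrow> R v (rk a) = a"
proof -
  note V = corner_sets_chain[OF v]
  have kl: "keys (lead_mon \<alpha> v) = keys (push (R v) \<alpha>) \<union> v"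
    by (simp add: lead_mon_def keys_plus_nat keys_corner_mon[OF corner_sets_finite[OF v]])
  have on: "R v (rk a) = a \<and> rk a \<le> d" if "a \<in> keys (lead_mon \<alpha> v)" for a
  proof (cases "a \<in> v")
    case True
    then show ?thesis using R_in[OF V True] V(2) rk_le_d by blast
  next
    case False
    then have "a \<in> (\<lambda>e. R v (rk e)) ` keys \<alpha>" using that keys_push[of "R v" \<alpha>] unfolding kl by blast
    then obtain x where x: "x \<in> keys \<alpha>" "a = R v (rk x)" by blast
    have "rk x \<le> d" using x(1) \<alpha> E_L rk_le_d by blast
    then show ?thesis using R_path[OF v, of "rk x"] x(2) by simp
  qed
  then show "a \<in> keys (lead_mon \<alpha> v) \<Longrightarrow> R v (rk a) = a" by blast
  show L: "keys (lead_mon \<alpha> v) \<subseteq> L" using on R_path[OF v] by (metis subsetI)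
  show ch: "chain2 (keys (lead_mon \<alpha> v))"
    unfolding chain2_def
  proof (intro ballI)
    fix a b assume "a \<in> keys (lead_mon \<alpha> v)" "b \<in> keys (lead_mon \<alpha> v)"
    then show "comparable a b" using on[of a] on[of b] R_mono[OF V, of "rk a" "rk b"] R_mono[OF V, of "rk b" "rk a"]
      by (cases "rk a \<le> rk b") (auto simp: comparable_def)
  qed
  show "corners (keys (lead_mon \<alpha> v)) = v"
    by (rule R_between(2)[OF v ch L]) (use on kl in auto)
qed

text \<open>The corners of the path through the support give back v; after
  \<open>corner_mon v\<close> is cancelled, pushing to \<open>base_pt\<close> gives back
  \<alpha>.\<close>

lemma lead_mon_inj:
  assumes v: "v \<in> corner_sets" "v' \<in> corner_sets" and \<alpha>: "keys \<alpha> \<subseteq> E" "keys \<alpha>' \<subseteq> E" and eq: "lead_mon \<alpha> v = lead_mon \<alpha>' v'"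
  shows "v = v'" "\<alpha> = \<alpha>'"
proof -
  show vv: "v = v'" using keys_lead_mon(3)[OF v(1) \<alpha>(1)] keys_lead_mon(3)[OF v(2) \<alpha>(2)] eq by simp
  then have pp: "push (R v) \<alpha> = push (R v) \<alpha>'" using eq by (simp add: lead_mon_def)
  have rec: "push base_pt (push (R v) \<beta>) = \<beta>" if \<beta>: "keys \<beta> \<subseteq> E" for \<beta>
  proof -
    have "push base_pt (push (R v) \<beta>) = push base_pt \<beta>"
    proof (rule poly_mapping_eqI)
      fix x
      show "lookup (push base_pt (push (R v) \<beta>)) x = lookup (push base_pt \<beta>) x"
        unfolding lookup_push wsum_push using R_path[OF v(1)] \<beta> E_L rk_le_d
        by (intro wsum_cong) (metis subsetD)
    qed
    also have "\<dots> = \<beta>" using \<beta> E_unique by (intro push_id) blast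
    finally show ?thesis .
  qed
  have "\<alpha> = push base_pt (push (R v) \<alpha>)" using rec[OF \<alpha>(1)] by (rule sym)
  also have "\<dots> = push base_pt (push (R v) \<alpha>')" by (simp only: pp)
  also have "\<dots> = \<alpha>'" by (rule rec[OF \<alpha>(2)])
  finally show "\<alpha> = \<alpha>'" .
qed

text \<open>Take for v the corners of the support. By \<open>R_corners\<close> the remaining factors
  lie on the path of v, so their ranks, recorded on \<open>E\<close>, recover them.\<close>

lemma lead_mon_surj:
  assumes c: "chain2 (keys c)" "keys c \<subseteq> L"
  shows "\<exists>\<alpha> v. v \<in> corner_sets \<and> keys \<alpha> \<subseteq> E \<and> c = lead_mon \<alpha> v"
proof -
  define v where "v = corners (keys c)"
  have v: "v \<in> corner_sets" "v \<subseteq> keys c" using corners_corner_sets[OF c] corners_subset[OF c] by (auto simp: v_def)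
  define n where "n = c - corner_mon v"
  have cn: "c = n + corner_mon v"
  proof (rule poly_mapping_eqI)
    fix a
    show "lookup c a = lookup (n + corner_mon v) a"
      using v(2) by (cases "a \<in> v") (auto simp: n_def lookup_add lookup_minus lookup_corner_mon[OF corner_sets_finite[OF v(1)]] in_keys_iff)
  qed
  have nc: "keys n \<subseteq> keys c" by (auto simp: cn keys_plus_nat)
  have on: "R v (rk a) = a" "rk a \<le> d" if "a \<in> keys n" for a
  proof -
    have a: "a \<in> keys c" using nc that by blast
    then show "rk a \<le> d" using c(2) rk_le_d by blast
    then show "R v (rk a) = a" using R_corners[OF c, of "rk a"] R_in[OF c a] by (simp add: v_def)
  qed
  define \<alpha> where "\<alpha> = push base_pt n"
  have \<alpha>E: "keys \<alpha> \<subseteq> E" using keys_push[of base_pt n] on base_pt_E by (auto simp: \<alpha>_def)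
  have "push (R v) \<alpha> = push (R v) n"
  proof (rule poly_mapping_eqI)
    fix x
    show "lookup (push (R v) \<alpha>) x = lookup (push (R v) n) x"
      unfolding \<alpha>_def lookup_push wsum_push using on base_pt(2) by (intro wsum_cong) auto
  qed
  also have "\<dots> = n" using on by (intro push_id) blast
  finally have "c = lead_mon \<alpha> v" by (simp add: lead_mon_def cn)
  then show ?thesis using v \<alpha>E by blast
qed

text \<open>If the monomial is a chain, each of its factors is comparable with v and hence not to
  the right of the path of v. The first coordinates add up to the maximum only if all factors lie on
  the path.\<close>

lemma keys_theta_mon:
  assumes v: "v \<in> corner_sets" and \<alpha>: "keys \<alpha> \<subseteq> E" and m: "m \<in> keys (theta_mon \<alpha> v :: 'k::field mpoly)"
  shows "keys m \<subseteq> L" "same_ranks m (lead_mon \<alpha> v)"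
    "chain2 (keys m) \<Longrightarrow> m = lead_mon \<alpha> v \<or> wsum fst m < wsum fst (lead_mon \<alpha> v)"
proof -
  note V = corner_sets_chain[OF v]
  have "m \<in> (+) (corner_mon v) ` keys (mon_eval to_rank \<alpha> :: 'k mpoly)"
    using keys_single_times[of "corner_mon v" 1 "mon_eval to_rank \<alpha> :: 'k mpoly"] m unfolding theta_mon_def mult.commute[of "mon_eval to_rank \<alpha>"] by blast
  then obtain n where n: "n \<in> keys (mon_eval to_rank \<alpha> :: 'k mpoly)" "m = n + corner_mon v" by (auto simp: add.commute)
  have nn: "keys n \<subseteq> L" "same_ranks n \<alpha>" using keys_theta_power[OF \<alpha> n(1)] by auto
  have kx: "keys (corner_mon v) = v" by (rule keys_corner_mon[OF corner_sets_finite[OF v]])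
  show "keys m \<subseteq> L" using nn V(2) by (simp add: n keys_plus_nat kx)
  show "same_ranks m (lead_mon \<alpha> v)" unfolding n(2) by (rule same_ranks_lead_mon[OF v \<alpha> nn(2)])
  assume ch: "chain2 (keys m)"
  have le: "fst a \<le> fst (R v (rk a))" if a: "a \<in> keys n" for a
  proof -
    have "a \<in> L" using a nn by blast
    moreover have "comparable a u" if "u \<in> v" for u
      using ch a that by (auto simp: chain2_def n keys_plus_nat kx)
    ultimately have "a \<in> cand v (rk a)" by (simp add: cand_def)
    then show ?thesis using R_spec(2)[OF V] rk_le_d \<open>a \<in> L\<close> by blast
  qed
  have eqF: "wsum (\<lambda>a. fst (R v (rk a))) n = wsum fst (push (R v) \<alpha>)"
    unfolding wsum_push using same_ranksD[OF nn(2), of "\<lambda>r. fst (R v r)"] .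
  show "m = lead_mon \<alpha> v \<or> wsum fst m < wsum fst (lead_mon \<alpha> v)"
  proof (cases "\<forall>a\<in>keys n. fst a = fst (R v (rk a))")
    case True
    have "R v (rk a) = a" if a: "a \<in> keys n" for a
    proof (rule rk_fst_eq)
      show "rk (R v (rk a)) = rk a" using R_path[OF v, of "rk a"] a nn rk_le_d by blast
      show "fst (R v (rk a)) = fst a" using True a by simp
    qed
    then have "n = push (R v) n" using push_id by metis
    also have "\<dots> = push (R v) \<alpha>" by (rule same_ranks_push[OF nn(2)])
    finally show ?thesis by (simp add: n lead_mon_def)
  next
    case False
    then obtain b where "b \<in> keys n" "fst b < fst (R v (rk b))" using le by (metis le_neq_implies_less)
    then have "wsum fst n < wsum (\<lambda>a. fst (R v (rk a))) n" using le by (intro wsum_less)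
    then show ?thesis using eqF by (simp add: n lead_mon_def wsum_add)
  qed
qed

lemma lookup_theta_mon_lead_mon:
  assumes v: "v \<in> corner_sets" and \<alpha>: "keys \<alpha> \<subseteq> E" shows "lookup (theta_mon \<alpha> v :: 'k::field mpoly) (lead_mon \<alpha> v) = 1"
  using lookup_single_times[of "corner_mon v" 1 "mon_eval to_rank \<alpha> :: 'k mpoly" "push (R v) \<alpha>"]
    lookup_theta_power[of "R v" \<alpha>, OF R_path[OF v] \<alpha>]
  by (simp add: theta_mon_def lead_mon_def mult.commute[of "mon_eval to_rank \<alpha>"] add.commute)

text \<open>Spanning is proved in the original coordinates, where the ideal is the Hibi ideal and
  straightening is available; \<open>subst to_rank\<close> produces the coefficients in rank
  sums.\<close>

definition spanned :: "'k::field mpoly set" where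
  "spanned = {f \<in> polyring L. \<exists>p. (\<forall>v\<in>corner_sets. p v \<in> polyring E) \<and>
     f - (\<Sum>v\<in>corner_sets. subst to_rank (p v) * single (corner_mon v) 1) \<in> J}"

lemma spanned_J: "f \<in> J \<Longrightarrow> f \<in> spanned"
  unfolding spanned_def using J_L by (auto intro!: exI[of _ "\<lambda>_. 0"])

lemma spanned_add: assumes "f \<in> spanned" "g \<in> spanned" shows "f + g \<in> spanned"
proof -
  obtain p q where p: "\<forall>v\<in>corner_sets. p v \<in> polyring E" "f - (\<Sum>v\<in>corner_sets. subst to_rank (p v) * single (corner_mon v) 1) \<in> J"
    and q: "\<forall>v\<in>corner_sets. q v \<in> polyring E" "g - (\<Sum>v\<in>corner_sets. subst to_rank (q v) * single (corner_mon v) 1) \<in> J"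
    using assms by (auto simp: spanned_def)
  have "f + g - (\<Sum>v\<in>corner_sets. subst to_rank (p v + q v) * single (corner_mon v) 1) \<in> J"
    using J_add[OF p(2) q(2)] by (simp add: subst_add algebra_simps sum.distrib)
  then show ?thesis using assms p(1) q(1) unfolding spanned_def
    by (intro CollectI conjI exI[of _ "\<lambda>v. p v + q v"]) auto
qed

lemma spanned_const: assumes "f \<in> spanned" shows "single 0 k * f \<in> spanned"
proof -
  obtain p where p: "\<forall>v\<in>corner_sets. p v \<in> polyring E" "f - (\<Sum>v\<in>corner_sets. subst to_rank (p v) * single (corner_mon v) 1) \<in> J"
    using assms by (auto simp: spanned_def)
  have k: "single 0 k \<in> polyring A" for A by (intro polyring_single) simp
  have "single 0 k * f - (\<Sum>v\<in>corner_sets. subst to_rank (single 0 k * p v) * single (corner_mon v) 1) =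
      single 0 k * (f - (\<Sum>v\<in>corner_sets. subst to_rank (p v) * single (corner_mon v) 1))"
    by (simp add: subst_times algebra_simps sum_distrib_left)
  also have "\<dots> \<in> J" using J_times[OF k p(2)] .
  finally show ?thesis using assms p(1) k unfolding spanned_def
    by (intro CollectI conjI exI[of _ "\<lambda>v. single 0 k * p v"]) auto
qed

lemma spanned_sum: "(\<And>i. i \<in> I \<Longrightarrow> f i \<in> spanned) \<Longrightarrow> sum f I \<in> spanned"
  by (induction I rule: infinite_finite_induct) (auto intro: spanned_add spanned_J J_0)

lemma spanned_theta_mon: assumes v: "v \<in> corner_sets" and \<alpha>: "keys \<alpha> \<subseteq> E" shows "theta_mon \<alpha> v \<in> (spanned :: 'k::field mpoly set)"
proof -
  define p where "p w = (if w = v then single \<alpha> 1 else 0 :: 'k mpoly)" for w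
  have "(\<Sum>w\<in>corner_sets. subst to_rank (p w) * single (corner_mon w) 1) = (\<Sum>w\<in>corner_sets. if w = v then theta_mon \<alpha> v else (0 :: 'k mpoly))"
    by (intro sum.cong refl) (auto simp: p_def theta_mon_def subst_single)
  then have "theta_mon \<alpha> v - (\<Sum>w\<in>corner_sets. subst to_rank (p w) * single (corner_mon w) 1) \<in> (J :: 'k mpoly set)"
    using v finite_corner_sets J_0 by simp
  moreover have "theta_mon \<alpha> v \<in> (polyring L :: 'k mpoly set)"
    using keys_theta_mon(1)[OF v \<alpha>, where 'k = 'k] by (simp add: polyring_def)
  moreover have "\<forall>w\<in>corner_sets. p w \<in> polyring E" using \<alpha> by (auto simp: p_def)
  ultimately show ?thesis by (auto simp: spanned_def)
qed

lemma spanned_of_chain: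
  assumes "keys m \<subseteq> L" "\<And>c. chain2 (keys c) \<Longrightarrow> keys c \<subseteq> L \<Longrightarrow> marg c = marg m \<Longrightarrow> c = m \<or> spread m < spread c \<Longrightarrow>
    single c 1 \<in> (spanned :: 'k::field mpoly set)"
  shows "single m k \<in> (spanned :: 'k mpoly set)"
proof -
  obtain c where c: "chain2 (keys c)" "keys c \<subseteq> L" "marg c = marg m"
    "single m 1 - single c 1 \<in> (J :: 'k mpoly set)" "c = m \<or> spread m < spread c"
    using straighten[OF assms(1)] by blast
  have "single c 1 + (single m 1 - single c 1) \<in> (spanned :: 'k mpoly set)"
    using assms(2)[OF c(1-3,5)] spanned_J[OF c(4)] by (rule spanned_add)
  then have "single 0 k * single m 1 \<in> (spanned :: 'k mpoly set)" using spanned_const by fastforce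
  then show ?thesis by (simp add: mult_single)
qed

text \<open>Subtract the product \<open>theta_mon\<close> with leading monomial c. Its other
  monomials straighten to chains of the same degree with larger \<open>spread\<close>, or are
  already chains with the same \<open>spread\<close> and a smaller sum of first coordinates. Both
  measures are natural numbers because \<open>spread\<close> is bounded in fixed degree.\<close>

lemma spanned_chain:
  assumes "chain2 (keys c)" "keys c \<subseteq> L" shows "single c 1 \<in> (spanned :: 'k::field mpoly set)"
  using assms
proof (induction c rule: wf_induct_rule[OF wf_measures, of "[\<lambda>c. mdeg c * (\<Sum>a\<in>L. (rk a)\<^sup>2) - spread c, wsum fst]"])
  case (1 c)
  obtain \<alpha> v where v: "v \<in> corner_sets" and \<alpha>: "keys \<alpha> \<subseteq> E" and c: "c = lead_mon \<alpha> v"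
    using lead_mon_surj 1(2,3) by blast
  let ?g = "theta_mon \<alpha> v :: 'k mpoly"
  have lg: "lookup ?g c = 1" unfolding c by (rule lookup_theta_mon_lead_mon[OF v \<alpha>])
  then have cg: "c \<in> keys ?g" by (simp add: in_keys_iff)
  have "single m (lookup ?g m) \<in> (spanned :: 'k mpoly set)" if m: "m \<in> keys ?g - {c}" for m
  proof (rule spanned_of_chain)
    note k = keys_theta_mon[OF v \<alpha>, of m]
    show mL: "keys m \<subseteq> L" using k m by blast
    have sr: "same_ranks m c" using k m c by blast
    fix c' assume c': "chain2 (keys c')" "keys c' \<subseteq> L" "marg c' = marg m" "c' = m \<or> spread m < spread c'"
    have md: "mdeg c' = mdeg c" using marg_mdeg[OF c'(3)] same_ranks_mdeg[OF sr] by simp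
    have sp: "spread m = spread c" by (rule same_ranks_spread[OF sr])
    have "(c', c) \<in> measures [\<lambda>c. mdeg c * (\<Sum>a\<in>L. (rk a)\<^sup>2) - spread c, wsum fst]"
      using c'(4)
    proof
      assume "c' = m"
      then have "wsum fst c' < wsum fst c" using k(3) m c c'(1) by auto
      then show ?thesis using \<open>c' = m\<close> md sp by simp
    next
      assume "spread m < spread c'"
      moreover have "spread c' \<le> mdeg c' * (\<Sum>a\<in>L. (rk a)\<^sup>2)" using c'(2) by (rule spread_le)
      ultimately have "mdeg c * (\<Sum>a\<in>L. (rk a)\<^sup>2) - spread c' < mdeg c * (\<Sum>a\<in>L. (rk a)\<^sup>2) - spread c"
        unfolding md sp by linarith
      then show ?thesis using md by simp
    qed
    then show "single c' 1 \<in> (spanned :: 'k mpoly set)" using 1(1) c' by blast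
  qed
  then have s: "(\<Sum>m\<in>keys ?g - {c}. single 0 (- 1) * single m (lookup ?g m)) \<in> (spanned :: 'k mpoly set)"
    by (intro spanned_sum spanned_const)
  define S where "S = (\<Sum>m\<in>keys ?g - {c}. single m (lookup ?g m))"
  have g: "?g = single c 1 + S"
    using sum_single_keys[of ?g] sum.remove[OF finite_keys cg, of "\<lambda>m. single m (lookup ?g m)"] lg
    by (simp add: S_def)
  have "(\<Sum>m\<in>keys ?g - {c}. single 0 (- 1) * single m (lookup ?g m)) = - S"
    by (simp add: S_def mult_single single_uminus sum_negf)
  then have "single c 1 + S + - S \<in> (spanned :: 'k mpoly set)"
    using spanned_add[OF spanned_theta_mon[OF v \<alpha>] s] unfolding g[symmetric] by simp
  then show ?case by simp
qed

lemma spanned_all: assumes "f \<in> polyring L" shows "f \<in> spanned"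
proof -
  have "single m (lookup f m) \<in> spanned" if "m \<in> keys f" for m
  proof (rule spanned_of_chain)
    show "keys m \<subseteq> L" using assms that by (simp add: polyring_def)
  qed (rule spanned_chain)
  then have "(\<Sum>m\<in>keys f. single m (lookup f m)) \<in> spanned" by (rule spanned_sum)
  then show ?thesis by (simp add: sum_single_keys)
qed

text \<open>A monomial in the fibre of the leading monomial straightens to that chain by
  \<open>chain_marg_unique\<close>. Minimality of \<open>spread\<close> excludes a proper
  straightening, and maximality of the sum of first coordinates excludes a monomial that is not
  leading.\<close>

lemma mcoeff_theta_mon:
  assumes v: "v \<in> corner_sets" "v0 \<in> corner_sets" and \<alpha>: "keys \<alpha> \<subseteq> E" "keys \<alpha>0 \<subseteq> E"
    and min: "spread (lead_mon \<alpha>0 v0) \<le> spread (lead_mon \<alpha> v)"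
    and max: "spread (lead_mon \<alpha>0 v0) = spread (lead_mon \<alpha> v) \<Longrightarrow> wsum fst (lead_mon \<alpha> v) \<le> wsum fst (lead_mon \<alpha>0 v0)"
  shows "mcoeff (marg (lead_mon \<alpha>0 v0)) (theta_mon \<alpha> v :: 'k::field mpoly) = (if \<alpha> = \<alpha>0 \<and> v = v0 then 1 else 0)"
proof -
  let ?g = "theta_mon \<alpha> v :: 'k mpoly" and ?c = "lead_mon \<alpha>0 v0"
  have mc: "m = ?c \<and> \<alpha> = \<alpha>0 \<and> v = v0" if m: "m \<in> keys ?g" "marg m = marg ?c" for m
  proof -
    note k = keys_theta_mon[OF v(1) \<alpha>(1) m(1)]
    obtain c' where c': "chain2 (keys c')" "marg c' = marg m" "c' = m \<or> spread m < spread c'"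
      using straighten[OF k(1)] by blast
    have cc: "c' = ?c" using chain_marg_unique[OF c'(1) keys_lead_mon(2)[OF v(2) \<alpha>(2)]] c'(2) m(2) by simp
    have sp: "spread m = spread (lead_mon \<alpha> v)" by (rule same_ranks_spread[OF k(2)])
    then have mc: "m = ?c" using c'(3) cc min by auto
    then have "?c = lead_mon \<alpha> v \<or> wsum fst ?c < wsum fst (lead_mon \<alpha> v)" using k(3) c'(1) cc by simp
    moreover have "spread ?c = spread (lead_mon \<alpha> v)" using sp mc by simp
    ultimately have "?c = lead_mon \<alpha> v" using max by auto
    then show ?thesis using mc lead_mon_inj[OF v \<alpha>] by simp
  qed
  show ?thesis
  proof (cases "\<alpha> = \<alpha>0 \<and> v = v0")
    case True
    have l: "lookup ?g ?c = 1" using lookup_theta_mon_lead_mon[OF v(1) \<alpha>(1), where 'k = 'k] True by simp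
    have "mcoeff (marg ?c) ?g = (\<Sum>m\<in>keys ?g. if m = ?c then 1 else 0)"
      unfolding mcoeff_def using mc l by (intro sum.cong refl) auto
    also have "\<dots> = 1" using l by (simp add: in_keys_iff)
    finally show ?thesis using True by simp
  next
    case False
    then have "marg m \<noteq> marg ?c" if "m \<in> keys ?g" for m using mc[OF that] by blast
    then have "mcoeff (marg ?c) ?g = 0" unfolding mcoeff_def by (intro sum.neutral) simp
    then show ?thesis using False by simp
  qed
qed

text \<open>Among all terms of a nontrivial relation choose one with least \<open>spread\<close>
  and, among those, largest sum of first coordinates. Applying \<open>mcoeff\<close> at its leading
  monomial isolates its coefficient, which must then vanish.\<close>

lemma independent:
  fixes p :: "pt set \<Rightarrow> 'k::field mpoly"
  assumes p: "\<And>v. v \<in> corner_sets \<Longrightarrow> p v \<in> polyring E" and J: "(\<Sum>v\<in>corner_sets. subst to_rank (p v) * single (corner_mon v) 1) \<in> J"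
  shows "\<forall>v\<in>corner_sets. p v = 0"
proof (rule ccontr)
  assume nz: "\<not> ?thesis"
  define T where "T = (SIGMA v:corner_sets. keys (p v))"
  define ld where "ld = (\<lambda>(v, \<alpha>). lead_mon \<alpha> v)"
  have finT: "finite T" unfolding T_def using finite_corner_sets by (intro finite_SigmaI) auto
  have T_ne: "T \<noteq> {}"
  proof -
    obtain v where "v \<in> corner_sets" "keys (p v) \<noteq> {}" using nz by auto
    then obtain \<alpha> where "(v, \<alpha>) \<in> T" unfolding T_def by blast
    then show ?thesis by blast
  qed
  have TE: "keys \<alpha> \<subseteq> E" if "(v, \<alpha>) \<in> T" for v \<alpha> using that p by (auto simp: T_def polyring_def)
  have "Min ((spread \<circ> ld) ` T) \<in> (spread \<circ> ld) ` T" using finT T_ne by (intro Min_in) auto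
  then obtain t1 where t1: "t1 \<in> T" "Min ((spread \<circ> ld) ` T) = spread (ld t1)" by auto
  have min: "spread (ld t1) \<le> spread (ld t)" if "t \<in> T" for t using that finT by (simp flip: t1(2))
  define T' where "T' = {t \<in> T. spread (ld t) = spread (ld t1)}"
  have "t1 \<in> T'" using t1(1) by (simp add: T'_def)
  moreover have "finite T'" using finT by (simp add: T'_def)
  ultimately have "Max ((wsum fst \<circ> ld) ` T') \<in> (wsum fst \<circ> ld) ` T'" by (intro Max_in) blast+
  then obtain t0 where t0: "t0 \<in> T'" "Max ((wsum fst \<circ> ld) ` T') = wsum fst (ld t0)" by auto
  have max: "wsum fst (ld t) \<le> wsum fst (ld t0)" if "t \<in> T'" for t
    using that finT by (simp add: T'_def flip: t0(2))
  obtain v0 \<alpha>0 where t0e: "t0 = (v0, \<alpha>0)" by fastforce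
  have t0T: "(v0, \<alpha>0) \<in> T" "spread (ld t0) = spread (ld t1)" using t0(1) by (auto simp: T'_def t0e)
  let ?h = "marg (lead_mon \<alpha>0 v0)"
  have mb: "mcoeff ?h (theta_mon \<alpha> v :: 'k mpoly) = (if \<alpha> = \<alpha>0 \<and> v = v0 then 1 else 0)" if t: "(v, \<alpha>) \<in> T" for v \<alpha>
  proof (rule mcoeff_theta_mon)
    show "v \<in> corner_sets" "v0 \<in> corner_sets" using t t0T by (auto simp: T_def)
    show "keys \<alpha> \<subseteq> E" "keys \<alpha>0 \<subseteq> E" using TE t t0T by auto
    show "spread (lead_mon \<alpha>0 v0) \<le> spread (lead_mon \<alpha> v)" using min[OF t] t0T(2) by (simp add: t0e ld_def)
    assume "spread (lead_mon \<alpha>0 v0) = spread (lead_mon \<alpha> v)"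
    then show "wsum fst (lead_mon \<alpha> v) \<le> wsum fst (lead_mon \<alpha>0 v0)"
      using max[of "(v, \<alpha>)"] t t0T(2) by (simp add: T'_def t0e ld_def)
  qed
  have "0 = mcoeff ?h (\<Sum>v\<in>corner_sets. subst to_rank (p v) * single (corner_mon v) 1)" using mcoeff_hibi_ideal[OF J] by simp
  also have "\<dots> = (\<Sum>v\<in>corner_sets. \<Sum>\<alpha>\<in>keys (p v). lookup (p v) \<alpha> * mcoeff ?h (theta_mon \<alpha> v))"
    by (simp add: subst_def sum_distrib_right mcoeff_sum mult.assoc theta_mon_def[symmetric] mcoeff_const_times)
  also have "\<dots> = (\<Sum>(v, \<alpha>)\<in>T. lookup (p v) \<alpha> * mcoeff ?h (theta_mon \<alpha> v))"
    unfolding T_def using finite_corner_sets by (intro sum.Sigma) auto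
  also have "\<dots> = (\<Sum>t\<in>T. if t = (v0, \<alpha>0) then lookup (p v0) \<alpha>0 else 0)"
  proof (intro sum.cong refl)
    fix t assume "t \<in> T"
    then show "(case t of (v, \<alpha>) \<Rightarrow> lookup (p v) \<alpha> * mcoeff ?h (theta_mon \<alpha> v)) =
        (if t = (v0, \<alpha>0) then lookup (p v0) \<alpha>0 else 0)"
      using mb[of "fst t" "snd t"] by (cases t) simp
  qed
  also have "\<dots> = lookup (p v0) \<alpha>0" using finT t0T by simp
  finally have "lookup (p v0) \<alpha>0 = 0" by simp
  then show False using t0T by (auto simp: T_def in_keys_iff)
qed

text \<open>Under \<open>from_rank\<close> the rank sum of rank r at most d becomes the single
  variable \<open>base_pt r\<close>. Freeness over the rank sums thereby takes the form of freeness
  over \<open>polyring E\<close>, as \<open>free_over\<close> requires.\<close>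

lemma free_over_rank_sums:
  "free_over L E (subst from_rank ` (J :: 'k::field mpoly set)) corner_sets (\<lambda>v. subst from_rank (single (corner_mon v) 1)) card {}"
proof
  show "finite L" "E \<subseteq> L" "finite corner_sets" "{} \<in> corner_sets" "card {} = 0"
    using fin E_L finite_corner_sets empty_corner_sets by simp_all
  show "subst from_rank (single (corner_mon {}) 1) = 1" by (simp add: corner_mon_def)
  have xL: "single (corner_mon v) 1 \<in> (polyring L :: 'k mpoly set)" if "v \<in> corner_sets" for v
    using that corner_sets_chain(2) corner_sets_finite keys_corner_mon by (intro polyring_single) auto
  show "subst from_rank (single (corner_mon v) 1 :: 'k mpoly) \<in> polyring L" if "v \<in> corner_sets" for v
    using xL[OF that] by (rule from_rank_polyring)
  show "homog (subst from_rank (single (corner_mon v) 1 :: 'k mpoly)) (int (card v))" if v: "v \<in> corner_sets" for v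
    by (rule homog_subst[OF xL[OF v]]) (auto simp: from_rank_homog mdeg_corner_mon[OF corner_sets_finite[OF v]] intro: homog_single)
  show "p + q \<in> subst from_rank ` J" if "p \<in> subst from_rank ` J" "q \<in> subst from_rank ` J" for p q :: "'k mpoly"
  proof -
    from that obtain i j where ij: "p = subst from_rank i" "i \<in> J" "q = subst from_rank j" "j \<in> J" by blast
    then have "p + q = subst from_rank (i + j)" by (simp add: subst_add)
    then show ?thesis using J_add[OF ij(2,4)] by blast
  qed
  show "p * q \<in> subst from_rank ` J" if "p \<in> polyring L" "q \<in> subst from_rank ` J" for p q :: "'k mpoly"
  proof -
    from that obtain j where j: "q = subst from_rank j" "j \<in> J" by blast
    then have "p * q = subst from_rank (subst to_rank p * j)" using that by (simp add: subst_times subst_from_rank_to_rank)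
    then show ?thesis using J_times[OF to_rank_polyring[OF that(1)] j(2)] by blast
  qed
  show "0 \<in> subst from_rank ` J" using J_0 by (metis image_eqI subst_0)
  show "subst from_rank ` J \<subseteq> polyring L" using J_L from_rank_polyring by blast
  show "hcomp e p \<in> subst from_rank ` J" if "p \<in> subst from_rank ` J" for p :: "'k mpoly" and e
  proof -
    from that obtain j where j: "p = subst from_rank j" "j \<in> J" by blast
    then have "hcomp e p = subst from_rank (hcomp e j)" using hcomp_subst[OF J_L[OF j(2)], of from_rank e, OF from_rank_homog] by simp
    then show ?thesis using J_hcomp[OF j(2)] by blast
  qed
  show "\<exists>p. (\<forall>v\<in>corner_sets. p v \<in> polyring E) \<and> f - (\<Sum>v\<in>corner_sets. p v * subst from_rank (single (corner_mon v) 1)) \<in> subst from_rank ` J"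
    if f: "f \<in> polyring L" for f :: "'k mpoly"
  proof -
    have "subst to_rank f \<in> spanned" using spanned_all[OF to_rank_polyring[OF f]] .
    then obtain p where p: "\<forall>v\<in>corner_sets. p v \<in> polyring E"
      "subst to_rank f - (\<Sum>v\<in>corner_sets. subst to_rank (p v) * single (corner_mon v) 1) \<in> J" by (auto simp: spanned_def)
    have "p v \<in> polyring L" if "v \<in> corner_sets" for v using p that polyring_mono[OF E_L] by blast
    then have "subst from_rank (subst to_rank f - (\<Sum>v\<in>corner_sets. subst to_rank (p v) * single (corner_mon v) 1)) =
        f - (\<Sum>v\<in>corner_sets. p v * subst from_rank (single (corner_mon v) 1))"
      by (simp add: subst_diff subst_sum subst_times subst_from_rank_to_rank[OF f] subst_from_rank_to_rank)
    then have "f - (\<Sum>v\<in>corner_sets. p v * subst from_rank (single (corner_mon v) 1)) \<in> subst from_rank ` J"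
      using imageI[OF p(2), of "subst from_rank"] by simp
    then show ?thesis using p(1) by blast
  qed
  show "\<forall>v\<in>corner_sets. p v = 0" if p: "\<And>v. v \<in> corner_sets \<Longrightarrow> p v \<in> polyring E"
    "(\<Sum>v\<in>corner_sets. p v * subst from_rank (single (corner_mon v) 1)) \<in> subst from_rank ` J" for p :: "pt set \<Rightarrow> 'k mpoly"
  proof -
    obtain j where j: "(\<Sum>v\<in>corner_sets. p v * subst from_rank (single (corner_mon v) 1)) = subst from_rank j" "j \<in> J" using p(2) by blast
    have "(\<Sum>v\<in>corner_sets. subst to_rank (p v) * single (corner_mon v) 1) = subst to_rank (\<Sum>v\<in>corner_sets. p v * subst from_rank (single (corner_mon v) 1))"
      by (simp add: subst_sum subst_times subst_to_rank_from_rank[OF xL])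
    also have "\<dots> = subst to_rank (subst from_rank j)" by (simp only: j(1))
    also have "\<dots> = j" by (rule subst_to_rank_from_rank[OF J_L[OF j(2)]])
    finally have "(\<Sum>v\<in>corner_sets. subst to_rank (p v) * single (corner_mon v) 1) \<in> J" using j(2) by simp
    then show ?thesis using independent[of p] p(1) by blast
  qed
qed

lemma graded_res_transfer:
  assumes "graded_res L (subst from_rank ` (J :: 'k::field mpoly set)) r a D"
  shows "graded_free_resolution L r a (\<lambda>i l k. subst to_rank (D i l k))"
proof -
  have "subst to_rank ` (subst from_rank ` (J :: 'k mpoly set) \<inter> polyring L) = J"
  proof -
    have "subst from_rank ` (J :: 'k mpoly set) \<inter> polyring L = subst from_rank ` J" using J_L from_rank_polyring by blast
    then show ?thesis using subst_to_rank_from_rank J_L by (force simp: image_image)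
  qed
  moreover have "graded_res L (subst to_rank ` (subst from_rank ` (J :: 'k mpoly set) \<inter> polyring L)) r a (\<lambda>i l k. subst to_rank (D i l k))"
    using to_rank_L to_rank_homog by (intro graded_res_subst[OF assms _ from_rank_L to_rank_from_rank from_rank_to_rank]) auto
  ultimately show ?thesis by (simp add: graded_free_resolution_iff)
qed

end

section \<open>Stacks of squares\<close>

lemma lt2_rk: "lt2 x y \<Longrightarrow> rk x < rk y"
  using le2_rk_le[of x y] le2_rk_eq[of x y] by (auto simp: lt2_def not_le[symmetric])

definition incr :: "pt list \<Rightarrow> bool" where
  "incr xs \<longleftrightarrow> (\<forall>k. Suc k < length xs \<longrightarrow> lt2 (xs ! k) (xs ! Suc k))"

lemma incr_rk: "incr xs \<Longrightarrow> k < l \<Longrightarrow> l < length xs \<Longrightarrow> rk (xs ! k) < rk (xs ! l)"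
proof (induction l)
  case (Suc l)
  then have "rk (xs ! l) < rk (xs ! Suc l)" by (auto simp: incr_def intro: lt2_rk)
  with Suc show ?case by (cases "k = l") auto
qed simp

lemma incr_length:
  assumes "finite C" "set xs \<subseteq> C" "incr xs" shows "length xs \<le> card C"
proof -
  have "distinct xs" unfolding distinct_conv_nth
    using incr_rk[OF assms(3)] by (metis less_irrefl linorder_neqE_nat)
  then show ?thesis using card_mono[OF assms(1,2)] by (simp add: distinct_card)
qed

lemma incr_snoc:
  assumes "incr xs" "xs \<noteq> []" "lt2 (last xs) y" shows "incr (xs @ [y])"
  unfolding incr_def
proof (intro allI impI)
  fix k assume k: "Suc k < length (xs @ [y])"
  show "lt2 ((xs @ [y]) ! k) ((xs @ [y]) ! Suc k)"
  proof (cases "Suc k < length xs")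
    case True
    then show ?thesis using assms(1) by (simp add: incr_def nth_append)
  next
    case False
    then have "k = length xs - 1" using k assms(2) by simp
    then show ?thesis using assms(2,3) by (simp add: nth_append last_conv_nth)
  qed
qed

lemma incr_butlast: "incr xs \<Longrightarrow> incr (butlast xs)"
  by (simp add: incr_def nth_butlast)

context
  fixes C :: "pt set" assumes fin: "finite C"
begin

lemma rank_in_ge:
  assumes "xs \<noteq> []" "set xs \<subseteq> C" "incr xs" shows "length xs - 1 \<le> rank_in C (last xs)"
proof -
  let ?S = "{length ys - 1 | ys. ys \<noteq> [] \<and> set ys \<subseteq> C \<and> last ys = last xs \<and> incr ys}"
  have "?S \<subseteq> {..card C}" using incr_length[OF fin] by fastforce
  then have "finite ?S" using finite_subset by blast
  moreover have "length xs - 1 \<in> ?S" using assms by blast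
  ultimately show ?thesis unfolding rank_in_def incr_def[symmetric] by (rule Max_ge)
qed

lemma rank_in_chain:
  assumes "x \<in> C"
  obtains xs where "xs \<noteq> []" "set xs \<subseteq> C" "incr xs" "last xs = x" "length xs - 1 = rank_in C x"
proof -
  let ?S = "{length ys - 1 | ys. ys \<noteq> [] \<and> set ys \<subseteq> C \<and> last ys = x \<and> incr ys}"
  have "?S \<subseteq> {..card C}" using incr_length[OF fin] by fastforce
  then have "finite ?S" using finite_subset by blast
  moreover have "length [x] - 1 \<in> ?S" using assms by (intro CollectI exI[of _ "[x]"]) (auto simp: incr_def)
  ultimately have "Max ?S \<in> ?S" by (intro Max_in) auto
  moreover have "rank_in C x = Max ?S" by (simp add: rank_in_def incr_def)
  ultimately have "rank_in C x \<in> ?S" by simp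
  then obtain xs where "rank_in C x = length xs - 1" "xs \<noteq> []" "set xs \<subseteq> C" "last xs = x" "incr xs" by blast
  then show ?thesis using that[of xs] by simp
qed

lemma rank_in_less:
  assumes "x \<in> C" "y \<in> C" "lt2 x y" shows "rank_in C x < rank_in C y"
proof -
  obtain xs where xs: "xs \<noteq> []" "set xs \<subseteq> C" "incr xs" "last xs = x" "length xs - 1 = rank_in C x"
    using rank_in_chain[OF assms(1)] .
  have "length (xs @ [y]) - 1 \<le> rank_in C (last (xs @ [y]))"
    using xs assms by (intro rank_in_ge incr_snoc) auto
  moreover have "length xs = Suc (rank_in C x)" using xs(1,5) by (cases xs) auto
  ultimately show ?thesis by simp
qed

text \<open>Every other element lies below a or above b, so its rank in C is smaller than that of a
  or larger than that of b. No rank lies in between, because the predecessor of b in a longest chain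
  lies below a.\<close>

lemma cut_edgeI:
  assumes ab: "a \<in> C" "b \<in> C" "lt2 a b" and cut: "\<And>x. x \<in> C \<Longrightarrow> le2 x a \<or> le2 b x"
  shows "cut_edge C a b"
proof -
  have le: "rank_in C x \<le> rank_in C y" if "x \<in> C" "y \<in> C" "le2 x y" for x y
    using rank_in_less[of x y] that by (cases "x = y") (auto simp: lt2_def)
  have nab: "\<not> le2 b a" using lt2_rk[OF ab(3)] le2_rk_le[of b a] by auto
  have lower: "lt2 x b \<Longrightarrow> x \<in> C \<Longrightarrow> le2 x a" for x
    using cut[of x] lt2_rk[of x b] le2_rk_le[of b x] by auto
  have "covers C a b"
    unfolding covers_def
  proof (intro conjI ab notI)
    assume "\<exists>c\<in>C. lt2 a c \<and> lt2 c b"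
    then obtain c where c: "c \<in> C" "lt2 a c" "lt2 c b" by blast
    then have "le2 c a" using lower by blast
    then show False using le2_rk_le[of c a] lt2_rk[OF c(2)] by simp
  qed
  moreover have r: "rank_in C b = rank_in C a + 1"
  proof -
    have 1: "rank_in C a < rank_in C b" by (rule rank_in_less[OF ab])
    obtain xs where xs: "xs \<noteq> []" "set xs \<subseteq> C" "incr xs" "last xs = b" "length xs - 1 = rank_in C b"
      using rank_in_chain[OF ab(2)] .
    \<comment> \<open>Dropping b from a longest chain to b leaves a chain that ends below a, which
      bounds its length by the rank of a.\<close>
    define ys where "ys = butlast xs"
    have ly: "length ys = rank_in C b" using xs(5) by (simp add: ys_def)
    then have yne: "ys \<noteq> []" using 1 by auto
    then have xy: "xs = ys @ [b]" using xs(1,4) by (metis append_butlast_last_id ys_def)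
    have ysC: "set ys \<subseteq> C" using xs(2) xy by auto
    have "lt2 (last ys) b"
    proof -
      have "Suc (length ys - 1) < length xs" using yne xy by simp
      then have "lt2 (xs ! (length ys - 1)) (xs ! Suc (length ys - 1))" using xs(3) by (simp add: incr_def)
      then show ?thesis using yne by (simp add: xy nth_append last_conv_nth)
    qed
    moreover have lC: "last ys \<in> C" using ysC yne last_in_set by blast
    ultimately have "le2 (last ys) a" using lower by blast
    then have "rank_in C (last ys) \<le> rank_in C a" using le lC ab by blast
    moreover have "length ys - 1 \<le> rank_in C (last ys)"
      using yne ysC xs(3) by (intro rank_in_ge) (auto simp: ys_def incr_butlast)
    ultimately show ?thesis using 1 ly by simp
  qed
  moreover have "c = a" if c: "c \<in> C" "rank_in C c = rank_in C a" for c
  proof -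
    have "\<not> le2 b c" using le[of b c] c ab r by auto
    then have "le2 c a" using cut c by blast
    then show ?thesis using rank_in_less[of c a] c ab by (auto simp: lt2_def)
  qed
  moreover have "c = b" if c: "c \<in> C" "rank_in C c = rank_in C b" for c
  proof -
    have "\<not> le2 c a" using le[of c a] c ab r by auto
    then have "le2 b c" using cut c by blast
    then show ?thesis using rank_in_less[of b c] c ab by (auto simp: lt2_def)
  qed
  ultimately show ?thesis unfolding cut_edge_def using ab by blast
qed

end

context planar
begin

section \<open>Squares, corner sets and cyclic sublattices\<close>

lemma covers_rk:
  assumes "covers L a b" shows "a \<in> L" "b \<in> L" "le2 a b" "rk b = rk a + 1"
proof -
  show L: "a \<in> L" "b \<in> L" and le: "le2 a b" using assms by (auto simp: covers_def lt2_def)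
  have lt: "rk a < rk b" using assms lt2_rk by (auto simp: covers_def)
  show "rk b = rk a + 1"
  proof (rule ccontr)
    assume n: "rk b \<noteq> rk a + 1"
    obtain z where z: "z \<in> L" "le2 a z" "le2 z b" "rk z = rk a + 1" using between[OF L le, of "rk a + 1"] lt by auto
    then have "lt2 a z" "lt2 z b" using n by (auto simp: lt2_def)
    then show False using assms z(1) by (auto simp: covers_def)
  qed
qed

lemma step_cases: "le2 a b \<Longrightarrow> rk b = rk a + 1 \<Longrightarrow> b = (fst a + 1, snd a) \<or> b = (fst a, snd a + 1)"
  by (cases a; cases b) (auto simp: le2_def rk_def)

lemma covers_cases: "covers L a b \<Longrightarrow> b = (fst a + 1, snd a) \<or> b = (fst a, snd a + 1)"
  using covers_rk step_cases by blast

lemma square_corner: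
  assumes "is_square L q"
  shows "\<exists>b\<in>corner_pts. sq_bot q = (fst b, snd b - 1) \<and> sq_top q = (fst b + 1, snd b)"
proof -
  obtain a b c e where q: "q = (a, b, c, e)" by (metis prod_cases4)
  have cov: "covers L a b" "covers L b e" "covers L a c" "covers L c e" and inc: "\<not> le2 b c" "\<not> le2 c b"
    using assms by (auto simp: is_square_def q)
  have L: "a \<in> L" "b \<in> L" "c \<in> L" "e \<in> L" using covers_rk cov by blast+
  define b0 where "b0 = (fst a, snd a + 1)"
  have bc: "(b = (fst a + 1, snd a) \<and> c = b0) \<or> (c = (fst a + 1, snd a) \<and> b = b0)"
    using covers_cases[OF cov(1)] covers_cases[OF cov(3)] inc by (auto simp: b0_def)
  then have "e = (fst a + 1, snd a + 1)" using covers_cases[OF cov(2)] covers_cases[OF cov(4)] by (auto simp: b0_def)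
  moreover from this have "b0 \<in> corner_pts" using L bc by (auto simp: corner_pts_def b0_def)
  ultimately show ?thesis by (intro bexI[of _ b0]) (auto simp: q sq_bot_def sq_top_def b0_def)
qed

definition sq :: "pt \<Rightarrow> pt \<times> pt \<times> pt \<times> pt" where
  "sq b = ((fst b, snd b - 1), b, (fst b + 1, snd b - 1), (fst b + 1, snd b))"

lemma sq_simps: "sq_bot (sq b) = (fst b, snd b - 1)" "sq_top (sq b) = (fst b + 1, snd b)"
  "sq_set (sq b) = {(fst b, snd b - 1), b, (fst b + 1, snd b - 1), (fst b + 1, snd b)}"
  by (auto simp: sq_def sq_bot_def sq_top_def sq_set_def)

lemma sq_bounds: "x \<in> sq_set (sq b) \<Longrightarrow> le2 (sq_bot (sq b)) x \<and> le2 x (sq_top (sq b))"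
  by (auto simp: sq_simps le2_def)

lemma sq_sublattice: "is_sublattice2 (sq_set (sq b))"
  by (cases b) (auto simp: sq_simps is_sublattice2_def join2_def meet2_def max_def min_def)

lemma is_square_sq: assumes "b \<in> corner_pts" shows "is_square L (sq b)"
proof -
  have cov: "covers L x y" if "x \<in> L" "y \<in> L" "le2 x y" "rk y = Suc (rk x)" for x y
  proof -
    have "\<not> (lt2 x z \<and> lt2 z y)" for z using lt2_rk[of x z] lt2_rk[of z y] that(4) by auto
    moreover have "x \<noteq> y" using that(4) by auto
    ultimately show ?thesis using that by (auto simp: covers_def lt2_def)
  qed
  have "is_sublattice2 {(fst b, snd b - 1), b, (fst b + 1, snd b - 1), (fst b + 1, snd b)}"
    using sq_sublattice[of b] by (simp add: sq_simps)
  moreover have "\<not> le2 b (fst b + 1, snd b - 1)" "\<not> le2 (fst b + 1, snd b - 1) b"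
    using assms by (auto simp: le2_def corner_pts_def)
  ultimately show ?thesis
    unfolding is_square_def sq_def prod.case using assms
    by (intro conjI cov) (auto simp: corner_pts_def le2_def rk_def)
qed

text \<open>A connecting chain ascends, so the top of a square lies below the bottom of the next
  one; in terms of the upper left corners this says that both coordinates increase strictly.\<close>

lemma cyclic_imp_corner_sets:
  assumes "cyclic_sublattice L C n" shows "\<exists>v\<in>corner_sets. card v = n"
proof -
  obtain q ch where q: "\<And>i. i < n \<Longrightarrow> is_square L (q i)"
    and ch: "\<And>i. Suc i < n \<Longrightarrow> ch i \<noteq> [] \<and> hd (ch i) = sq_top (q i) \<and> last (ch i) = sq_bot (q (Suc i)) \<and>
           (\<forall>k. Suc k < length (ch i) \<longrightarrow> cut_edge C (ch i ! k) (ch i ! Suc k))"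
    using assms unfolding cyclic_sublattice_def by blast
  obtain b where b: "\<And>i. i < n \<Longrightarrow> b i \<in> corner_pts \<and> sq_bot (q i) = (fst (b i), snd (b i) - 1) \<and>
      sq_top (q i) = (fst (b i) + 1, snd (b i))"
    using square_corner[OF q] by metis
  have step: "fst (b i) < fst (b (Suc i)) \<and> snd (b i) < snd (b (Suc i))" if i: "Suc i < n" for i
  proof -
    have "le2 (ch i ! 0) (ch i ! k)" if "k < length (ch i)" for k
      using that
    proof (induction k)
      case (Suc k)
      have "le2 (ch i ! k) (ch i ! Suc k)" using ch[OF i] Suc.prems by (auto simp: cut_edge_def covers_def lt2_def)
      then show ?case using Suc le2_trans Suc_lessD by blast
    qed simp
    moreover have c: "ch i \<noteq> []" "hd (ch i) = sq_top (q i)" "last (ch i) = sq_bot (q (Suc i))"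
      using ch[OF i] by auto
    then have "length (ch i) - 1 < length (ch i)" by simp
    ultimately have "le2 (ch i ! 0) (ch i ! (length (ch i) - 1))" by blast
    then have "le2 (hd (ch i)) (last (ch i))" using c(1) by (simp add: hd_conv_nth last_conv_nth)
    then have "le2 (sq_top (q i)) (sq_bot (q (Suc i)))" by (simp only: c)
    moreover have "snd (b (Suc i)) \<ge> 1" using b[OF i] by (simp add: corner_pts_def)
    ultimately show ?thesis using b[OF i] b[of i] i by (auto simp: le2_def)
  qed
  have mono: "fst (b i) < fst (b j) \<and> snd (b i) < snd (b j)" if "i < j" "j < n" for i j
    using that
  proof (induction j)
    case (Suc j)
    then show ?case using step[of j] by (cases "i = j") auto
  qed simp
  have "inj_on b {..<n}" by (rule linorder_inj_onI) (use mono in force)+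
  then have "card (b ` {..<n}) = n" by (simp add: card_image)
  moreover have "b ` {..<n} \<in> corner_sets"
  proof -
    have "b i = b j \<or> (fst (b i) < fst (b j) \<and> snd (b i) < snd (b j)) \<or> (fst (b j) < fst (b i) \<and> snd (b j) < snd (b i))"
      if "i < n" "j < n" for i j
      using mono[of i j] mono[of j i] that by (cases i j rule: linorder_cases) auto
    then show ?thesis using b by (auto simp: corner_sets_def)
  qed
  ultimately show ?thesis by blast
qed

text \<open>Take for C the union of the squares alone. Cut edges are those of C and not of L, so the
  top of a square and a different bottom of the next one are joined by a single cut edge even if
  they are far apart in L.\<close>

lemma corner_sets_imp_cyclic:
  assumes v: "v \<in> corner_sets" shows "\<exists>C. cyclic_sublattice L C (card v)"
proof -
  define bs where "bs = sorted_list_of_set v"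
  define n where "n = card v"
  have finv: "finite v" by (rule corner_sets_finite[OF v])
  have len: "length bs = n" and bsv: "set bs = v" using finv by (simp_all add: bs_def n_def)
  have bv: "bs ! i \<in> v" if "i < n" for i using that len bsv nth_mem by blast
  have bB: "bs ! i \<in> corner_pts" if "i < n" for i using bv[OF that] v by (auto simp: corner_sets_def)
  have mono: "fst (bs ! i) < fst (bs ! j) \<and> snd (bs ! i) < snd (bs ! j)" if ij: "i < j" "j < n" for i j
  proof -
    \<comment> \<open>The list is sorted lexicographically, which on a corner set agrees with the
      order of both coordinates.\<close>
    have "bs ! i < bs ! j" using strict_sorted_list_of_set[of v] ij len
      unfolding bs_def[symmetric] sorted_wrt_iff_nth_less by blast
    then have "bs ! i \<noteq> bs ! j" "\<not> fst (bs ! j) < fst (bs ! i)" by (auto simp: less_prod_def)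
    moreover have "bs ! i \<in> v" "bs ! j \<in> v" using bv ij by auto
    ultimately show ?thesis using v unfolding corner_sets_def by blast
  qed
  define q where "q i = sq (bs ! i)" for i
  have tb: "le2 (sq_top (q i)) (sq_bot (q j))" if "i < j" "j < n" for i j
    using mono[OF that] by (auto simp: q_def sq_simps le2_def)
  \<comment> \<open>The chain is a single point if the two squares touch, as hd and last then have
    to coincide.\<close>
  define ch where "ch i = (if sq_top (q i) = sq_bot (q (Suc i)) then [sq_top (q i)]
    else [sq_top (q i), sq_bot (q (Suc i))])" for i
  define C where "C = (\<Union>i<n. sq_set (q i))"
  have qL: "is_square L (q i)" if "i < n" for i using is_square_sq[OF bB[OF that]] by (simp add: q_def)
  have qsL: "sq_set (q i) \<subseteq> L" if "i < n" for i using bB[OF that] by (auto simp: q_def sq_simps corner_pts_def)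
  have bnd: "le2 (sq_bot (q i)) x" "le2 x (sq_top (q i))" if "x \<in> sq_set (q i)" for x i
    using sq_bounds that by (auto simp: q_def)
  have ends: "sq_bot (q i) \<in> sq_set (q i)" "sq_top (q i) \<in> sq_set (q i)" for i
    by (auto simp: q_def sq_simps)
  have CL: "C \<subseteq> L" using qsL by (auto simp: C_def)
  have finC: "finite C" using CL fin finite_subset by blast
  have "is_sublattice2 C"
    unfolding is_sublattice2_def
  proof (intro ballI)
    fix x y assume "x \<in> C" "y \<in> C"
    then obtain i j where ij: "i < n" "j < n" "x \<in> sq_set (q i)" "y \<in> sq_set (q j)" by (auto simp: C_def)
    have "join2 x y \<in> sq_set (q i) \<union> sq_set (q j) \<and> meet2 x y \<in> sq_set (q i) \<union> sq_set (q j)"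
    proof (cases "i = j")
      case True
      then show ?thesis using sq_sublattice ij by (auto simp: is_sublattice2_def q_def)
    next
      case False
      then consider "i < j" | "j < i" by linarith
      then have "le2 x y \<or> le2 y x"
        using tb[of i j] tb[of j i] bnd ij le2_trans by cases metis+
      then have "join2 x y \<in> {x, y} \<and> meet2 x y \<in> {x, y}"
        by (cases x; cases y) (auto simp: le2_def join2_def meet2_def max_def min_def)
      then show ?thesis using ij by auto
    qed
    then show "join2 x y \<in> C \<and> meet2 x y \<in> C" using ij by (auto simp: C_def)
  qed
  moreover have "ch i \<noteq> [] \<and> hd (ch i) = sq_top (q i) \<and> last (ch i) = sq_bot (q (Suc i)) \<and>
      (\<forall>k. Suc k < length (ch i) \<longrightarrow> cut_edge C (ch i ! k) (ch i ! Suc k))" if i: "Suc i < n" for i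
  proof -
    have "cut_edge C (sq_top (q i)) (sq_bot (q (Suc i)))" if ne: "sq_top (q i) \<noteq> sq_bot (q (Suc i))"
    proof (rule cut_edgeI[OF finC])
      have "i < n" using i by simp
      then show "sq_top (q i) \<in> C" using ends by (auto simp: C_def)
      show "sq_bot (q (Suc i)) \<in> C" using ends i by (auto simp: C_def)
      show "lt2 (sq_top (q i)) (sq_bot (q (Suc i)))" using ne tb[of i "Suc i"] i by (simp add: lt2_def)
      fix x assume "x \<in> C"
      then obtain j where j: "j < n" "x \<in> sq_set (q j)" by (auto simp: C_def)
      show "le2 x (sq_top (q i)) \<or> le2 (sq_bot (q (Suc i))) x"
      proof (cases "j \<le> i")
        case True
        have "le2 (sq_top (q j)) (sq_top (q i))"
          using le2_trans[OF tb[of j i] bnd(1)[OF ends(2)]] True \<open>i < n\<close> by (cases "j = i") auto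
        then show ?thesis using bnd(2)[OF j(2)] le2_trans by blast
      next
        case False
        have "le2 (sq_bot (q (Suc i))) (sq_bot (q j))"
          using le2_trans[OF bnd(1)[OF ends(2)] tb[of "Suc i" j]] False j(1) by (cases "j = Suc i") auto
        then show ?thesis using bnd(1)[OF j(2)] le2_trans by blast
      qed
    qed
    then show ?thesis by (auto simp: ch_def less_Suc_eq)
  qed
  moreover have "C = (\<Union>i<n. sq_set (q i)) \<union> (\<Union>i\<in>{i. Suc i < n}. set (ch i))"
  proof -
    have "set (ch i) \<subseteq> C" if "Suc i < n" for i
    proof -
      have "i < n" using that by simp
      then have "sq_top (q i) \<in> C" "sq_bot (q (Suc i)) \<in> C"
        unfolding C_def using ends that by blast+
      then show ?thesis by (simp add: ch_def)
    qed
    then show ?thesis by (auto simp: C_def)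
  qed
  ultimately show ?thesis unfolding cyclic_sublattice_def n_def[symmetric] using CL qL by blast
qed

lemma max_cyclic_squares_corner_sets: "max_cyclic_squares L = Max (card ` corner_sets)"
proof -
  have "{m. \<exists>C. cyclic_sublattice L C m} = card ` corner_sets"
    using cyclic_imp_corner_sets corner_sets_imp_cyclic by blast
  then show ?thesis by (simp add: max_cyclic_squares_def)
qed

text \<open>The upper left and lower right points of a square have the same rank, while
  \<open>E\<close> has one point per rank. So the last Koszul position is positive, as
  \<open>generator_degree_unavoidable\<close> needs.\<close>

lemma off_basis_nonempty: assumes "b \<in> corner_pts" shows "L - E \<noteq> {}"
proof
  assume "L - E = {}"
  then have "b \<in> E" "(fst b + 1, snd b - 1) \<in> E" using assms by (auto simp: corner_pts_def)
  moreover have "rk (fst b + 1, snd b - 1) = rk b" using assms by (auto simp: corner_pts_def rk_def)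
  ultimately have "b = (fst b + 1, snd b - 1)" using E_unique by metis
  then show False by (metis Suc_eq_plus1 fst_conv n_not_Suc_n)
qed

section \<open>The regularity as an attained minimum\<close>

lemma reg_set_finite:
  assumes "graded_free_resolution L r a D" shows "finite {a i k - int i | i k. k < r i}"
proof -
  obtain n where n: "\<And>i. i > n \<Longrightarrow> r i = 0" using assms by (auto simp: graded_free_resolution_def)
  have "{a i k - int i | i k. k < r i} \<subseteq> (\<lambda>(i, k). a i k - int i) ` (SIGMA i:{..n}. {..<r i})"
  proof
    fix x assume "x \<in> {a i k - int i | i k. k < r i}"
    then obtain i k where x: "x = a i k - int i" "k < r i" by blast
    then have "i \<le> n" using n[of i] by (metis less_nat_zero_code linorder_not_le)
    then show "x \<in> (\<lambda>(i, k). a i k - int i) ` (SIGMA i:{..n}. {..<r i})"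
      using x by (intro image_eqI[of _ _ "(i, k)"]) auto
  qed
  then show ?thesis by (rule finite_subset) (intro finite_imageI finite_SigmaI; simp)
qed

text \<open>The degrees of the constructed resolution bound its regularity from above. The lower
  bound holds for every resolution, in particular for this one, so the infimum is an attained
  minimum.\<close>

lemma regularity:
  "reg_hibi TYPE('k::field) L = int (Max (card ` corner_sets))"
proof -
  define m where "m = Max (card ` corner_sets)"
  have m: "card v \<le> m" if "v \<in> corner_sets" for v using that finite_corner_sets by (simp add: m_def)
  have "m \<in> card ` corner_sets" unfolding m_def using finite_corner_sets empty_corner_sets by (intro Max_in) auto
  then obtain u where u: "u \<in> corner_sets" "card u = m" by auto
  interpret F: free_over L E "subst from_rank ` (J :: 'k mpoly set)" corner_sets "\<lambda>v. subst from_rank (single (corner_mon v) 1)" card "{}"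
    by (rule free_over_rank_sums)
  have lower: "int m \<le> resolution_reg r a" if G: "graded_free_resolution L r a (D :: nat \<Rightarrow> nat \<Rightarrow> nat \<Rightarrow> 'k mpoly)" for r a D
  proof -
    have "\<exists>i k. k < r i \<and> a i k - int i = int m"
    proof (cases "m = 0")
      \<comment> \<open>For m = 0 the generator of degree 0 in position 0 already gives the
        bound.\<close>
      case True
      then show ?thesis using G by (intro exI[of _ 0]) (auto simp: graded_free_resolution_def)
    next
      case False
      then have "u \<noteq> {}" using u by auto
      then obtain b where "b \<in> corner_pts" using u(1) by (auto simp: corner_sets_def)
      then have "card (L - E) \<noteq> 0" using off_basis_nonempty fin by simp
      then obtain c where c: "card (L - E) = Suc c" using not0_implies_Suc by blast
      have m1: "m \<ge> 1" using False by simp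
      obtain r' a' D' k where F: "graded_res L (subst from_rank ` (J :: 'k mpoly set)) r' a' D'"
        "\<And>i k. k < r' i \<Longrightarrow> a' i k \<le> int i + int m" "k < r' (Suc c)" "a' (Suc c) k = int (Suc c + m)"
        "\<And>k. k < r' (Suc (Suc c)) \<Longrightarrow> a' (Suc (Suc c)) k \<noteq> int (Suc c + m)"
        by (rule F.resolution_top_generator[OF _ u m1 c]) (rule m, assumption, rule that)
      have "\<exists>k'<r (Suc c). a (Suc c) k' = a' (Suc c) k"
      proof (rule generator_degree_unavoidable)
        show "graded_res L (J :: 'k mpoly set) r a D" using G by (simp add: graded_free_resolution_iff)
        show "graded_res L (J :: 'k mpoly set) r' a' (\<lambda>i l k. subst to_rank (D' i l k))"
          using graded_res_transfer[OF F(1)] by (simp add: graded_free_resolution_iff)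
        \<comment> \<open>One position lower the degrees are at most \<open>c + m\<close>, one less
          than that of the chosen generator.\<close>
        show "a' c l \<noteq> a' (Suc c) k" if "l < r' c" for l using F(2)[OF that] F(4) by simp
      qed (use F in auto)
      then show ?thesis using F(4) by force
    qed
    then have "int m \<in> {a i k - int i | i k. k < r i}" by (metis (mono_tags, lifting) mem_Collect_eq)
    then show ?thesis unfolding resolution_reg_def using reg_set_finite[OF G] by (intro Max_ge)
  qed
  obtain r a D where F: "graded_res L (subst from_rank ` (J :: 'k mpoly set)) r a D"
    "\<And>i k. k < r i \<Longrightarrow> a i k \<le> int i + int m"
    using F.resolution_regularity_le[OF m] by auto
  note F' = graded_res_transfer[OF F(1)]
  have "resolution_reg r a \<le> int m"
    unfolding resolution_reg_def
  proof (rule Max.boundedI[OF reg_set_finite[OF F']])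
    have "0 < r 0" using F' by (simp add: graded_free_resolution_def)
    then show "{a i k - int i | i k. k < r i} \<noteq> {}" by blast
    show "x \<le> int m" if "x \<in> {a i k - int i | i k. k < r i}" for x using that F(2) by fastforce
  qed
  then have "resolution_reg r a = int m" using lower[OF F'] by simp
  then have "int m \<in> {resolution_reg r a | r a (D :: nat \<Rightarrow> nat \<Rightarrow> nat \<Rightarrow> 'k mpoly). graded_free_resolution L r a D}"
    using F' by (intro CollectI) metis
  then have "Inf {resolution_reg r a | r a (D :: nat \<Rightarrow> nat \<Rightarrow> nat \<Rightarrow> 'k mpoly). graded_free_resolution L r a D} = int m"
    by (rule cInf_eq_minimum) (use lower in auto)
  then show ?thesis by (simp add: reg_hibi_def m_def)
qed

end

theorem theorem4:
  fixes L :: "(nat \<times> nat) set"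
  assumes "planar_distributive_lattice L"
    and "simple_lattice L"
  shows "reg_hibi TYPE('k::field) L = int (max_cyclic_squares L)"
proof -
  interpret planar L by unfold_locales (rule assms(1))
  show ?thesis by (simp only: regularity max_cyclic_squares_corner_sets)
qed

end
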